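(* Let $n\ge 1$ and let $h\colon [n]\to[n]$ be an indecomposable Hessenberg function. For every $w\in\mathfrak{S}_n$, the ring $\mathbb{C}[\mathbf{x}_w]/J_{w,h}$ is the coordinate ring of the subvariety $\mathcal{N}_{w,h}:=\mathrm{Hess}(N,h)\cap\mathcal{N}_w$ of $\mathcal{N}_w$. In particular, the ideal $J_{w,h}$ is radical and is the defining ideal of $\mathcal{N}_{w,h}$ in $\mathcal{N}_w$.
   Context: Write $[n]=\{1,\dots,n\}$. A Hessenberg function is a function $h\colon[n]\to[n]$ with $h(i)\ge i$ for all $i$ and $h(i+1)\ge h(i)$ for $1\le i<n$. It is indecomposable if $h(j)\ge j+1$ for all $j\in\{1,\dots,n-1\}$. Set $H(h)=\{(a_{i,j})\in\mathfrak{gl}_n(\mathbb{C}) \mid a_{i,j}=0 \text{ if } i>h(j)\}$. Let $B\subset \mathrm{GL}_n(\mathbb{C})$ be the upper-triangular matrices and $\mathrm{Flags}(\mathbb{C}^n)=\mathrm{GL}_n(\mathbb{C})/B$. Let $N$ be the $n\times n$ nilpotent matrix with $1$'s on the superdiagonal and $0$'s elsewhere. The regular nilpotent Hessenberg variety is the (reduced) closed subvariety $\mathrm{Hess}(N,h)=\{MB\in\mathrm{GL}_n(\mathbb{C})/B \mid M^{-1}NM\in H(h)\}$. For $w\in\mathfrak{S}_n$, identify $w$ with its permutation matrix (with $1$'s in positions $(w(j),j)$). Let $U^-$ be the set of lower-triangular $n\times n$ matrices with $1$'s on the diagonal, and let $\mathcal{N}_w=\{wMB\mid M\in U^-\}\subset\mathrm{Flags}(\mathbb{C}^n)$,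 an open subset isomorphic to $U^-\cong\mathbb{A}^{n(n-1)/2}$ via $M\mapsto wMB$. A point of $\mathcal{N}_w$ is thus uniquely given by a matrix $X=wM=(x_{i,j})$ with $x_{w(j),j}=1$ for all $j$ and $x_{w(i),j}=0$ for all $j>i$. The coordinate ring $\mathbb{C}[\mathbf{x}_w]$ of $\mathcal{N}_w$ is the polynomial ring in the remaining $n(n-1)/2$ entries $x_{i,j}$. For $i>h(j)$ let $f^w_{i,j}:=(X^{-1}NX)_{i,j}\in\mathbb{C}[\mathbf{x}_w]$, and let $J_{w,h}:=\langle f^w_{i,j}\mid i>h(j)\rangle\subseteq\mathbb{C}[\mathbf{x}_w]$. *)

theory Defs
  imports
    "HOL-Algebra.Left_Coset"
    "HOL-Algebra.QuotRing"
    "HOL-Combinatorics.Permutations"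
    "HOL-Library.Poly_Mapping"
    "Jordan_Normal_Form.Matrix"
begin

text \<open>
  Rows and columns of an \<open>n \<times> n\<close> matrix are numbered \<open>1, \<dots>, n\<close>, whereas the entries of the type
  \<^typ>\<open>'a mat\<close> are numbered from 0; the functions \<open>entry\<close> and \<open>matrix_of\<close> do the conversion.
\<close>

definition entry :: "'a mat \<Rightarrow> nat \<Rightarrow> nat \<Rightarrow> 'a" where
  "entry A i j = A $$ (i - 1, j - 1)"

definition matrix_of :: "nat \<Rightarrow> (nat \<Rightarrow> nat \<Rightarrow> 'a) \<Rightarrow> 'a mat" where
  "matrix_of n a = Matrix.mat n n (\<lambda>(i, j). a (i + 1) (j + 1))"

definition GL :: "nat \<Rightarrow> 'a::comm_ring_1 mat monoid" where
  "GL n = units_of (ring_mat TYPE('a) n ())"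

definition borel :: "nat \<Rightarrow> complex mat set" where
  "borel n = {M \<in> carrier (GL n). upper_triangular M}"

definition flags :: "nat \<Rightarrow> complex mat set set" where
  "flags n = lcosets\<^bsub>GL n\<^esub> (borel n)"

definition hessenberg_function :: "nat \<Rightarrow> (nat \<Rightarrow> nat) \<Rightarrow> bool" where
  "hessenberg_function n h \<longleftrightarrow>
     h ` {1..n} \<subseteq> {1..n} \<and> (\<forall>i\<in>{1..n}. h i \<ge> i) \<and> (\<forall>i\<in>{1..<n}. h (i + 1) \<ge> h i)"

definition indecomposable :: "nat \<Rightarrow> (nat \<Rightarrow> nat) \<Rightarrow> bool" where
  "indecomposable n h \<longleftrightarrow> (\<forall>j\<in>{1..<n}. h j \<ge> j + 1)"

definition hessenberg_space :: "nat \<Rightarrow> (nat \<Rightarrow> nat) \<Rightarrow> complex mat set" where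
  "hessenberg_space n h =
     {A \<in> carrier_mat n n. \<forall>i\<in>{1..n}. \<forall>j\<in>{1..n}. i > h j \<longrightarrow> entry A i j = 0}"

definition reg_nilpotent :: "nat \<Rightarrow> 'a::comm_ring_1 mat" where
  "reg_nilpotent n = matrix_of n (\<lambda>i j. if j = i + 1 then 1 else 0)"

definition Hess :: "nat \<Rightarrow> (nat \<Rightarrow> nat) \<Rightarrow> complex mat set set" where
  "Hess n h = {P \<in> flags n. \<exists>M \<in> carrier (GL n). P = M <#\<^bsub>GL n\<^esub> borel n \<and>
     inv\<^bsub>GL n\<^esub> M * reg_nilpotent n * M \<in> hessenberg_space n h}"

definition perm_matrix :: "nat \<Rightarrow> (nat \<Rightarrow> nat) \<Rightarrow> complex mat" where
  "perm_matrix n w = matrix_of n (\<lambda>i j. if i = w j then 1 else 0)"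

definition lower_unipotent :: "nat \<Rightarrow> complex mat set" where
  "lower_unipotent n = {M \<in> carrier_mat n n.
     (\<forall>i\<in>{1..n}. entry M i i = 1) \<and> (\<forall>i\<in>{1..n}. \<forall>j\<in>{1..n}. i < j \<longrightarrow> entry M i j = 0)}"

definition chart :: "nat \<Rightarrow> (nat \<Rightarrow> nat) \<Rightarrow> complex mat set set" where
  "chart n w = {(perm_matrix n w * M) <#\<^bsub>GL n\<^esub> borel n | M. M \<in> lower_unipotent n}"

definition chart_representative :: "nat \<Rightarrow> (nat \<Rightarrow> nat) \<Rightarrow> complex mat set \<Rightarrow> complex mat" where
  "chart_representative n w P =
     (THE X. (\<exists>M \<in> lower_unipotent n. X = perm_matrix n w * M) \<and> P = X <#\<^bsub>GL n\<^esub> borel n)"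

definition hess_patch :: "nat \<Rightarrow> (nat \<Rightarrow> nat) \<Rightarrow> (nat \<Rightarrow> nat) \<Rightarrow> complex mat set set" where
  "hess_patch n w h = Hess n h \<inter> chart n w"

text \<open>
  A polynomial is a finitely supported map from monomials to coefficients, and a monomial a
  finitely supported map from variables to exponents; the variable \<open>x\<^sub>i\<^sub>j\<close> is the pair \<open>(i, j)\<close>.
\<close>

type_synonym cpoly = "((nat \<times> nat) \<Rightarrow>\<^sub>0 nat) \<Rightarrow>\<^sub>0 complex"

definition poly_var :: "nat \<Rightarrow> nat \<Rightarrow> cpoly" where
  "poly_var i j = Poly_Mapping.single (Poly_Mapping.single (i, j) 1) 1"

definition poly_eval :: "(nat \<Rightarrow> nat \<Rightarrow> complex) \<Rightarrow> cpoly \<Rightarrow> complex" where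
  "poly_eval a p = (\<Sum>m\<in>Poly_Mapping.keys p. Poly_Mapping.lookup p m *
     (\<Prod>(i, j)\<in>Poly_Mapping.keys m. a i j ^ Poly_Mapping.lookup m (i, j)))"

text \<open>The positions \<open>(w(i), j)\<close> with \<open>j < i\<close>, that is, those where \<open>w M\<close> is not fixed to be 0 or 1.\<close>

definition free_positions :: "nat \<Rightarrow> (nat \<Rightarrow> nat) \<Rightarrow> (nat \<times> nat) set" where
  "free_positions n w = {(w i, j) | i j. i \<in> {1..n} \<and> j \<in> {1..n} \<and> j < i}"

definition coord_poly_ring :: "nat \<Rightarrow> (nat \<Rightarrow> nat) \<Rightarrow> cpoly ring" where
  "coord_poly_ring n w =
     \<lparr>carrier = {p. \<forall>m\<in>Poly_Mapping.keys p. Poly_Mapping.keys m \<subseteq> free_positions n w},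
      monoid.mult = (*), one = 1, zero = 0, add = (+)\<rparr>"

definition generic_matrix :: "nat \<Rightarrow> (nat \<Rightarrow> nat) \<Rightarrow> cpoly mat" where
  "generic_matrix n w = matrix_of n (\<lambda>i j.
     if i = w j then 1 else if (i, j) \<in> free_positions n w then poly_var i j else 0)"

definition hess_poly :: "nat \<Rightarrow> (nat \<Rightarrow> nat) \<Rightarrow> nat \<Rightarrow> nat \<Rightarrow> cpoly" where
  "hess_poly n w i j =
     entry (inv\<^bsub>GL n\<^esub> (generic_matrix n w) * reg_nilpotent n * generic_matrix n w) i j"

definition hess_ideal :: "nat \<Rightarrow> (nat \<Rightarrow> nat) \<Rightarrow> (nat \<Rightarrow> nat) \<Rightarrow> cpoly set" where
  "hess_ideal n w h =
     Idl\<^bsub>coord_poly_ring n w\<^esub> {hess_poly n w i j | i j. i \<in> {1..n} \<and> j \<in> {1..n} \<and> i > h j}"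

definition poly_fun :: "nat \<Rightarrow> (nat \<Rightarrow> nat) \<Rightarrow> cpoly \<Rightarrow> complex mat set \<Rightarrow> complex" where
  "poly_fun n w p P = poly_eval (entry (chart_representative n w P)) p"

text \<open>
  Since the chart is an affine space, the regular functions on a closed subvariety \<open>Z\<close> are the
  restrictions to \<open>Z\<close> of polynomial functions. Functions on \<open>Z\<close> are represented by functions with
  the value \<^const>\<open>undefined\<close> outside \<open>Z\<close>.
\<close>

definition coordinate_ring ::
    "nat \<Rightarrow> (nat \<Rightarrow> nat) \<Rightarrow> complex mat set set \<Rightarrow> (complex mat set \<Rightarrow> complex) ring" where
  "coordinate_ring n w Z =
     \<lparr>carrier = {restrict (poly_fun n w p) Z | p. p \<in> carrier (coord_poly_ring n w)},
      monoid.mult = (\<lambda>f g. \<lambda>P\<in>Z. f P * g P), one = (\<lambda>P\<in>Z. 1),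
      zero = (\<lambda>P\<in>Z. 0), add = (\<lambda>f g. \<lambda>P\<in>Z. f P + g P)\<rparr>"

definition zero_locus :: "nat \<Rightarrow> (nat \<Rightarrow> nat) \<Rightarrow> cpoly set \<Rightarrow> complex mat set set" where
  "zero_locus n w I = {P \<in> chart n w. \<forall>p\<in>I. poly_fun n w p P = 0}"

definition vanishing_ideal :: "nat \<Rightarrow> (nat \<Rightarrow> nat) \<Rightarrow> complex mat set set \<Rightarrow> cpoly set" where
  "vanishing_ideal n w Z = {p \<in> carrier (coord_poly_ring n w). \<forall>P\<in>Z. poly_fun n w p P = 0}"

text \<open>The first conjunct says that \<open>Z\<close> is closed in the chart and cut out by \<open>I\<close>.\<close>

definition is_defining_ideal ::
    "nat \<Rightarrow> (nat \<Rightarrow> nat) \<Rightarrow> cpoly set \<Rightarrow> complex mat set set \<Rightarrow> bool" where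
  "is_defining_ideal n w I Z \<longleftrightarrow> Z = zero_locus n w I \<and> I = vanishing_ideal n w Z"

text \<open>The unit ideal counts as radical; it occurs here whenever \<^const>\<open>hess_patch\<close> is empty.\<close>

definition radical_ideal :: "('a, 'b) ring_scheme \<Rightarrow> 'a set \<Rightarrow> bool" where
  "radical_ideal R I \<longleftrightarrow> ideal I R \<and>
     (\<forall>a\<in>carrier R. \<forall>k::nat. a [^]\<^bsub>R\<^esub> k \<in> I \<longrightarrow> a \<in> I)"

end

(* A flag near w is w M B with M lower unitriangular, and the equations only involve M^-1 E M with
   E = w^-1 N w. At the longest element they are triangular, so they can be solved for some of the
   coordinates: there the ideal is the ideal of its zero set. Overlapping charts are compared by the
   LU decomposition, which transfers this property up to a power of a product D of leading minors.
   To get from the longest element to the identity one needs D to be a nonzerodivisor there. Writing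
   H = M^-1 N M = N + (lower triangular), the matrix M has rows e_0^T H^i, so the ideal becomes the
   ideal of the n entries of e_0^T H^n in the free entries of H. With respect to a suitable weight on
   the diagonal entries x_k these equations have leading forms x_k^(n-k), so the quotient is free over
   the polynomials in the remaining entries. By freeness it suffices to invert D over the single fibre
   with subdiagonal 1 and zeros elsewhere, where every flag is spanned by v, Nv, N^2 v, ... .
   To get from the identity to an arbitrary chart one moves the chart by elements u(s) of the
   centralizer of N; the minors D_u(s) generate the unit ideal, since no prime contains all of them. *)
theory Submission
  imports Defs "Jordan_Normal_Form.Determinant" "HOL-Computational_Algebra.Polynomial"
begin

section \<open>Algebras of complex-valued functions\<close>

text \<open>Polynomials are handled as functions on affine space: over the infinite field C nothing
  is lost, identities are checked pointwise, and a change of coordinates is a substitution. The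
  property carried from chart to chart is \<open>reduced\<close>: the ideal contains every
  polynomial vanishing on its zero set. It yields radicality and the defining ideal together, with
  no appeal to the Nullstellensatz. The standard flag is the obstacle. The centralizer of N consists
  of polynomials in N, which are upper triangular, so it fixes this flag and for n \<ge> 2 cannot
  move it into the chart at the longest element, where the equations are solvable. Comparing these
  two charts leaves a power of D on the polynomial, and flatness over the parameters has to remove
  it: a multiple of a power of D acts as the identity on one fibre, hence injectively on the free
  module. For the remaining charts there is no such obstacle, because a generic element of the
  centralizer moves any given flag into the chart at the identity.\<close>

locale fun_alg =
  fixes A :: "('p \<Rightarrow> complex) set"
  assumes const: "(\<lambda>_. c) \<in> A"
    and add: "f \<in> A \<Longrightarrow> g \<in> A \<Longrightarrow> (\<lambda>x. f x + g x) \<in> A"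
    and mult: "f \<in> A \<Longrightarrow> g \<in> A \<Longrightarrow> (\<lambda>x. f x * g x) \<in> A"
begin

lemma uminus: "f \<in> A \<Longrightarrow> (\<lambda>x. - f x) \<in> A"
  using mult[OF const[of "-1"], of f] by simp

lemma diff: "f \<in> A \<Longrightarrow> g \<in> A \<Longrightarrow> (\<lambda>x. f x - g x) \<in> A"
  using add[of f "\<lambda>x. - g x"] uminus[of g] by simp

lemma sum: "(\<And>i. i \<in> T \<Longrightarrow> f i \<in> A) \<Longrightarrow> (\<lambda>x. \<Sum>i\<in>T. f i x) \<in> A"
proof (induction T rule: infinite_finite_induct)
  case (insert i T)
  then show ?case using add[of "f i" "\<lambda>x. \<Sum>i\<in>T. f i x"] by simp
qed (simp_all add: const)

lemma prod: "(\<And>i. i \<in> T \<Longrightarrow> f i \<in> A) \<Longrightarrow> (\<lambda>x. \<Prod>i\<in>T. f i x) \<in> A"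
proof (induction T rule: infinite_finite_induct)
  case (insert i T)
  then show ?case using mult[of "f i" "\<lambda>x. \<Prod>i\<in>T. f i x"] by simp
qed (simp_all add: const)

lemma power: "f \<in> A \<Longrightarrow> (\<lambda>x. f x ^ k) \<in> A"
  using prod[of "{..<k}" "\<lambda>_. f"] by simp

lemma det:
  assumes "\<And>x. X x \<in> carrier_mat n n"
    and "\<And>i j. i < n \<Longrightarrow> j < n \<Longrightarrow> (\<lambda>x. X x $$ (i, j)) \<in> A"
  shows "(\<lambda>x. det (X x)) \<in> A"
proof -
  have "(\<lambda>x. det (X x)) =
      (\<lambda>x. \<Sum>p\<in>{p. p permutes {0..<n}}. signof p * (\<Prod>i = 0..<n. X x $$ (i, p i)))"
    using det_def'[OF assms(1)] by (intro ext) simp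
  also have "\<dots> \<in> A"
    by (intro sum mult const prod assms) auto
  finally show ?thesis .
qed

lemma mat_mult:
  assumes "\<And>x. X x \<in> carrier_mat n n" and "\<And>x. Y x \<in> carrier_mat n n"
    and "\<And>i j. i < n \<Longrightarrow> j < n \<Longrightarrow> (\<lambda>x. X x $$ (i, j)) \<in> A"
    and "\<And>i j. i < n \<Longrightarrow> j < n \<Longrightarrow> (\<lambda>x. Y x $$ (i, j)) \<in> A"
    and "i < n" "j < n"
  shows "(\<lambda>x. (X x * Y x) $$ (i, j)) \<in> A"
proof -
  have "(\<lambda>x. (X x * Y x) $$ (i, j)) = (\<lambda>x. \<Sum>k = 0..<n. X x $$ (i, k) * Y x $$ (k, j))"
    using assms(1,2)[THEN carrier_matD(1)] assms(1,2)[THEN carrier_matD(2)] assms(5,6)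
    by (intro ext) (simp add: scalar_prod_def)
  also have "\<dots> \<in> A"
    using assms by (intro sum mult) auto
  finally show ?thesis .
qed

text \<open>Cofactors are signed determinants of submatrices, hence polynomial in the entries.
  Unitriangular matrices have determinant 1, so their inverses are taken as adjugates throughout and
  stay inside the algebra without division.\<close>

lemma adj_mat:
  assumes "\<And>x. X x \<in> carrier_mat n n"
    and "\<And>i j. i < n \<Longrightarrow> j < n \<Longrightarrow> (\<lambda>x. X x $$ (i, j)) \<in> A"
    and "i < n" "j < n"
  shows "(\<lambda>x. adj_mat (X x) $$ (i, j)) \<in> A"
proof -
  have eq: "(\<lambda>x. adj_mat (X x) $$ (i, j)) = (\<lambda>x. (-1) ^ (j + i) * det (mat_delete (X x) j i))"
    using assms(1)[THEN carrier_matD(1)] assms(1)[THEN carrier_matD(2)] assms(3,4)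
    by (intro ext) (simp add: adj_mat_def cofactor_def)
  have "(\<lambda>x. det (mat_delete (X x) j i)) \<in> A"
  proof (rule det[where n = "n - 1"])
    fix x show "mat_delete (X x) j i \<in> carrier_mat (n - 1) (n - 1)"
      using assms(1) by (rule mat_delete_carrier)
  next
    fix i' j' assume ij: "i' < n - 1" "j' < n - 1"
    have "(\<lambda>x. mat_delete (X x) j i $$ (i', j')) =
        (\<lambda>x. X x $$ (if i' < j then i' else Suc i', if j' < i then j' else Suc j'))"
      using assms(1)[THEN carrier_matD(1)] assms(1)[THEN carrier_matD(2)] ij
      by (intro ext) (simp add: mat_delete_def)
    also have "\<dots> \<in> A"
      using ij by (intro assms(2)) auto
    finally show "(\<lambda>x. mat_delete (X x) j i $$ (i', j')) \<in> A" .
  qed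
  then show ?thesis unfolding eq by (intro mult const)
qed

end

locale fun_ideal = fun_alg A for A :: "('p \<Rightarrow> complex) set" +
  fixes I :: "('p \<Rightarrow> complex) set"
  assumes ideal_sub: "I \<subseteq> A"
    and ideal_zero: "(\<lambda>_. 0) \<in> I"
    and ideal_add: "f \<in> I \<Longrightarrow> g \<in> I \<Longrightarrow> (\<lambda>x. f x + g x) \<in> I"
    and ideal_mult: "f \<in> A \<Longrightarrow> g \<in> I \<Longrightarrow> (\<lambda>x. f x * g x) \<in> I"
begin

lemma ideal_mult2: "f \<in> I \<Longrightarrow> g \<in> A \<Longrightarrow> (\<lambda>x. f x * g x) \<in> I"
  using ideal_mult[of g f] by (simp add: mult.commute)

lemma ideal_uminus: "f \<in> I \<Longrightarrow> (\<lambda>x. - f x) \<in> I"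
  using ideal_mult[OF const[of "-1"], of f] by simp

lemma ideal_diff: "f \<in> I \<Longrightarrow> g \<in> I \<Longrightarrow> (\<lambda>x. f x - g x) \<in> I"
  using ideal_add[of f "\<lambda>x. - g x"] ideal_uminus[of g] by simp

lemma ideal_sum: "(\<And>i. i \<in> T \<Longrightarrow> f i \<in> I) \<Longrightarrow> (\<lambda>x. \<Sum>i\<in>T. f i x) \<in> I"
proof (induction T rule: infinite_finite_induct)
  case (insert i T)
  then show ?case using ideal_add[of "f i" "\<lambda>x. \<Sum>i\<in>T. f i x"] by simp
qed (simp_all add: ideal_zero)

text \<open>Congruence of f and f' modulo \<open>I\<close> is spelled as membership of f - f' in
  \<open>I\<close>; sums, products, powers and determinants respect it.\<close>

lemma cong_refl: "(\<lambda>x. f x - f x) \<in> I"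
  using ideal_zero by simp

lemma cong_add:
  assumes "(\<lambda>x. f x - f' x) \<in> I" "(\<lambda>x. g x - g' x) \<in> I"
  shows "(\<lambda>x. (f x + g x) - (f' x + g' x)) \<in> I"
  using ideal_add[OF assms] by (simp add: algebra_simps)

lemma cong_mult:
  assumes "(\<lambda>x. f x - f' x) \<in> I" "(\<lambda>x. g x - g' x) \<in> I" "g \<in> A" "f' \<in> A"
  shows "(\<lambda>x. f x * g x - f' x * g' x) \<in> I"
proof -
  have "(\<lambda>x. (f x - f' x) * g x + f' x * (g x - g' x)) \<in> I"
    using assms by (intro ideal_add ideal_mult ideal_mult2)
  then show ?thesis by (simp add: algebra_simps)
qed

lemma cong_sum:
  "(\<And>i. i \<in> T \<Longrightarrow> (\<lambda>x. f i x - g i x) \<in> I) \<Longrightarrow> (\<lambda>x. (\<Sum>i\<in>T. f i x) - (\<Sum>i\<in>T. g i x)) \<in> I"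
  using ideal_sum[of T "\<lambda>i x. f i x - g i x"] by (simp add: sum_subtractf)

lemma cong_prod:
  "(\<And>i. i \<in> T \<Longrightarrow> (\<lambda>x. f i x - g i x) \<in> I) \<Longrightarrow> (\<And>i. i \<in> T \<Longrightarrow> f i \<in> A) \<Longrightarrow>
    (\<And>i. i \<in> T \<Longrightarrow> g i \<in> A) \<Longrightarrow> (\<lambda>x. (\<Prod>i\<in>T. f i x) - (\<Prod>i\<in>T. g i x)) \<in> I"
proof (induction T rule: infinite_finite_induct)
  case (insert i T)
  have "(\<lambda>x. f i x * (\<Prod>i\<in>T. f i x) - g i x * (\<Prod>i\<in>T. g i x)) \<in> I"
    using insert by (intro cong_mult prod) auto
  then show ?case using insert.hyps by simp
qed (simp_all add: ideal_zero)

lemma cong_power: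
  "(\<lambda>x. f x - g x) \<in> I \<Longrightarrow> f \<in> A \<Longrightarrow> g \<in> A \<Longrightarrow> (\<lambda>x. f x ^ k - g x ^ k) \<in> I"
  using cong_prod[of "{..<k}" "\<lambda>_. f" "\<lambda>_. g"] by simp

lemma cong_det:
  assumes "\<And>x. X x \<in> carrier_mat n n" "\<And>x. Y x \<in> carrier_mat n n"
    and "\<And>i j. i < n \<Longrightarrow> j < n \<Longrightarrow> (\<lambda>x. X x $$ (i, j)) \<in> A"
    and "\<And>i j. i < n \<Longrightarrow> j < n \<Longrightarrow> (\<lambda>x. Y x $$ (i, j)) \<in> A"
    and "\<And>i j. i < n \<Longrightarrow> j < n \<Longrightarrow> (\<lambda>x. X x $$ (i, j) - Y x $$ (i, j)) \<in> I"
  shows "(\<lambda>x. det (X x) - det (Y x)) \<in> I"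
  unfolding det_def'[OF assms(1)] det_def'[OF assms(2)]
  by (intro cong_sum cong_mult cong_prod cong_refl const prod assms) auto

end

section \<open>Generated ideals and polynomial functions\<close>

inductive_set idl :: "('p \<Rightarrow> complex) set \<Rightarrow> ('p \<Rightarrow> complex) set \<Rightarrow> ('p \<Rightarrow> complex) set"
  for A F where
    zero: "(\<lambda>_. 0) \<in> idl A F"
  | step: "g \<in> A \<Longrightarrow> f \<in> F \<Longrightarrow> r \<in> idl A F \<Longrightarrow> (\<lambda>x. g x * f x + r x) \<in> idl A F"

context fun_alg
begin

lemma idl_gen: "f \<in> F \<Longrightarrow> f \<in> idl A F"
  using idl.step[OF const[of 1] _ idl.zero, of f F] by simp

lemma fun_ideal_idl:
  assumes "F \<subseteq> A"
  shows "fun_ideal A (idl A F)"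
proof unfold_locales
  show "idl A F \<subseteq> A"
  proof
    fix f assume "f \<in> idl A F" then show "f \<in> A"
    proof (induction)
      case (step g f r)
      then show ?case using assms by (intro add mult) auto
    qed (rule const)
  qed
  show "(\<lambda>_. 0) \<in> idl A F" by (rule idl.zero)
  show "(\<lambda>x. f x + g x) \<in> idl A F" if "f \<in> idl A F" "g \<in> idl A F" for f g
    using that
  proof (induction arbitrary: g)
    case (step k f r)
    have "(\<lambda>x. k x * f x + (r x + g x)) \<in> idl A F"
      using step by (intro idl.step) auto
    then show ?case by (simp add: add.assoc)
  qed simp
  show "(\<lambda>x. f x * g x) \<in> idl A F" if "f \<in> A" "g \<in> idl A F" for f g
    using that(2)
  proof (induction)
    case zero
    then show ?case using idl.zero by simp
  next
    case (step k e r)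
    have "(\<lambda>x. (f x * k x) * e x + f x * r x) \<in> idl A F"
      using step that(1) by (intro idl.step mult) auto
    then show ?case by (simp add: algebra_simps)
  qed
qed

end

text \<open>A map of points induces a ring homomorphism by substitution, and one that sends the
  generators into \<open>I\<close> sends the whole ideal there. Ideal membership is moved between
  coordinate systems in this way.\<close>

lemma (in fun_ideal) idl_compose:
  assumes "p \<in> idl R F"
    and "\<And>g. g \<in> R \<Longrightarrow> (\<lambda>z. g (b z)) \<in> A"
    and "\<And>f. f \<in> F \<Longrightarrow> (\<lambda>z. f (b z)) \<in> I"
  shows "(\<lambda>z. p (b z)) \<in> I"
  using assms(1)
proof (induction)
  case (step g f r)
  then show ?case
    by (intro ideal_add[OF ideal_mult[OF assms(2)[of g] assms(3)[of f]]])
qed (rule ideal_zero)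

text \<open>Over an infinite field the polynomial functions in the coordinates from \<open>S\<close>
  form the polynomial ring itself. Points are total functions; coordinates outside \<open>S\<close>
  are present but never read.\<close>

inductive_set pf :: "'v set \<Rightarrow> (('v \<Rightarrow> complex) \<Rightarrow> complex) set" for S where
    const: "(\<lambda>_. c) \<in> pf S"
  | var: "v \<in> S \<Longrightarrow> (\<lambda>a. a v) \<in> pf S"
  | add: "f \<in> pf S \<Longrightarrow> g \<in> pf S \<Longrightarrow> (\<lambda>a. f a + g a) \<in> pf S"
  | mult: "f \<in> pf S \<Longrightarrow> g \<in> pf S \<Longrightarrow> (\<lambda>a. f a * g a) \<in> pf S"

interpretation pfa: fun_alg "pf S" for S
  by unfold_locales (rule pf.intros; assumption)+

lemma (in fun_alg) pf_compose:
  assumes "p \<in> pf S" and "\<And>v. v \<in> S \<Longrightarrow> (\<lambda>z. b z v) \<in> A"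
  shows "(\<lambda>z. p (b z)) \<in> A"
  using assms(1) by (induction) (rule const add mult assms(2); assumption)+

lemma pf_mono: "S \<subseteq> T \<Longrightarrow> p \<in> pf S \<Longrightarrow> p \<in> pf T"
  by (rule pfa.pf_compose[of p S "\<lambda>z. z" T]) (auto simp: pf.var)

lemma pf_depends: "p \<in> pf S \<Longrightarrow> (\<And>v. v \<in> S \<Longrightarrow> a v = b v) \<Longrightarrow> p a = p b"
  by (induction rule: pf.induct) auto

lemma (in fun_ideal) pf_compose_cong:
  assumes "p \<in> pf S" and "\<And>v. v \<in> S \<Longrightarrow> (\<lambda>z. b z v) \<in> A" "\<And>v. v \<in> S \<Longrightarrow> (\<lambda>z. b' z v) \<in> A"
    and "\<And>v. v \<in> S \<Longrightarrow> (\<lambda>z. b z v - b' z v) \<in> I"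
  shows "(\<lambda>z. p (b z) - p (b' z)) \<in> I"
  using assms(1)
proof (induction)
  case (add f g)
  show ?case by (rule cong_add[OF add.IH])
next
  case (mult f g)
  have "(\<lambda>z. g (b z)) \<in> A" "(\<lambda>z. f (b' z)) \<in> A"
    by (rule pf_compose[OF mult.hyps(2) assms(2)] pf_compose[OF mult.hyps(1) assms(3)]; assumption)+
  then show ?case by (rule cong_mult[OF mult.IH])
next
  case (var v)
  then show ?case by (rule assms(4))
qed (simp add: ideal_zero)

section \<open>Triangular elimination\<close>

text \<open>Each equation determines its coordinate \<open>v\<close> from coordinates of smaller
  key, so the quotient is the polynomial ring in the undetermined ones. The proof replaces the
  determined coordinate of largest key by \<open>\<phi> v\<close>: this alters \<open>p\<close> by
  an element of the ideal, and the other equations, which do not involve \<open>v\<close>, still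
  force the result to vanish. When nothing is left to eliminate, the polynomial vanishes at every
  point.\<close>

lemma triangular_elimination:
  fixes key :: "'v \<Rightarrow> nat"
  assumes "finite V" "Det \<subseteq> V" "inj_on key V"
    and "\<And>v. v \<in> Det \<Longrightarrow> \<phi> v \<in> pf {u \<in> V. key u < key v}"
    and "p \<in> pf V"
    and "\<And>a. (\<And>v. v \<in> Det \<Longrightarrow> \<phi> v a - a v = 0) \<Longrightarrow> p a = 0"
  shows "p \<in> idl (pf V) ((\<lambda>v a. \<phi> v a - a v) ` Det)"
  using assms(2,4-6)
proof (induction "card Det" arbitrary: Det p)
  case 0
  then have "Det = {}"
    using \<open>finite V\<close> finite_subset by fastforce
  with 0 have "p = (\<lambda>_. 0)" by auto
  then show ?case using idl.zero by simp
next
  case (Suc N)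
  have fin: "finite Det" using Suc.prems(1) assms(1) finite_subset by blast
  have ne: "Det \<noteq> {}" using Suc.hyps(2) by auto
  obtain v where v: "v \<in> Det" and vmax: "\<And>u. u \<in> Det \<Longrightarrow> key u \<le> key v"
    using Max_in[of "key ` Det"] Max_ge[of "key ` Det"] fin ne by fastforce
  define Det' where "Det' = Det - {v}"
  define q where "q = (\<lambda>a. p (a(v := \<phi> v a)))"
  have vV: "v \<in> V" using v Suc.prems(1) by auto
  have phiV: "\<phi> u \<in> pf V" if "u \<in> Det" for u
    using Suc.prems(2)[OF that] by (rule pf_mono[rotated]) auto
  have less: "key u < key v" if "u \<in> Det'" for u
    using that vmax[of u] assms(3) vV Suc.prems(1) unfolding Det'_def inj_on_def
    by (metis DiffE order_le_less insertI1 subsetD)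
  have indep: "\<phi> u (a(v := c)) = \<phi> u a" if "u \<in> Det" for u a c
    using Suc.prems(2)[OF that] by (rule pf_depends) (use vmax[OF that] in auto)
  interpret J: fun_ideal "pf V" "idl (pf V) ((\<lambda>v a. \<phi> v a - a v) ` Det)"
  proof (rule pfa.fun_ideal_idl, rule image_subsetI)
    fix v assume v: "v \<in> Det"
    show "(\<lambda>a. \<phi> v a - a v) \<in> pf V"
      using v Suc.prems(1) by (intro pfa.diff pf.var phiV) auto
  qed
  have "q \<in> pf V"
    unfolding q_def
  proof (rule pfa.pf_compose[OF Suc.prems(3)])
    fix u assume "u \<in> V" then show "(\<lambda>z. (z(v := \<phi> v z)) u) \<in> pf V"
      using phiV[OF v] by (cases "u = v") (simp_all add: pf.var)
  qed
  moreover have "q a = 0" if "\<And>u. u \<in> Det' \<Longrightarrow> \<phi> u a - a u = 0" for a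
    unfolding q_def
  proof (rule Suc.prems(4))
    fix u assume u: "u \<in> Det"
    show "\<phi> u (a(v := \<phi> v a)) - (a(v := \<phi> v a)) u = 0"
      unfolding indep[OF u] using that[of u] u unfolding Det'_def by auto
  qed
  moreover have "N = card Det'" "Det' \<subseteq> V"
    using Suc.hyps(2) Suc.prems(1) v fin unfolding Det'_def by auto
  ultimately have "q \<in> idl (pf V) ((\<lambda>v a. \<phi> v a - a v) ` Det')"
    using Suc.hyps(1)[of Det' q] Suc.prems(2) unfolding Det'_def by blast
  then have q: "q \<in> idl (pf V) ((\<lambda>v a. \<phi> v a - a v) ` Det)"
  proof (induction)
    case (step g f r)
    then show ?case unfolding Det'_def by (intro idl.step) auto
  qed (rule idl.zero)
  have "(\<lambda>a. p (a(v := \<phi> v a)) - p a) \<in> idl (pf V) ((\<lambda>v a. \<phi> v a - a v) ` Det)"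
  proof (rule J.pf_compose_cong[OF Suc.prems(3)])
    fix u assume u: "u \<in> V"
    show "(\<lambda>z. (z(v := \<phi> v z)) u) \<in> pf V"
      using phiV[OF v] u by (cases "u = v") (simp_all add: pf.var)
    show "(\<lambda>z. z u) \<in> pf V" using u by (rule pf.var)
    show "(\<lambda>z. (z(v := \<phi> v z)) u - z u) \<in> idl (pf V) ((\<lambda>v a. \<phi> v a - a v) ` Det)"
      using pfa.idl_gen[of "\<lambda>a. \<phi> v a - a v"] v J.ideal_zero by (cases "u = v") auto
  qed
  from J.ideal_diff[OF q this] show ?case unfolding q_def by simp
qed

section \<open>Unitriangular matrices and Hessenberg conditions\<close>

definition lower_unitri :: "nat \<Rightarrow> complex mat \<Rightarrow> bool" where
  "lower_unitri n L \<longleftrightarrow> L \<in> carrier_mat n n \<and> (\<forall>i<n. L $$ (i, i) = 1) \<and>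
     (\<forall>i<n. \<forall>j<n. i < j \<longrightarrow> L $$ (i, j) = 0)"

definition lcoords :: "nat \<Rightarrow> (nat \<times> nat) set" where
  "lcoords n = {(i, j). j < i \<and> i < n}"

definition umat :: "nat \<Rightarrow> (nat \<times> nat \<Rightarrow> complex) \<Rightarrow> complex mat" where
  "umat n a = Matrix.mat n n (\<lambda>(i, j). if j < i then a (i, j) else if i = j then 1 else 0)"

definition lead_block :: "nat \<Rightarrow> 'a mat \<Rightarrow> 'a mat" where
  "lead_block k Y = Matrix.mat k k (\<lambda>(i, j). Y $$ (i, j))"

definition lead_minor :: "nat \<Rightarrow> complex mat \<Rightarrow> complex" where
  "lead_minor k Y = det (lead_block k Y)"

lemma umat_carrier [simp]: "umat n a \<in> carrier_mat n n"
  by (simp add: umat_def)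

lemma lead_block_carrier [simp]: "lead_block k Y \<in> carrier_mat k k"
  by (simp add: lead_block_def)

lemma lower_unitri_umat [simp]: "lower_unitri n (umat n a)"
  by (auto simp: lower_unitri_def umat_def)

lemma lower_unitri_det: "lower_unitri n L \<Longrightarrow> det L = 1"
  by (subst det_lower_triangular[of n]) (auto simp: lower_unitri_def prod_list_diag_prod)

lemma umat_of_lower_unitri: "lower_unitri n L \<Longrightarrow> umat n (\<lambda>(i, j). L $$ (i, j)) = L"
  by (intro eq_matI) (auto simp: lower_unitri_def umat_def)

lemma umat_inj: "umat n a = umat n b \<Longrightarrow> v \<in> lcoords n \<Longrightarrow> a v = b v"
proof -
  assume eq: "umat n a = umat n b" and v: "v \<in> lcoords n"
  obtain i j where ij: "v = (i, j)" "j < i" "i < n" using v by (auto simp: lcoords_def)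
  have "umat n a $$ (i, j) = umat n b $$ (i, j)" using eq by simp
  then show ?thesis using ij by (simp add: umat_def)
qed

lemma mat_mult_index:
  assumes "X \<in> carrier_mat n m" "Y \<in> carrier_mat m l" "i < n" "j < l"
  shows "(X * Y) $$ (i, j) = (\<Sum>k<m. X $$ (i, k) * Y $$ (k, j))"
  using assms by (simp add: scalar_prod_def lessThan_atLeast0)

lemma lower_unitri_inverse:
  assumes L: "lower_unitri n L" and R: "R \<in> carrier_mat n n" and LR: "L * R = 1\<^sub>m n"
  shows "lower_unitri n R"
proof -
  have Lc: "L \<in> carrier_mat n n" using L by (simp add: lower_unitri_def)
  have main: "R $$ (i, j) = (if i = j then 1 else 0)" if "i < n" "j < n" "i \<le> j" for i j
    using that
  proof (induction i rule: less_induct)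
    case (less i)
    have "(L * R) $$ (i, j) = (\<Sum>k<n. L $$ (i, k) * R $$ (k, j))"
      using less.prems by (intro mat_mult_index[OF Lc R])
    also have "\<dots> = (\<Sum>k<n. if k = i then R $$ (i, j) else 0)"
    proof (intro sum.cong refl)
      fix k assume k: "k \<in> {..<n}"
      show "L $$ (i, k) * R $$ (k, j) = (if k = i then R $$ (i, j) else 0)"
        using less.IH[of k] less.prems k L unfolding lower_unitri_def
        by (cases k i rule: linorder_cases) auto
    qed
    also have "\<dots> = R $$ (i, j)" using less.prems by simp
    finally show ?case using LR less.prems by simp
  qed
  show ?thesis unfolding lower_unitri_def using R main by auto
qed

lemma lower_unitri_adj:
  assumes L: "lower_unitri n L"
  shows "adj_mat L \<in> carrier_mat n n" "L * adj_mat L = 1\<^sub>m n" "adj_mat L * L = 1\<^sub>m n"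
    "lower_unitri n (adj_mat L)"
proof -
  have Lc: "L \<in> carrier_mat n n" using L by (simp add: lower_unitri_def)
  show c: "adj_mat L \<in> carrier_mat n n" and e: "L * adj_mat L = 1\<^sub>m n" and "adj_mat L * L = 1\<^sub>m n"
    using adj_mat[OF Lc] lower_unitri_det[OF L] by auto
  show "lower_unitri n (adj_mat L)" by (rule lower_unitri_inverse[OF L c e])
qed

lemma lower_unitri_mult:
  assumes "lower_unitri n L" "lower_unitri n M"
  shows "lower_unitri n (L * M)"
proof -
  have c: "L \<in> carrier_mat n n" "M \<in> carrier_mat n n" using assms by (auto simp: lower_unitri_def)
  have "(L * M) $$ (i, j) = (if i = j then 1 else 0)" if "i < n" "j < n" "i \<le> j" for i j
  proof -
    have "(L * M) $$ (i, j) = (\<Sum>k<n. L $$ (i, k) * M $$ (k, j))"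
      by (rule mat_mult_index[OF c that(1,2)])
    also have "\<dots> = (\<Sum>k<n. if k = i then M $$ (i, j) else 0)"
    proof (intro sum.cong refl)
      fix k assume "k \<in> {..<n}"
      then show "L $$ (i, k) * M $$ (k, j) = (if k = i then M $$ (i, j) else 0)"
        using assms that unfolding lower_unitri_def by (cases k i rule: linorder_cases) auto
    qed
    also have "\<dots> = (if i = j then 1 else 0)"
      using that assms unfolding lower_unitri_def by auto
    finally show ?thesis .
  qed
  then show ?thesis using c unfolding lower_unitri_def by auto
qed

lemma lead_block_mult_lower:
  assumes "lower_unitri n L" "Y \<in> carrier_mat n n" "k \<le> n"
  shows "lead_block k (L * Y) = lead_block k L * lead_block k Y"
proof (intro eq_matI)
  have Lc: "L \<in> carrier_mat n n" using assms by (simp add: lower_unitri_def)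
  fix i j assume "i < dim_row (lead_block k L * lead_block k Y)"
    "j < dim_col (lead_block k L * lead_block k Y)"
  then have ij: "i < k" "j < k" by (auto simp: lead_block_def)
  have "(L * Y) $$ (i, j) = (\<Sum>l<n. L $$ (i, l) * Y $$ (l, j))"
    using ij assms(3) by (intro mat_mult_index[OF Lc assms(2)]) auto
  also have "\<dots> = (\<Sum>l<k. L $$ (i, l) * Y $$ (l, j))"
    using assms(1,3) ij by (intro sum.mono_neutral_right) (auto simp: lower_unitri_def)
  also have "\<dots> = (lead_block k L * lead_block k Y) $$ (i, j)"
    using ij by (subst mat_mult_index[of _ k k _ k]) (auto simp: lead_block_def)
  finally show "lead_block k (L * Y) $$ (i, j) = (lead_block k L * lead_block k Y) $$ (i, j)"
    using ij by (simp add: lead_block_def)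
qed (auto simp: lead_block_def)

lemma lead_block_mult_upper:
  assumes "upper_triangular B" "B \<in> carrier_mat n n" "Y \<in> carrier_mat n n" "k \<le> n"
  shows "lead_block k (Y * B) = lead_block k Y * lead_block k B"
proof (intro eq_matI)
  fix i j assume "i < dim_row (lead_block k Y * lead_block k B)"
    "j < dim_col (lead_block k Y * lead_block k B)"
  then have ij: "i < k" "j < k" by (auto simp: lead_block_def)
  have "(Y * B) $$ (i, j) = (\<Sum>l<n. Y $$ (i, l) * B $$ (l, j))"
    using ij assms(4) by (intro mat_mult_index[OF assms(3,2)]) auto
  also have "\<dots> = (\<Sum>l<k. Y $$ (i, l) * B $$ (l, j))"
    using assms(1,2,4) ij by (intro sum.mono_neutral_right) (auto simp: upper_triangular_def)
  also have "\<dots> = (lead_block k Y * lead_block k B) $$ (i, j)"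
    using ij by (subst mat_mult_index[of _ k k _ k]) (auto simp: lead_block_def)
  finally show "lead_block k (Y * B) $$ (i, j) = (lead_block k Y * lead_block k B) $$ (i, j)"
    using ij by (simp add: lead_block_def)
qed (auto simp: lead_block_def)

text \<open>The first k rows of \<open>L\<close> vanish to the right of column k, so
  \<open>L\<close> acts on the leading block through its own leading block, of determinant 1.
  Together with multiplicativity for upper triangular right factors this makes nonvanishing of all
  leading minors the condition for lying in U^- B.\<close>

lemma lead_minor_lower_mult:
  assumes "lower_unitri n L" "Y \<in> carrier_mat n n" "k \<le> n"
  shows "lead_minor k (L * Y) = lead_minor k Y"
proof -
  have "lower_unitri k (lead_block k L)"
    using assms by (auto simp: lower_unitri_def lead_block_def)
  then show ?thesis
    unfolding lead_minor_def lead_block_mult_lower[OF assms]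
    by (subst det_mult[of _ k]) (auto simp: lower_unitri_det)
qed

lemma lead_minor_upper_mult:
  assumes "upper_triangular B" "B \<in> carrier_mat n n" "Y \<in> carrier_mat n n" "k \<le> n"
  shows "lead_minor k (Y * B) = lead_minor k Y * lead_minor k B"
  unfolding lead_minor_def lead_block_mult_upper[OF assms]
  by (subst det_mult[of _ k]) auto

lemma lead_minor_full: "Y \<in> carrier_mat n n \<Longrightarrow> lead_minor n Y = det Y"
  unfolding lead_minor_def lead_block_def by (rule arg_cong[of _ _ det], intro eq_matI) auto

lemma lead_minor_one: "k \<le> n \<Longrightarrow> lead_minor k (1\<^sub>m n) = 1"
proof -
  assume "k \<le> n"
  then have "lead_block k (1\<^sub>m n :: complex mat) = 1\<^sub>m k"
    by (intro eq_matI) (auto simp: lead_block_def)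
  then show ?thesis by (simp add: lead_minor_def)
qed

text \<open>Once the earlier entries of row i of \<open>P\<close> are known to vanish, entry (i, j)
  of the product with j < i reduces to P_ij B_jj, and B_jj is nonzero. It serves for inverses, with
  \<open>U\<close> the identity, and for the uniqueness of LU factors.\<close>

lemma upper_triangular_right_factor:
  assumes PB: "P * B = U" and c: "P \<in> carrier_mat n n" "B \<in> carrier_mat n n"
    and B: "upper_triangular B" "det B \<noteq> (0 :: complex)" and U: "upper_triangular U"
  shows "upper_triangular P"
proof -
  have diag: "B $$ (j, j) \<noteq> (0::complex)" if "j < n" for j
    using B(2) that c(2) unfolding det_upper_triangular[OF B(1) c(2)]
    by (auto simp: prod_list_zero_iff diag_mat_def)
  have "P $$ (i, j) = 0" if "j < i" "i < n" for i j
    using that(1)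
  proof (induction j rule: less_induct)
    case (less j)
    have "U $$ (i, j) = (\<Sum>k<n. P $$ (i, k) * B $$ (k, j))"
      unfolding PB[symmetric] using less.prems that by (intro mat_mult_index[OF c]) auto
    also have "\<dots> = (\<Sum>k<n. if k = j then P $$ (i, j) * B $$ (j, j) else 0)"
    proof (intro sum.cong refl)
      fix k assume "k \<in> {..<n}"
      then show "P $$ (i, k) * B $$ (k, j) = (if k = j then P $$ (i, j) * B $$ (j, j) else 0)"
        using less upper_triangularD[OF B(1), of j k] c that
        by (cases k j rule: linorder_cases) auto
    qed
    also have "\<dots> = P $$ (i, j) * B $$ (j, j)" using less.prems that by simp
    finally have "P $$ (i, j) * B $$ (j, j) = 0"
      using upper_triangularD[OF U, of j i] less.prems that c PB by auto
    then show ?case using diag[of j] less.prems that by simp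
  qed
  then show ?thesis using c by (intro upper_triangularI) auto
qed

section \<open>The LU decomposition with regular entries\<close>

text \<open>The inverse of the lower factor in an LU decomposition, row by row: row i must
  annihilate the columns of \<open>Y\<close> before column i, hence equals (-y Y_i^(-1), 1, 0, ...)
  with Y_i the leading i x i block and y the first i entries of row i of \<open>Y\<close>. Cramer's
  rule shows that only leading minors occur as denominators. Where such a minor vanishes, division
  by 0 gives 0 and the matrix is still unitriangular, so \<open>lu_decomposition\<close> holds for
  every n x n matrix.\<close>

definition linv :: "nat \<Rightarrow> complex mat \<Rightarrow> complex mat" where
  "linv n Y = Matrix.mat n n (\<lambda>(i, l). if l = i then 1 else if i < l then 0
     else - (\<Sum>t<i. Y $$ (i, t) * adj_mat (lead_block i Y) $$ (t, l)) / lead_minor i Y)"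

definition lcoord :: "nat \<Rightarrow> complex mat \<Rightarrow> nat \<times> nat \<Rightarrow> complex" where
  "lcoord n Y = (\<lambda>(i, j). adj_mat (linv n Y) $$ (i, j))"

lemma linv_carrier [simp]: "linv n Y \<in> carrier_mat n n"
  by (simp add: linv_def)

lemma lower_unitri_linv: "lower_unitri n (linv n Y)"
  by (auto simp: lower_unitri_def linv_def)

lemma umat_lcoord: "umat n (lcoord n Y) = adj_mat (linv n Y)"
  unfolding lcoord_def
  by (rule umat_of_lower_unitri[OF lower_unitri_adj(4)[OF lower_unitri_linv]])

lemma linv_mult_upper:
  assumes Y: "Y \<in> carrier_mat n n" and nz: "\<And>k. k \<le> n \<Longrightarrow> lead_minor k Y \<noteq> 0"
  shows "upper_triangular (linv n Y * Y)"
proof (rule upper_triangularI)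
  fix i j assume ji: "j < i" "i < dim_row (linv n Y * Y)"
  then have ij: "i < n" "j < i" by (auto simp: linv_def)
  let ?d = "lead_minor i Y" and ?A = "adj_mat (lead_block i Y)"
  have "(linv n Y * Y) $$ (i, j) = (\<Sum>k<n. linv n Y $$ (i, k) * Y $$ (k, j))"
    using ij by (intro mat_mult_index[OF _ Y]) auto
  also have "\<dots> = (\<Sum>k<Suc i. linv n Y $$ (i, k) * Y $$ (k, j))"
    using ij by (intro sum.mono_neutral_right) (auto simp: linv_def)
  also have "\<dots> = Y $$ (i, j) + (\<Sum>k<i. - (\<Sum>t<i. Y $$ (i, t) * ?A $$ (t, k)) / ?d * Y $$ (k, j))"
    using ij by (simp add: linv_def)
  also have "(\<Sum>k<i. - (\<Sum>t<i. Y $$ (i, t) * ?A $$ (t, k)) / ?d * Y $$ (k, j)) =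
      - (\<Sum>k<i. \<Sum>t<i. Y $$ (i, t) * ?A $$ (t, k) * Y $$ (k, j)) / ?d"
    by (simp add: sum_divide_distrib sum_distrib_right sum_negf)
  \<comment> \<open>Regrouped so that the adjugate meets the leading block; their product is the
    minor times the identity, and the correction cancels Y_ij.\<close>
  also have "(\<Sum>k<i. \<Sum>t<i. Y $$ (i, t) * ?A $$ (t, k) * Y $$ (k, j)) =
      (\<Sum>t<i. Y $$ (i, t) * (\<Sum>k<i. ?A $$ (t, k) * lead_block i Y $$ (k, j)))"
    using ij by (subst sum.swap) (simp add: sum_distrib_left lead_block_def mult.assoc)
  also have "\<dots> = (\<Sum>t<i. Y $$ (i, t) * (?d * (if t = j then 1 else 0)))"
  proof (intro sum.cong refl arg_cong2[of _ _ _ _ "(*)"])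
    fix t assume t: "t \<in> {..<i}"
    have "(\<Sum>k<i. ?A $$ (t, k) * lead_block i Y $$ (k, j)) = (?A * lead_block i Y) $$ (t, j)"
      using ij t adj_mat(1)[of "lead_block i Y" i] by (subst mat_mult_index[of _ i i _ i]) auto
    also have "\<dots> = ?d * (if t = j then 1 else 0)"
      using ij t by (subst adj_mat(3)[of _ i]) (auto simp: lead_minor_def)
    finally show "(\<Sum>k<i. ?A $$ (t, k) * lead_block i Y $$ (k, j)) = ?d * (if t = j then 1 else 0)" .
  qed
  also have "\<dots> = (\<Sum>t<i. if t = j then ?d * Y $$ (i, j) else 0)"
    by (intro sum.cong) auto
  also have "\<dots> = ?d * Y $$ (i, j)" using ij by simp
  finally show "(linv n Y * Y) $$ (i, j) = 0"
    using nz[of i] ij by simp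
qed

lemma lu_decomposition:
  assumes Y: "Y \<in> carrier_mat n n"
  shows "umat n (lcoord n Y) * (linv n Y * Y) = Y"
proof -
  have "adj_mat (linv n Y) * (linv n Y * Y) = adj_mat (linv n Y) * linv n Y * Y"
    using lower_unitri_adj(1)[OF lower_unitri_linv] Y
    by (subst assoc_mult_mat[of _ n n _ n _ n]) auto
  then show ?thesis
    using lower_unitri_adj(3)[OF lower_unitri_linv] Y by (simp add: umat_lcoord)
qed

text \<open>\<open>M\<close> and the computed lower factor differ by a matrix that is both lower
  unitriangular and upper triangular, hence the identity. Thus \<open>lcoord\<close> recovers the
  chart coordinates of a flag from any matrix representing it.\<close>

lemma lu_unique:
  assumes M: "lower_unitri n M" and B: "upper_triangular B" "B \<in> carrier_mat n n"
    and nz: "\<And>k. k \<le> n \<Longrightarrow> lead_minor k (M * B) \<noteq> 0"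
  shows "umat n (lcoord n (M * B)) = M"
proof -
  have Mc: "M \<in> carrier_mat n n" using M by (simp add: lower_unitri_def)
  define P where "P = linv n (M * B) * M"
  have P: "lower_unitri n P"
    unfolding P_def by (rule lower_unitri_mult[OF lower_unitri_linv M])
  then have Pc: "P \<in> carrier_mat n n" by (simp add: lower_unitri_def)
  have "det B \<noteq> 0"
    using nz[of n] lead_minor_full[of "M * B" n] Mc B(2) det_mult[OF Mc B(2)] by auto
  moreover have "P * B = linv n (M * B) * (M * B)"
    unfolding P_def using Mc B(2) by (subst assoc_mult_mat[of _ n n _ n _ n]) auto
  ultimately have "upper_triangular P"
    using linv_mult_upper[of "M * B" n] Mc B nz Pc
    by (intro upper_triangular_right_factor[of P B _ n]) auto
  then have "P = 1\<^sub>m n"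
    using P by (intro eq_matI) (auto simp: lower_unitri_def upper_triangular_def,
      metis linorder_neqE_nat)
  have "adj_mat (linv n (M * B)) * P = adj_mat (linv n (M * B)) * linv n (M * B) * M"
    unfolding P_def using lower_unitri_adj(1)[OF lower_unitri_linv] Mc
    by (subst assoc_mult_mat[of _ n n _ n _ n]) auto
  also have "\<dots> = M" using lower_unitri_adj(3)[OF lower_unitri_linv] Mc by simp
  finally show ?thesis
    using \<open>P = 1\<^sub>m n\<close> right_mult_one_mat[OF lower_unitri_adj(1)[OF lower_unitri_linv]]
    by (simp add: umat_lcoord)
qed

section \<open>Localization\<close>

text \<open>Localization at \<open>D\<close>, realised by total functions: an element is a fraction
  g / D^m where \<open>D\<close> is nonzero and arbitrary elsewhere. The same formula applied to an
  ideal gives the extended ideal.\<close>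

definition loc :: "('p \<Rightarrow> complex) \<Rightarrow> ('p \<Rightarrow> complex) set \<Rightarrow> ('p \<Rightarrow> complex) set" where
  "loc D A = {f. \<exists>m. \<exists>g\<in>A. \<forall>x. D x \<noteq> 0 \<longrightarrow> f x * D x ^ m = g x}"

lemma locI: "g \<in> A \<Longrightarrow> (\<And>x. D x \<noteq> 0 \<Longrightarrow> f x * D x ^ m = g x) \<Longrightarrow> f \<in> loc D A"
  unfolding loc_def by blast

lemma loc_base: "f \<in> A \<Longrightarrow> f \<in> loc D A"
  by (rule locI[of f A D f 0]) auto

lemma loc_cong: "g \<in> loc D A \<Longrightarrow> (\<And>x. D x \<noteq> 0 \<Longrightarrow> f x = g x) \<Longrightarrow> f \<in> loc D A"
  unfolding loc_def by auto

lemma (in fun_ideal) fun_ideal_loc: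
  assumes D: "D \<in> A"
  shows "fun_ideal (loc D A) (loc D I)"
proof -
  have mul_gen: "(\<lambda>x. f x * g x) \<in> loc D T" if fl: "f \<in> loc D A" and gl: "g \<in> loc D T" and TT:
    "\<And>f g. f \<in> A \<Longrightarrow> g \<in> T \<Longrightarrow> (\<lambda>x. f x * g x) \<in> T" for f g T
  proof -
    obtain m f' where f: "f' \<in> A" "\<And>x. D x \<noteq> 0 \<Longrightarrow> f x * D x ^ m = f' x"
      using fl unfolding loc_def by blast
    obtain k g' where g: "g' \<in> T" "\<And>x. D x \<noteq> 0 \<Longrightarrow> g x * D x ^ k = g' x"
      using gl unfolding loc_def by blast
    show ?thesis
    proof (rule locI[of "\<lambda>x. f' x * g' x" _ _ _ "m + k"])
      show "(\<lambda>x. f' x * g' x) \<in> T" by (rule TT[OF f(1) g(1)])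
      fix x assume x: "D x \<noteq> 0"
      show "f x * g x * D x ^ (m + k) = f' x * g' x"
        unfolding f(2)[OF x, symmetric] g(2)[OF x, symmetric] by (simp add: power_add)
    qed
  qed
  have add_gen: "(\<lambda>x. f x + g x) \<in> loc D T" if fl: "f \<in> loc D T" and gl: "g \<in> loc D T" and TT:
    "\<And>f g. f \<in> A \<Longrightarrow> g \<in> T \<Longrightarrow> (\<lambda>x. f x * g x) \<in> T" and SS:
    "\<And>f g. f \<in> T \<Longrightarrow> g \<in> T \<Longrightarrow> (\<lambda>x. f x + g x) \<in> T" for f g T
  proof -
    obtain m f' where f: "f' \<in> T" "\<And>x. D x \<noteq> 0 \<Longrightarrow> f x * D x ^ m = f' x"
      using fl unfolding loc_def by blast
    obtain k g' where g: "g' \<in> T" "\<And>x. D x \<noteq> 0 \<Longrightarrow> g x * D x ^ k = g' x"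
      using gl unfolding loc_def by blast
    show ?thesis
    proof (rule locI[of "\<lambda>x. D x ^ k * f' x + D x ^ m * g' x" _ _ _ "m + k"])
      show "(\<lambda>x. D x ^ k * f' x + D x ^ m * g' x) \<in> T"
        by (rule SS[OF TT[OF power[OF D] f(1)] TT[OF power[OF D] g(1)]])
      fix x assume x: "D x \<noteq> 0"
      show "(f x + g x) * D x ^ (m + k) = D x ^ k * f' x + D x ^ m * g' x"
        unfolding f(2)[OF x, symmetric] g(2)[OF x, symmetric]
        by (simp add: power_add algebra_simps)
    qed
  qed
  show ?thesis
  proof unfold_locales
    show "(\<lambda>_. c) \<in> loc D A" for c by (rule loc_base[OF const])
    show "(\<lambda>x. f x + g x) \<in> loc D A" if "f \<in> loc D A" "g \<in> loc D A" for f g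
      by (rule add_gen[OF that]) (fact mult add)+
    show "(\<lambda>x. f x * g x) \<in> loc D A" if "f \<in> loc D A" "g \<in> loc D A" for f g
      by (rule mul_gen[OF that]) (fact mult)
    show "loc D I \<subseteq> loc D A" using ideal_sub unfolding loc_def by blast
    show "(\<lambda>_. 0) \<in> loc D I" by (rule loc_base[OF ideal_zero])
    show "(\<lambda>x. f x + g x) \<in> loc D I" if "f \<in> loc D I" "g \<in> loc D I" for f g
      by (rule add_gen[OF that]) (fact ideal_mult ideal_add)+
    show "(\<lambda>x. f x * g x) \<in> loc D I" if "f \<in> loc D A" "g \<in> loc D I" for f g
      by (rule mul_gen[OF that]) (fact ideal_mult)
  qed
qed

lemma (in fun_alg) fun_alg_loc:
  assumes "D \<in> A" shows "fun_alg (loc D A)"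
proof -
  have "fun_ideal A A"
    by unfold_locales (use const local.add mult in \<open>simp_all\<close>)
  then have "fun_ideal (loc D A) (loc D A)" by (rule fun_ideal.fun_ideal_loc[OF _ assms])
  then show ?thesis by (simp add: fun_ideal_def)
qed

definition lead_prod :: "nat \<Rightarrow> complex mat \<Rightarrow> complex" where
  "lead_prod n Y = (\<Prod>k\<le>n. lead_minor k Y)"

lemma lead_prod_nonzero: "lead_prod n Y \<noteq> 0 \<longleftrightarrow> (\<forall>k\<le>n. lead_minor k Y \<noteq> 0)"
  by (auto simp: lead_prod_def)

context fun_alg
begin

lemma lead_minor:
  assumes "\<And>i j. i < n \<Longrightarrow> j < n \<Longrightarrow> (\<lambda>x. Y x $$ (i, j)) \<in> A" and "k \<le> n"
  shows "(\<lambda>x. lead_minor k (Y x)) \<in> A"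
  unfolding lead_minor_def
proof (rule det[where n = k])
  fix i j assume "i < k" "j < k"
  then show "(\<lambda>x. lead_block k (Y x) $$ (i, j)) \<in> A"
    using assms(1)[of i j] assms(2) by (simp add: lead_block_def)
qed simp

lemma lead_prod:
  assumes "\<And>i j. i < n \<Longrightarrow> j < n \<Longrightarrow> (\<lambda>x. Y x $$ (i, j)) \<in> A"
  shows "(\<lambda>x. lead_prod n (Y x)) \<in> A"
  unfolding lead_prod_def by (rule prod, rule lead_minor) (use assms in auto)

lemma linv_regular:
  assumes Y: "\<And>i j. i < n \<Longrightarrow> j < n \<Longrightarrow> (\<lambda>x. Y x $$ (i, j)) \<in> A"
    and ij: "i < n" "j < n"
  shows "(\<lambda>x. linv n (Y x) $$ (i, j)) \<in> loc (\<lambda>x. lead_prod n (Y x)) A"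
proof -
  let ?D = "\<lambda>x. lead_prod n (Y x)"
  have DA: "?D \<in> A" by (rule lead_prod[OF Y])
  interpret L: fun_alg "loc ?D A" by (rule fun_alg_loc[OF DA])
  consider "j = i" | "i < j" | "j < i" by linarith
  then show ?thesis
  proof cases
    case 3
    \<comment> \<open>Every leading minor is a factor of \<open>lead_prod\<close>, so one power of
      the product clears this denominator.\<close>
    have inv: "(\<lambda>x. 1 / lead_minor i (Y x)) \<in> loc ?D A"
    proof (rule locI[of _ _ _ _ 1])
      show "(\<lambda>x. \<Prod>k\<in>{..n} - {i}. lead_minor k (Y x)) \<in> A"
        by (rule prod, rule lead_minor[OF Y]) auto
      fix x assume "?D x \<noteq> 0"
      then have "lead_minor i (Y x) \<noteq> 0" using ij by (simp add: lead_prod_nonzero)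
      then show "1 / lead_minor i (Y x) * ?D x ^ 1 = (\<Prod>k\<in>{..n} - {i}. lead_minor k (Y x))"
        using ij unfolding lead_prod_def by (subst prod.remove[of _ i]) auto
    qed
    have "(\<lambda>x. Y x $$ (i, t) * adj_mat (lead_block i (Y x)) $$ (t, j)) \<in> A" if "t < i" for t
    proof (rule mult)
      show "(\<lambda>x. Y x $$ (i, t)) \<in> A" using Y that ij by auto
      show "(\<lambda>x. adj_mat (lead_block i (Y x)) $$ (t, j)) \<in> A"
      proof (rule adj_mat[where n = i])
        fix k l assume "k < i" "l < i"
        then show "(\<lambda>x. lead_block i (Y x) $$ (k, l)) \<in> A"
          using Y[of k l] ij by (simp add: lead_block_def)
      qed (use that 3 in auto)
    qed
    then have "(\<lambda>x. \<Sum>t<i. Y x $$ (i, t) * adj_mat (lead_block i (Y x)) $$ (t, j)) \<in> A"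
      by (intro sum) auto
    then have "(\<lambda>x. (- (\<Sum>t<i. Y x $$ (i, t) * adj_mat (lead_block i (Y x)) $$ (t, j))) *
        (1 / lead_minor i (Y x))) \<in> loc ?D A"
      by (intro L.mult inv L.uminus loc_base)
    then show ?thesis using ij 3 by (simp add: linv_def)
  qed (use ij in \<open>simp_all add: linv_def L.const\<close>)
qed

lemma lcoord_regular:
  assumes Y: "\<And>i j. i < n \<Longrightarrow> j < n \<Longrightarrow> (\<lambda>x. Y x $$ (i, j)) \<in> A"
    and v: "v \<in> lcoords n"
  shows "(\<lambda>x. lcoord n (Y x) v) \<in> loc (\<lambda>x. lead_prod n (Y x)) A"
proof -
  interpret L: fun_alg "loc (\<lambda>x. lead_prod n (Y x)) A"
    by (rule fun_alg_loc, rule lead_prod[OF Y])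
  obtain i j where ij: "v = (i, j)" "i < n" "j < n" using v by (auto simp: lcoords_def)
  have "(\<lambda>x. adj_mat (linv n (Y x)) $$ (i, j)) \<in> loc (\<lambda>x. lead_prod n (Y x)) A"
    by (rule L.adj_mat[where n = n, OF _ linv_regular[OF Y]]) (use ij in auto)
  then show ?thesis using ij by (simp add: lcoord_def)
qed

end

lemma umat_entry_pf: "i < n \<Longrightarrow> j < n \<Longrightarrow> (\<lambda>a. umat n a $$ (i, j)) \<in> pf (lcoords n)"
  by (cases "j < i") (auto simp: umat_def lcoords_def intro: pf.var pf.const)

lemma mult_umat_entry_pf:
  assumes "C \<in> carrier_mat n n" "i < n" "j < n"
  shows "(\<lambda>a. (C * umat n a) $$ (i, j)) \<in> pf (lcoords n)"
  by (rule pfa.mat_mult[where n = n]) (use assms in \<open>auto intro: umat_entry_pf pf.const\<close>)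

section \<open>Transfer between charts\<close>

text \<open>In the chart around the flag of an invertible matrix \<open>Q\<close> the conditions \<open>X\<^sup>-\<^sup>1 N X \<in> H(h)\<close> read
  \<open>M\<^sup>-\<^sup>1 E M \<in> H(h)\<close> with \<open>M\<close> lower unitriangular and \<open>E = Q\<^sup>-\<^sup>1 N Q\<close>.\<close>

definition uconj :: "nat \<Rightarrow> complex mat \<Rightarrow> (nat \<times> nat \<Rightarrow> complex) \<Rightarrow> complex mat" where
  "uconj n E a = adj_mat (umat n a) * E * umat n a"

definition uconj_fun :: "nat \<Rightarrow> complex mat \<Rightarrow> nat \<times> nat \<Rightarrow> (nat \<times> nat \<Rightarrow> complex) \<Rightarrow> complex" where
  "uconj_fun n E v a = uconj n E a $$ v"

lemma adj_umat [simp]: "adj_mat (umat n a) \<in> carrier_mat n n"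
  by (rule lower_unitri_adj(1)[OF lower_unitri_umat])

lemma adj_umat_mult [simp]: "adj_mat (umat n a) * umat n a = 1\<^sub>m n"
    "umat n a * adj_mat (umat n a) = 1\<^sub>m n"
  by (rule lower_unitri_adj[OF lower_unitri_umat])+

lemma uconj_carrier [simp]: "E \<in> carrier_mat n n \<Longrightarrow> uconj n E a \<in> carrier_mat n n"
  unfolding uconj_def by (meson adj_umat mult_carrier_mat umat_carrier)

lemma uconj_entry_pf:
  assumes "E \<in> carrier_mat n n" "i < n" "j < n"
  shows "uconj_fun n E (i, j) \<in> pf (lcoords n)"
proof -
  have "(\<lambda>a. (adj_mat (umat n a) * E * umat n a) $$ (i, j)) \<in> pf (lcoords n)"
  proof (rule pfa.mat_mult[where n = n])
    show "(\<lambda>a. umat n a $$ (k, l)) \<in> pf (lcoords n)" if "k < n" "l < n" for k l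
      by (rule umat_entry_pf[OF that])
    show "(\<lambda>a. (adj_mat (umat n a) * E) $$ (k, l)) \<in> pf (lcoords n)" if kl: "k < n" "l < n" for k l
    proof (rule pfa.mat_mult[where n = n])
      show "(\<lambda>a. adj_mat (umat n a) $$ (k, l)) \<in> pf (lcoords n)" if "k < n" "l < n" for k l
        by (rule pfa.adj_mat[where n = n]) (use that in \<open>auto intro: umat_entry_pf\<close>)
    qed (use assms kl in \<open>auto intro: pf.const\<close>)
  qed (use assms mult_carrier_mat[OF adj_umat assms(1)] in auto)
  then show ?thesis by (simp add: uconj_fun_def[abs_def] uconj_def)
qed

text \<open>Passing to another chart changes the matrix on which the Hessenberg conditions are
  imposed by conjugation with the upper triangular factor \<open>B\<close>. Its inverse
  \<open>R\<close> is written with \<open>C'\<close> and an adjugate instead of an inverse of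
  \<open>B\<close>, so that its entries are visibly regular.\<close>

lemma uconj_change_basis:
  assumes c: "C \<in> carrier_mat n n" "C' \<in> carrier_mat n n" "E \<in> carrier_mat n n" "B \<in> carrier_mat n n"
    and inv: "C * C' = 1\<^sub>m n" "C' * C = 1\<^sub>m n"
    and eq: "C * umat n a = umat n b * B" and B: "upper_triangular B"
  defines "R \<equiv> adj_mat (umat n a) * C' * umat n b"
  shows "R \<in> carrier_mat n n" "B * R = 1\<^sub>m n" "R * B = 1\<^sub>m n" "upper_triangular R"
    "uconj n (C * E * C') b = B * uconj n E a * R"
    "C' * umat n b = umat n a * R"
proof -
  let ?U = "umat n a" and ?V = "umat n b" and ?Ui = "adj_mat (umat n a)" and ?Vi = "adj_mat (umat n b)"
  have car: "?U \<in> carrier_mat n n" "?V \<in> carrier_mat n n" "?Ui \<in> carrier_mat n n" "?Vi \<in> carrier_mat n n"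
    by simp_all
  note [simp] = car c inv mult_carrier_mat[of _ n n _ n]
  have as: "(X * Y) * Z = X * (Y * Z)" if "X \<in> carrier_mat n n" "Y \<in> carrier_mat n n" "Z \<in> carrier_mat n n"
    for X Y Z :: "complex mat" using that by (rule assoc_mult_mat)
  have can: "X * (Y * Z) = Z" if "X * Y = 1\<^sub>m n" "X \<in> carrier_mat n n" "Y \<in> carrier_mat n n" "Z \<in> carrier_mat n n"
    for X Y Z :: "complex mat" using that as[of X Y Z] by simp
  note cans = can[of ?U ?Ui] can[of ?Ui ?U] can[of ?V ?Vi] can[of ?Vi ?V] can[of C C'] can[of C' C]
  show Rc: "R \<in> carrier_mat n n" by (simp add: R_def)
  have Beq: "B = ?Vi * (C * ?U)" unfolding eq by (simp add: cans)
  have Req: "R = ?Ui * (C' * ?V)" unfolding R_def by (simp add: as)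
  show "B * R = 1\<^sub>m n" unfolding Beq Req by (simp add: as cans)
  show RB: "R * B = 1\<^sub>m n" unfolding Beq Req by (simp add: as cans)
  show "uconj n (C * E * C') b = B * uconj n E a * R"
    unfolding uconj_def Beq Req by (simp add: as cans)
  show "C' * ?V = ?U * R" unfolding Req by (simp add: as cans)
  have "det R * det B = 1" using det_mult[OF Rc c(4)] RB by simp
  then have "det B \<noteq> 0" by auto
  then show "upper_triangular R"
    by (rule upper_triangular_right_factor[OF RB Rc c(4) B]) (auto simp: upper_triangular_def)
qed

text \<open>Indices run from 0, as for matrix entries. \<open>h_indec\<close> says that the
  subdiagonal is never constrained.\<close>

locale hessenberg_fun =
  fixes n :: nat and h :: "nat \<Rightarrow> nat"
  assumes h_less: "j < n \<Longrightarrow> h j < n"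
    and h_mono: "i \<le> j \<Longrightarrow> j < n \<Longrightarrow> h i \<le> h j"
    and h_indec: "Suc j < n \<Longrightarrow> Suc j \<le> h j"
begin

definition below :: "(nat \<times> nat) set" where
  "below = {(i, j). i < n \<and> j < n \<and> h j < i}"

definition hJ :: "complex mat \<Rightarrow> ((nat \<times> nat \<Rightarrow> complex) \<Rightarrow> complex) set" where
  "hJ E = idl (pf (lcoords n)) (uconj_fun n E ` below)"

definition hZ :: "complex mat \<Rightarrow> (nat \<times> nat \<Rightarrow> complex) set" where
  "hZ E = {a. \<forall>v\<in>below. uconj_fun n E v a = 0}"

definition reduced :: "complex mat \<Rightarrow> bool" where
  "reduced E \<longleftrightarrow> (\<forall>p\<in>pf (lcoords n). (\<forall>a\<in>hZ E. p a = 0) \<longrightarrow> p \<in> hJ E)"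

lemma h_ge: "j < n \<Longrightarrow> j \<le> h j"
proof -
  assume "j < n"
  show "j \<le> h j"
  proof (cases j)
    case (Suc i)
    then show ?thesis using h_indec[of i] h_mono[of i j] \<open>j < n\<close> by simp
  qed simp
qed

lemma below_gt: "(i, j) \<in> below \<Longrightarrow> j < i"
  using h_ge[of j] by (auto simp: below_def)

lemma fun_ideal_hJ: "E \<in> carrier_mat n n \<Longrightarrow> fun_ideal (pf (lcoords n)) (hJ E)"
  unfolding hJ_def
  by (rule pfa.fun_ideal_idl) (auto simp: below_def intro!: uconj_entry_pf)

text \<open>Stability of H(h) under conjugation by the Borel group, in the form that ideals require:
  linear combinations of the constrained entries. If B_ik and R_lj are nonzero then i \<le> k and l
  \<le> j, and monotonicity gives h(l) \<le> h(j) < i \<le> k, so (k, l) is constrained as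
  well.\<close>

lemma upper_conj_below:
  assumes "B \<in> carrier_mat n n" "X \<in> carrier_mat n n" "R \<in> carrier_mat n n"
    and "upper_triangular B" "upper_triangular R" and v: "(i, j) \<in> below"
  shows "(B * X * R) $$ (i, j) = (\<Sum>(k, l)\<in>below. B $$ (i, k) * X $$ (k, l) * R $$ (l, j))"
proof -
  have ij: "i < n" "j < n" "h j < i" using v by (auto simp: below_def)
  have "(B * X * R) $$ (i, j) = (\<Sum>l<n. (B * X) $$ (i, l) * R $$ (l, j))"
    using assms ij by (intro mat_mult_index[of _ n n _ n]) auto
  also have "\<dots> = (\<Sum>l<n. \<Sum>k<n. B $$ (i, k) * X $$ (k, l) * R $$ (l, j))"
  proof (intro sum.cong refl)
    fix l assume "l \<in> {..<n}"
    then have "(B * X) $$ (i, l) = (\<Sum>k<n. B $$ (i, k) * X $$ (k, l))"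
      using assms ij by (intro mat_mult_index[of _ n n _ n]) auto
    then show "(B * X) $$ (i, l) * R $$ (l, j) = (\<Sum>k<n. B $$ (i, k) * X $$ (k, l) * R $$ (l, j))"
      by (simp add: sum_distrib_right)
  qed
  also have "\<dots> = (\<Sum>(k, l)\<in>{..<n} \<times> {..<n}. B $$ (i, k) * X $$ (k, l) * R $$ (l, j))"
    by (subst sum.swap) (simp add: sum.cartesian_product)
  also have "\<dots> = (\<Sum>(k, l)\<in>below. B $$ (i, k) * X $$ (k, l) * R $$ (l, j))"
  proof (intro sum.mono_neutral_right ballI)
    show "below \<subseteq> {..<n} \<times> {..<n}" by (auto simp: below_def)
    fix v assume v: "v \<in> {..<n} \<times> {..<n} - below"
    obtain k l where kl: "v = (k, l)" by (cases v)
    have kln: "k < n" "l < n" "k \<le> h l" using v kl by (auto simp: below_def)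
    have "k < i \<or> j < l" using h_mono[of l j] ij kln by (cases "l \<le> j") auto
    then show "(case v of (k, l) \<Rightarrow> B $$ (i, k) * X $$ (k, l) * R $$ (l, j)) = 0"
      using kl kln ij assms upper_triangularD[OF assms(4), of k i] upper_triangularD[OF assms(5), of j l]
      by auto
  qed simp
  finally show ?thesis .
qed

text \<open>On the overlap of the two charts \<open>p\<close> is rewritten in the other coordinates,
  cleared of denominators, placed in the ideal there by reducedness, and pulled back. Pulling back
  inverts the minors of the chart change, which costs the power in the conclusion.\<close>

theorem transfer:
  assumes c: "C \<in> carrier_mat n n" "C' \<in> carrier_mat n n" "E \<in> carrier_mat n n"
    and inv: "C * C' = 1\<^sub>m n" "C' * C = 1\<^sub>m n"
    and red: "reduced (C * E * C')"
    and p: "p \<in> pf (lcoords n)" "\<And>a. a \<in> hZ E \<Longrightarrow> p a = 0"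
  shows "\<exists>m. (\<lambda>a. lead_prod n (C * umat n a) ^ m * p a) \<in> hJ E"
proof -
  let ?E = "C * E * C'" and ?A = "pf (lcoords n)"
  define D where "D = (\<lambda>a. lead_prod n (C * umat n a))"
  define D' where "D' = (\<lambda>b. lead_prod n (C' * umat n b))"
  define \<beta> where "\<beta> = (\<lambda>a. lcoord n (C * umat n a))"
  define \<alpha> where "\<alpha> = (\<lambda>b. lcoord n (C' * umat n b))"
  define B where "B = (\<lambda>a. linv n (C * umat n a) * (C * umat n a))"
  define R where "R = (\<lambda>a. adj_mat (umat n a) * C' * umat n (\<beta> a))"
  have E'c: "?E \<in> carrier_mat n n" using c by auto
  have E'E: "C' * ?E * C = E"
    using c inv by (simp add: assoc_mult_mat[of _ n n _ n _ n] mult_carrier_mat[of _ n n _ n])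
      (metis assoc_mult_mat left_mult_one_mat right_mult_one_mat mult_carrier_mat)
  have DA: "D \<in> ?A" and DA': "D' \<in> ?A"
    unfolding D_def D'_def by (rule pfa.lead_prod, rule mult_umat_entry_pf; use c in simp)+
  have Yc: "C * umat n a \<in> carrier_mat n n" "C' * umat n a \<in> carrier_mat n n" for a
    using c by auto
  have Bc: "B a \<in> carrier_mat n n" for a
    unfolding B_def using Yc(1)[of a] by (meson linv_carrier mult_carrier_mat)
  have lu: "C * umat n a = umat n (\<beta> a) * B a" for a
    unfolding \<beta>_def B_def by (rule lu_decomposition[symmetric, OF Yc(1)])
  have Bu: "upper_triangular (B a)" if "D a \<noteq> 0" for a
    unfolding B_def using that by (intro linv_mult_upper Yc) (auto simp: D_def lead_prod_nonzero)
  have R_fold: "adj_mat (umat n a) * C' * umat n (\<beta> a) = R a" for a by (simp add: R_def)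
  note R = uconj_change_basis[OF c Bc inv lu Bu, unfolded R_fold]
  \<comment> \<open>The two chart changes have triangular factors \<open>B\<close> and
    \<open>R\<close> inverse to each other, so their leading minors are reciprocal. Powers of
    \<open>D'\<close> can therefore be traded for powers of \<open>D\<close>.\<close>
  have DD: "D' (\<beta> a) * D a = 1" if "D a \<noteq> 0" for a
  proof -
    have "lead_minor k (C' * umat n (\<beta> a)) * lead_minor k (C * umat n a) = 1" if k: "k \<le> n" for k
    proof -
      have "lead_minor k (R a) * lead_minor k (B a) = 1"
        using lead_minor_upper_mult[OF Bu[OF \<open>D a \<noteq> 0\<close>] Bc R(1)[OF \<open>D a \<noteq> 0\<close>] k]
          R(3)[OF \<open>D a \<noteq> 0\<close>] lead_minor_one[OF k] by simp
      then show ?thesis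
        unfolding R(6)[OF \<open>D a \<noteq> 0\<close>] lu
        using lead_minor_lower_mult[OF lower_unitri_umat R(1)[OF \<open>D a \<noteq> 0\<close>] k]
          lead_minor_lower_mult[OF lower_unitri_umat Bc k] by simp
    qed
    then show ?thesis
      unfolding D_def D'_def lead_prod_def by (simp add: prod.distrib[symmetric])
  qed
  have roundtrip: "p (\<alpha> (\<beta> a)) = p a" if "D a \<noteq> 0" for a
  proof -
    have "D' (\<beta> a) \<noteq> 0" using DD[OF that] by auto
    then have "umat n (\<alpha> (\<beta> a)) = umat n a"
      unfolding \<alpha>_def R(6)[OF that] D'_def
      by (intro lu_unique[OF lower_unitri_umat R(4)[OF that] R(1)[OF that]])
        (simp add: lead_prod_nonzero)
    then show ?thesis using p(1) umat_inj by (intro pf_depends[OF p(1)]) auto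
  qed
  interpret LA': fun_alg "loc D' ?A" by (rule pfa.fun_alg_loc[OF DA'])
  have "(\<lambda>b. p (\<alpha> b)) \<in> loc D' ?A"
    using LA'.pf_compose[OF p(1), of \<alpha>] pfa.lcoord_regular[OF mult_umat_entry_pf[OF c(2)]]
    unfolding \<alpha>_def D'_def by blast
  then obtain m p' where p': "p' \<in> ?A" "\<And>b. D' b \<noteq> 0 \<Longrightarrow> p (\<alpha> b) * D' b ^ m = p' b"
    unfolding loc_def by blast
  \<comment> \<open>\<open>p'\<close> is controlled only where \<open>D'\<close> is nonzero; the
    extra factor makes \<open>q\<close> vanish on the whole zero set.\<close>
  define q where "q = (\<lambda>b. D' b * p' b)"
  have "q b = 0" if b: "b \<in> hZ ?E" for b
  proof (cases "D' b = 0")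
    case False
    define B' where "B' = linv n (C' * umat n b) * (C' * umat n b)"
    have lu': "C' * umat n b = umat n (\<alpha> b) * B'"
      unfolding B'_def \<alpha>_def by (rule lu_decomposition[symmetric, OF Yc(2)])
    have B'c: "B' \<in> carrier_mat n n"
      unfolding B'_def using Yc(2)[of b] by (meson linv_carrier mult_carrier_mat)
    have B'u: "upper_triangular B'"
      unfolding B'_def using False by (intro linv_mult_upper Yc) (auto simp: D'_def lead_prod_nonzero)
    note R' = uconj_change_basis[OF c(2,1) E'c B'c inv(2,1) lu' B'u, unfolded E'E]
    have "\<alpha> b \<in> hZ E"
      unfolding hZ_def
    proof (clarify, unfold uconj_fun_def)
      fix i j assume v: "(i, j) \<in> below"
      have "uconj n ?E b $$ (k, l) = 0" if "(k, l) \<in> below" for k l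
        using b that unfolding hZ_def uconj_fun_def by auto
      then show "uconj n E (\<alpha> b) $$ (i, j) = 0"
        unfolding R'(5) upper_conj_below[OF B'c uconj_carrier[OF E'c] R'(1) B'u R'(4) v]
        by (intro sum.neutral) auto
    qed
    then have "p' b = 0" using p(2) p'(2)[OF False] by auto
    then show ?thesis by (simp add: q_def)
  qed (simp add: q_def)
  moreover have qA: "q \<in> ?A" unfolding q_def by (rule pf.mult[OF DA' p'(1)])
  ultimately have qJ: "q \<in> hJ ?E" using red unfolding reduced_def by auto
  interpret J: fun_ideal ?A "hJ E" by (rule fun_ideal_hJ[OF c(3)])
  interpret L: fun_ideal "loc D ?A" "loc D (hJ E)" by (rule J.fun_ideal_loc[OF DA])
  have entries: "(\<lambda>a. (C * umat n a) $$ (i, j)) \<in> loc D ?A" "(\<lambda>a. adj_mat (umat n a) $$ (i, j)) \<in> loc D ?A"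
    "(\<lambda>a. linv n (C * umat n a) $$ (i, j)) \<in> loc D ?A"
    "(\<lambda>a. umat n (\<beta> a) $$ (i, j)) \<in> loc D ?A" if ij: "i < n" "j < n" for i j
  proof -
    show "(\<lambda>a. (C * umat n a) $$ (i, j)) \<in> loc D ?A"
      by (rule loc_base[OF mult_umat_entry_pf[OF c(1) ij]])
    show "(\<lambda>a. adj_mat (umat n a) $$ (i, j)) \<in> loc D ?A"
      by (rule loc_base, rule pfa.adj_mat[where n = n]) (use ij in \<open>auto intro: umat_entry_pf\<close>)
    have *: "(\<lambda>a. linv n (C * umat n a) $$ (i, j)) \<in> loc D ?A" if "i < n" "j < n" for i j
      unfolding D_def by (rule pfa.linv_regular[OF mult_umat_entry_pf[OF c(1)] that])
    show "(\<lambda>a. linv n (C * umat n a) $$ (i, j)) \<in> loc D ?A" by (rule *[OF ij])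
    show "(\<lambda>a. umat n (\<beta> a) $$ (i, j)) \<in> loc D ?A"
      unfolding \<beta>_def umat_lcoord by (rule L.adj_mat[where n = n, OF _ *]) (use ij in auto)
  qed
  have beta: "(\<lambda>a. \<beta> a v) \<in> loc D ?A" if "v \<in> lcoords n" for v
    unfolding \<beta>_def D_def by (rule pfa.lcoord_regular[OF mult_umat_entry_pf[OF c(1)] that])
  have Bent: "(\<lambda>a. B a $$ (i, j)) \<in> loc D ?A" if "i < n" "j < n" for i j
    unfolding B_def by (rule L.mat_mult[where n = n]) (use that Yc entries in auto)
  have Rent: "(\<lambda>a. R a $$ (i, j)) \<in> loc D ?A" if ij: "i < n" "j < n" for i j
    unfolding R_def
  proof (rule L.mat_mult[where n = n])
    show "adj_mat (umat n a) * C' \<in> carrier_mat n n" for a using c by (meson adj_umat mult_carrier_mat)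
    show "(\<lambda>a. (adj_mat (umat n a) * C') $$ (k, l)) \<in> loc D ?A" if "k < n" "l < n" for k l
      by (rule L.mat_mult[where n = n]) (use that entries c L.const in auto)
  qed (use ij entries in auto)
  have "(\<lambda>a. q (\<beta> a)) \<in> loc D (hJ E)"
  proof (rule L.idl_compose[OF qJ[unfolded hJ_def]])
    show "(\<lambda>a. g (\<beta> a)) \<in> loc D ?A" if "g \<in> ?A" for g
      by (rule L.pf_compose[OF that beta])
    fix f assume "f \<in> uconj_fun n ?E ` below"
    then obtain i j where f: "f = uconj_fun n ?E (i, j)" and v: "(i, j) \<in> below" by auto
    show "(\<lambda>a. f (\<beta> a)) \<in> loc D (hJ E)"
    proof (rule loc_cong)
      show "(\<lambda>a. \<Sum>(k, l)\<in>below. B a $$ (i, k) * uconj_fun n E (k, l) a * R a $$ (l, j)) \<in> loc D (hJ E)"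
      proof (rule L.ideal_sum, clarify)
        fix k l assume kl: "(k, l) \<in> below"
        have lt: "i < n" "j < n" "k < n" "l < n" using v kl by (auto simp: below_def)
        have "uconj_fun n E (k, l) \<in> hJ E"
          unfolding hJ_def by (rule pfa.idl_gen) (use kl in auto)
        from L.ideal_mult2[OF L.ideal_mult[OF Bent[OF lt(1,3)] loc_base[OF this]] Rent[OF lt(4,2)]]
        show "(\<lambda>a. B a $$ (i, k) * uconj_fun n E (k, l) a * R a $$ (l, j)) \<in> loc D (hJ E)" .
      qed
      fix a assume a: "D a \<noteq> 0"
      show "f (\<beta> a) = (\<Sum>(k, l)\<in>below. B a $$ (i, k) * uconj_fun n E (k, l) a * R a $$ (l, j))"
        unfolding f uconj_fun_def R(5)[OF a]
        by (rule upper_conj_below[OF Bc uconj_carrier[OF c(3)] R(1)[OF a] Bu[OF a] R(4)[OF a] v])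
    qed
  qed
  then have "(\<lambda>a. D a ^ Suc m * q (\<beta> a)) \<in> loc D (hJ E)"
    by (rule L.ideal_mult[OF loc_base[OF pfa.power[OF DA]]])
  then have "p \<in> loc D (hJ E)"
  proof (rule loc_cong)
    fix a assume a: "D a \<noteq> 0"
    have nz: "D' (\<beta> a) \<noteq> 0" using DD[OF a] by auto
    have "D a ^ Suc m * q (\<beta> a) = (D' (\<beta> a) * D a) ^ Suc m * p (\<alpha> (\<beta> a))"
      unfolding q_def p'(2)[OF nz, symmetric] by (simp add: power_mult_distrib)
    then show "p a = D a ^ Suc m * q (\<beta> a)" using DD[OF a] roundtrip[OF a] by simp
  qed
  then obtain m' g where g: "g \<in> hJ E" "\<And>a. D a \<noteq> 0 \<Longrightarrow> p a * D a ^ m' = g a"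
    unfolding loc_def by blast
  \<comment> \<open>One more factor \<open>D\<close> makes the identity hold also at the points
    where \<open>D\<close> is zero.\<close>
  have "(\<lambda>a. D a ^ Suc m' * p a) = (\<lambda>a. D a * g a)"
  proof
    fix a show "D a ^ Suc m' * p a = D a * g a"
      using g(2)[of a] by (cases "D a = 0") (auto simp: algebra_simps)
  qed
  moreover have "(\<lambda>a. D a * g a) \<in> hJ E" by (rule J.ideal_mult[OF DA g(1)])
  ultimately have "(\<lambda>a. D a ^ Suc m' * p a) \<in> hJ E" by (simp only:)
  then show ?thesis unfolding D_def by (rule exI)
qed

end

section \<open>The chart at the longest element\<close>

definition subdiag :: "nat \<Rightarrow> complex mat" where
  "subdiag n = Matrix.mat n n (\<lambda>(i, j). if i = Suc j then 1 else 0)"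

lemma subdiag_carrier [simp]: "subdiag n \<in> carrier_mat n n"
  by (simp add: subdiag_def)

text \<open>Row i of U F = S U, with S the subdiagonal matrix and F the conjugate, solved for its
  last term: F is computed by forward substitution.\<close>

lemma uconj_subdiag_rec:
  assumes ij: "i < n" "j < n"
  shows "uconj n (subdiag n) a $$ (i, j) =
    (if i = 0 then 0 else umat n a $$ (i - 1, j)) - (\<Sum>k<i. umat n a $$ (i, k) * uconj n (subdiag n) a $$ (k, j))"
proof -
  let ?F = "uconj n (subdiag n) a" and ?U = "umat n a"
  have "?U * ?F = (?U * adj_mat ?U) * (subdiag n * ?U)"
    unfolding uconj_def using mult_carrier_mat[of "subdiag n" n n ?U n]
    by (simp add: assoc_mult_mat[of _ n n _ n _ n] mult_carrier_mat[of _ n n _ n] del: adj_umat_mult)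
  then have UF: "?U * ?F = subdiag n * ?U"
    using mult_carrier_mat[of "subdiag n" n n ?U n] left_mult_one_mat[of "subdiag n * ?U" n n] by simp
  have "(subdiag n * ?U) $$ (i, j) = (\<Sum>k<n. subdiag n $$ (i, k) * ?U $$ (k, j))"
    using ij by (intro mat_mult_index[of _ n n _ n]) auto
  also have "\<dots> = (\<Sum>k<n. if i \<noteq> 0 \<and> k = i - 1 then ?U $$ (i - 1, j) else 0)"
    using ij by (intro sum.cong) (auto simp: subdiag_def)
  also have "\<dots> = (if i = 0 then 0 else ?U $$ (i - 1, j))"
    using ij by (cases "i = 0") auto
  finally have 1: "(?U * ?F) $$ (i, j) = (if i = 0 then 0 else ?U $$ (i - 1, j))"
    unfolding UF .
  have "(?U * ?F) $$ (i, j) = (\<Sum>k<n. ?U $$ (i, k) * ?F $$ (k, j))"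
    using ij by (intro mat_mult_index[of _ n n _ n]) auto
  also have "\<dots> = (\<Sum>k<Suc i. ?U $$ (i, k) * ?F $$ (k, j))"
    using ij by (intro sum.mono_neutral_right) (auto simp: umat_def)
  also have "\<dots> = (\<Sum>k<i. ?U $$ (i, k) * ?F $$ (k, j)) + ?F $$ (i, j)"
    using ij by (simp add: umat_def)
  finally show ?thesis using 1 by simp
qed

lemma uconj_subdiag_pf:
  assumes "i < n" "j < n"
  shows "(\<lambda>a. uconj n (subdiag n) a $$ (i, j)) \<in> pf {v \<in> lcoords n. fst v \<le> i}"
  using assms(1)
proof (induction i rule: less_induct)
  case (less i)
  let ?A = "pf {v \<in> lcoords n. fst v \<le> i}"
  have U: "(\<lambda>a. umat n a $$ (k, l)) \<in> ?A" if "k \<le> i" "l < n" for k l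
    using that less.prems by (cases "l < k") (auto simp: umat_def lcoords_def intro: pf.var pf.const)
  have "(\<lambda>a. uconj n (subdiag n) a $$ (k, j)) \<in> ?A" if "k < i" for k
    by (rule pf_mono[OF _ less.IH]) (use that less.prems in auto)
  then have "(\<lambda>a. \<Sum>k<i. umat n a $$ (i, k) * uconj n (subdiag n) a $$ (k, j)) \<in> ?A"
    using less.prems U by (intro pfa.sum pf.mult) auto
  moreover have "(\<lambda>a. if i = 0 then 0 else umat n a $$ (i - 1, j)) \<in> ?A"
    using U[of "i - 1" j] assms(2) by (cases "i = 0") (auto intro: pf.const)
  ultimately show ?case
    unfolding uconj_subdiag_rec[OF less.prems assms(2)] by (intro pfa.diff)
qed

lemma uconj_subdiag_upper:
  assumes "i < n" "j < n" "i \<le> Suc j"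
  shows "uconj n (subdiag n) a $$ (i, j) = (if i = Suc j then 1 else 0)"
  using assms(1,3)
proof (induction i rule: less_induct)
  case (less i)
  have "(\<Sum>k<i. umat n a $$ (i, k) * uconj n (subdiag n) a $$ (k, j)) = 0"
    using less by (intro sum.neutral) auto
  then show ?case
    unfolding uconj_subdiag_rec[OF less.prems(1) assms(2)] using less.prems assms(2)
    by (auto simp: umat_def)
qed

text \<open>The entry 1 of the conjugate at (j + 1, j) contributes the linear term a(i, j + 1).
  Every other variable lies in an earlier row or, in row i, in a later column, so the equation can
  be solved for a(i, j + 1).\<close>

lemma uconj_subdiag_below:
  assumes "i < n" "Suc j < i"
  shows "uconj n (subdiag n) a $$ (i, j) =
    a (i - 1, j) - (\<Sum>k\<in>{Suc (Suc j)..<i}. a (i, k) * uconj n (subdiag n) a $$ (k, j)) - a (i, Suc j)"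
proof -
  have split: "{..<i} = {..j} \<union> ({Suc j} \<union> {Suc (Suc j)..<i})" using assms by auto
  have "(\<Sum>k<i. umat n a $$ (i, k) * uconj n (subdiag n) a $$ (k, j)) =
      (\<Sum>k\<le>j. umat n a $$ (i, k) * uconj n (subdiag n) a $$ (k, j)) +
      (umat n a $$ (i, Suc j) * uconj n (subdiag n) a $$ (Suc j, j) +
       (\<Sum>k\<in>{Suc (Suc j)..<i}. umat n a $$ (i, k) * uconj n (subdiag n) a $$ (k, j)))"
    unfolding split by (subst sum.union_disjoint; (subst sum.union_disjoint)?) auto
  also have "(\<Sum>k\<le>j. umat n a $$ (i, k) * uconj n (subdiag n) a $$ (k, j)) = 0"
    using assms by (intro sum.neutral) (auto simp: uconj_subdiag_upper)
  also have "(\<Sum>k\<in>{Suc (Suc j)..<i}. umat n a $$ (i, k) * uconj n (subdiag n) a $$ (k, j)) =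
      (\<Sum>k\<in>{Suc (Suc j)..<i}. a (i, k) * uconj n (subdiag n) a $$ (k, j))"
    using assms by (intro sum.cong) (auto simp: umat_def)
  also have "umat n a $$ (i, Suc j) * uconj n (subdiag n) a $$ (Suc j, j) = a (i, Suc j)"
    using assms by (simp add: uconj_subdiag_upper) (simp add: umat_def)
  finally show ?thesis
    unfolding uconj_subdiag_rec[of i n j, OF assms(1) order.strict_trans[OF Suc_lessD[OF assms(2)] assms(1)]]
    using assms by (simp add: umat_def)
qed

theorem (in hessenberg_fun) reduced_subdiag: "reduced (subdiag n)"
  unfolding reduced_def
proof (intro ballI impI)
  fix p assume p: "p \<in> pf (lcoords n)" "\<forall>a\<in>hZ (subdiag n). p a = 0"
  \<comment> \<open>Indecomposability places a constrained position (i, j) at least two below the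
    diagonal, so (i, j + 1) is a genuine coordinate of the chart.\<close>
  define Det where "Det = (\<lambda>(i, j). (i, Suc j)) ` below"
  \<comment> \<open>Rows from top to bottom and, within a row, columns from right to left: the order
    in which the equations can be solved. The factor n + 1 exceeds every n - c, so rows are compared
    first.\<close>
  define key :: "nat \<times> nat \<Rightarrow> nat" where "key = (\<lambda>(i, c). i * Suc n + (n - c))"
  define \<phi> where "\<phi> = (\<lambda>(i, c) a. a (i - 1, c - 1) -
    (\<Sum>k\<in>{Suc c..<i}. a (i, k) * uconj n (subdiag n) a $$ (k, c - 1)))"
  have bel: "Suc j < i" if "(i, j) \<in> below" for i j
    using that h_indec[of j] below_gt[OF that] by (auto simp: below_def)
  have key_row: "key (r, c) < key (i, c')" if "r < i" for r c i c'
  proof -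
    have "key (r, c) < Suc r * Suc n" by (simp add: key_def)
    also have "\<dots> \<le> i * Suc n" using that by (intro mult_right_mono) auto
    also have "\<dots> \<le> key (i, c')" by (simp add: key_def)
    finally show ?thesis .
  qed
  have gen: "uconj_fun n (subdiag n) (i, j) = (\<lambda>a. \<phi> (i, Suc j) a - a (i, Suc j))" if "(i, j) \<in> below" for i j
    using uconj_subdiag_below[of i n j] bel[OF that] that
    by (intro ext) (simp add: uconj_fun_def \<phi>_def below_def)
  then have gens: "uconj_fun n (subdiag n) ` below = (\<lambda>v a. \<phi> v a - a v) ` Det"
    unfolding Det_def image_image by (intro image_cong) auto
  show "p \<in> hJ (subdiag n)"
    unfolding hJ_def gens
  proof (rule triangular_elimination[where key = key])
    show "finite (lcoords n)"
      by (rule finite_subset[of _ "{..<n} \<times> {..<n}"]) (auto simp: lcoords_def)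
    show "Det \<subseteq> lcoords n" using bel by (auto simp: Det_def lcoords_def below_def)
    show "inj_on key (lcoords n)"
    proof (rule inj_onI, clarify)
      fix i c i' c' assume *: "(i, c) \<in> lcoords n" "(i', c') \<in> lcoords n" "key (i, c) = key (i', c')"
      have "i = i'" using key_row[of i i' c c'] key_row[of i' i c' c] *(3) by (cases i i' rule: linorder_cases) auto
      then show "i = i' \<and> c = c'" using * by (auto simp: key_def lcoords_def)
    qed
    show "p \<in> pf (lcoords n)" by fact
    fix v assume "v \<in> Det"
    then obtain i j where v: "v = (i, Suc j)" and b: "(i, j) \<in> below" by (auto simp: Det_def)
    have ij: "Suc j < i" "i < n" using bel[OF b] b by (auto simp: below_def)
    let ?A = "pf {u \<in> lcoords n. key u < key v}"
    have "(\<lambda>a. a (i - 1, j)) \<in> ?A"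
      using ij by (intro pf.var) (auto simp: v lcoords_def intro!: key_row)
    moreover have "(\<lambda>a. a (i, k) * uconj n (subdiag n) a $$ (k, j)) \<in> ?A" if "k \<in> {Suc (Suc j)..<i}" for k
    proof (rule pf.mult)
      show "(\<lambda>a. a (i, k)) \<in> ?A"
        using ij that by (intro pf.var) (auto simp: v lcoords_def key_def)
      show "(\<lambda>a. uconj n (subdiag n) a $$ (k, j)) \<in> ?A"
        by (rule pf_mono[OF _ uconj_subdiag_pf]) (use ij that in \<open>auto simp: v intro!: key_row\<close>)
    qed
    ultimately have "(\<lambda>a. a (i - 1, j) -
        (\<Sum>k\<in>{Suc (Suc j)..<i}. a (i, k) * uconj n (subdiag n) a $$ (k, j))) \<in> ?A"
      by (intro pfa.diff pfa.sum)
    then show "\<phi> v \<in> ?A" by (simp add: v \<phi>_def)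
  next
    fix a assume "\<And>v. v \<in> Det \<Longrightarrow> \<phi> v a - a v = 0"
    then have "a \<in> hZ (subdiag n)" unfolding hZ_def Det_def using gen by fastforce
    then show "p a = 0" using p(2) by auto
  qed
qed

section \<open>Free quotients by systems with leading forms powers of the variables\<close>

text \<open>Fixing all variables but one leaves a univariate polynomial with every complex number as
  a root; its coefficients vanish, and they are polynomials in fewer variables. Exponents are zero
  outside \<open>V\<close>, hence determined by their values on \<open>V\<close>.\<close>

lemma monomials_independent:
  fixes \<kappa> :: "('v \<Rightarrow> nat) \<Rightarrow> complex"
  assumes "finite V" "finite T" "\<And>m v. m \<in> T \<Longrightarrow> v \<notin> V \<Longrightarrow> m v = 0"
    and "\<And>x. (\<Sum>m\<in>T. \<kappa> m * (\<Prod>v\<in>V. x v ^ m v)) = 0" and "m \<in> T"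
  shows "\<kappa> m = 0"
  using assms
proof (induction V arbitrary: T \<kappa> m rule: finite_induct)
  case empty
  have "m' = (\<lambda>_. 0)" if "m' \<in> T" for m' using empty.prems(2)[OF that] by auto
  then have "T = {m}" using empty.prems(4) by auto
  then show ?case using empty.prems(3) by simp
next
  case (insert v V)
  define e where "e = m v"
  define Te where "Te = {m' \<in> T. m' v = e}"
  have zero: "(\<Sum>m'\<in>Te. \<kappa> m' * (\<Prod>u\<in>V. x u ^ m' u)) = 0" for x
  proof -
    define co where "co = (\<lambda>f. \<Sum>m'\<in>{m' \<in> T. m' v = f}. \<kappa> m' * (\<Prod>u\<in>V. x u ^ m' u))"
    define P where "P = (\<Sum>f\<in>(\<lambda>m'. m' v) ` T. monom (co f) f)"
    have "poly P t = 0" for t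
    proof -
      have "(\<Prod>u\<in>V. (x(v := t)) u ^ m' u) = (\<Prod>u\<in>V. x u ^ m' u)" for m' :: "'v \<Rightarrow> nat"
        using insert.hyps by (intro prod.cong) auto
      then have "(\<Sum>m'\<in>T. \<kappa> m' * (t ^ m' v * (\<Prod>u\<in>V. x u ^ m' u))) = 0"
        using insert.prems(3)[of "x(v := t)"] insert.hyps by simp
      also have "(\<Sum>m'\<in>T. \<kappa> m' * (t ^ m' v * (\<Prod>u\<in>V. x u ^ m' u))) =
          (\<Sum>f\<in>(\<lambda>m'. m' v) ` T. \<Sum>m'\<in>{m' \<in> T. m' v = f}. \<kappa> m' * (t ^ m' v * (\<Prod>u\<in>V. x u ^ m' u)))"
        using insert.prems(1) by (subst sum.group) auto
      also have "\<dots> = poly P t"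
        unfolding P_def poly_sum poly_monom co_def
        by (intro sum.cong refl) (auto simp: sum_distrib_right sum_distrib_left mult_ac intro!: sum.cong)
      finally show ?thesis .
    qed
    then have "P = 0" by (intro poly_all_0_iff_0[THEN iffD1] allI)
    moreover have "coeff P e = co e"
      unfolding P_def coeff_sum using insert.prems(1,4)
      by (subst sum.remove[of _ e]) (auto simp: e_def intro!: sum.neutral)
    ultimately show ?thesis by (simp add: co_def Te_def)
  qed
  have inj: "inj_on (\<lambda>m'. m'(v := 0)) Te"
  proof (rule inj_onI)
    fix f g assume "f \<in> Te" "g \<in> Te" and eq: "f(v := 0) = g(v := 0)"
    show "f = g"
    proof
      fix u show "f u = g u"
        using fun_cong[OF eq, of u] \<open>f \<in> Te\<close> \<open>g \<in> Te\<close> by (cases "u = v") (auto simp: Te_def)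
    qed
  qed
  have "\<kappa> (m(v := 0, v := e)) = 0"
  proof (rule insert.IH[where T = "(\<lambda>m'. m'(v := 0)) ` Te" and \<kappa> = "\<lambda>m'. \<kappa> (m'(v := e))"])
    show "finite ((\<lambda>m'. m'(v := 0)) ` Te)" using insert.prems(1) by (simp add: Te_def)
    show "m(v := 0) \<in> (\<lambda>m'. m'(v := 0)) ` Te" using insert.prems(4) by (auto simp: Te_def e_def)
    show "m' u = 0" if "m' \<in> (\<lambda>m'. m'(v := 0)) ` Te" "u \<notin> V" for m' u
      using that insert.prems(2) by (auto simp: Te_def)
    fix x
    have "(\<Sum>m'\<in>(\<lambda>m'. m'(v := 0)) ` Te. \<kappa> (m'(v := e)) * (\<Prod>u\<in>V. x u ^ m' u)) =
        (\<Sum>m'\<in>Te. \<kappa> (m'(v := 0, v := e)) * (\<Prod>u\<in>V. x u ^ (m'(v := 0)) u))"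
      by (subst sum.reindex[OF inj]) simp
    also have "\<dots> = (\<Sum>m'\<in>Te. \<kappa> m' * (\<Prod>u\<in>V. x u ^ m' u))"
    proof (intro sum.cong refl arg_cong2[of _ _ _ _ "(*)"] prod.cong)
      fix m' assume "m' \<in> Te"
      then show "\<kappa> (m'(v := 0, v := e)) = \<kappa> m'" by (auto simp: Te_def)
      fix u assume "u \<in> V"
      then show "x u ^ (m'(v := 0)) u = x u ^ m' u" using insert.hyps by auto
    qed
    finally show "(\<Sum>m'\<in>(\<lambda>m'. m'(v := 0)) ` Te. \<kappa> (m'(v := e)) * (\<Prod>u\<in>V. x u ^ m' u)) = 0"
      using zero by simp
  qed
  then show ?case by (simp add: e_def)
qed

text \<open>On a line through a chosen parameter value, coordinates in a free module become
  univariate polynomials, where divisibility by every power of the line parameter forces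
  zero.\<close>

lemma pf_line_poly:
  assumes "y \<in> pf S"
  shows "\<exists>P. \<forall>t. y (\<lambda>v. q0 v + t * (q1 v - q0 v)) = poly P t"
  using assms
proof (induction)
  case (const c)
  show ?case by (rule exI[of _ "[:c:]"]) simp
next
  case (var v)
  show ?case by (rule exI[of _ "[:q0 v, q1 v - q0 v:]"]) simp
next
  case (add f g)
  then show ?case by (metis poly_add)
next
  case (mult f g)
  then show ?case by (metis poly_mult)
qed

text \<open>A point is a pair \<open>(q, x)\<close> of parameters and variables; \<open>weighted_poly \<omega>\<close> consists of the polynomials
  of weight at most \<open>\<omega>\<close> in \<open>x\<close>, where \<open>x k\<close> has weight \<open>W k\<close>.\<close>

type_synonym 'v point = "('v \<Rightarrow> complex) \<times> (nat \<Rightarrow> complex)"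

section \<open>Polynomials filtered by weight\<close>

locale leading_powers =
  fixes n :: nat and d W :: "nat \<Rightarrow> nat"
  assumes W_pos: "k < n \<Longrightarrow> 0 < W k" and d_pos: "k < n \<Longrightarrow> 0 < d k"
begin

definition exponents :: "(nat \<Rightarrow> nat) set" where
  "exponents = {m. \<forall>k\<ge>n. m k = 0}"

definition mono :: "(nat \<Rightarrow> nat) \<Rightarrow> (nat \<Rightarrow> complex) \<Rightarrow> complex" where
  "mono m x = (\<Prod>k<n. x k ^ m k)"

definition wt :: "(nat \<Rightarrow> nat) \<Rightarrow> nat" where
  "wt m = (\<Sum>k<n. W k * m k)"

text \<open>Exponents of the monomials divisible by no x_k^(d_k), the expected basis of the
  quotient.\<close>

definition Box :: "(nat \<Rightarrow> nat) set" where
  "Box = {m \<in> exponents. \<forall>k<n. m k < d k}"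

inductive_set weighted_poly :: "nat \<Rightarrow> ('v point \<Rightarrow> complex) set" for \<omega> where
    monomial: "y \<in> pf UNIV \<Longrightarrow> m \<in> exponents \<Longrightarrow> wt m \<le> \<omega> \<Longrightarrow>
      (\<lambda>z. y (fst z) * mono m (snd z)) \<in> weighted_poly \<omega>"
  | add: "f \<in> weighted_poly \<omega> \<Longrightarrow> g \<in> weighted_poly \<omega> \<Longrightarrow> (\<lambda>z. f z + g z) \<in> weighted_poly \<omega>"

definition polys :: "('v point \<Rightarrow> complex) set" where
  "polys = (\<Union>\<omega>. weighted_poly \<omega>)"

lemma finite_Box: "finite Box"
proof -
  have "Box \<subseteq> {f. \<forall>k. (k \<in> {..<n} \<longrightarrow> f k \<in> {..<Suc (\<Sum>k<n. d k)}) \<and> (k \<notin> {..<n} \<longrightarrow> f k = 0)}"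
  proof (clarify, intro conjI impI)
    fix f k assume f: "f \<in> Box"
    show "f k = 0" if "k \<notin> {..<n}" using f that by (auto simp: Box_def exponents_def)
    assume k: "k \<in> {..<n}"
    have "f k < d k" using f k by (auto simp: Box_def)
    also have "d k \<le> (\<Sum>k<n. d k)" using k by (intro member_le_sum) auto
    finally show "f k \<in> {..<Suc (\<Sum>k<n. d k)}" by simp
  qed
  then show ?thesis by (rule finite_subset) (rule finite_set_of_finite_funs; simp)
qed

lemma weighted_poly_mono: "f \<in> weighted_poly \<omega> \<Longrightarrow> \<omega> \<le> \<omega>' \<Longrightarrow> f \<in> weighted_poly \<omega>'"
  by (induction rule: weighted_poly.induct) (auto intro: weighted_poly.intros)

lemma mono_add: "mono m x * mono m' x = mono (\<lambda>k. m k + m' k) x"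
  by (simp add: mono_def power_add prod.distrib)

lemma wt_add: "wt (\<lambda>k. m k + m' k) = wt m + wt m'"
  by (simp add: wt_def sum.distrib distrib_left)

lemma weighted_poly_mult:
  assumes "f \<in> weighted_poly \<omega>" "g \<in> weighted_poly \<omega>'"
  shows "(\<lambda>z. f z * g z) \<in> weighted_poly (\<omega> + \<omega>')"
  using assms(1)
proof (induction rule: weighted_poly.induct)
  case (monomial y m)
  note m = this
  show ?case using assms(2)
  proof (induction rule: weighted_poly.induct)
    case (monomial y' m')
    have "(\<lambda>z. (y (fst z) * y' (fst z)) * mono (\<lambda>k. m k + m' k) (snd z)) \<in> weighted_poly (\<omega> + \<omega>')"
      by (rule weighted_poly.monomial[where y = "\<lambda>q. y q * y' q"])
        (use m monomial in \<open>auto simp: exponents_def wt_add intro: pf.mult\<close>)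
    then show ?case by (simp add: mono_add[symmetric] mult_ac)
  next
    case (add f g)
    from weighted_poly.add[OF add.IH] show ?case by (simp add: algebra_simps)
  qed
next
  case (add f1 f2)
  from weighted_poly.add[OF add.IH] show ?case by (simp add: algebra_simps)
qed

lemma weighted_poly_param: "y \<in> pf UNIV \<Longrightarrow> (\<lambda>z. y (fst z)) \<in> weighted_poly \<omega>"
  using weighted_poly.monomial[of y "\<lambda>_. 0" \<omega>] by (simp add: exponents_def wt_def mono_def)

lemma weighted_poly_mono_fun: "m \<in> exponents \<Longrightarrow> (\<lambda>z. mono m (snd z)) \<in> weighted_poly (wt m)"
  using weighted_poly.monomial[of "\<lambda>_. 1" m "wt m"] by (simp add: pf.const)

lemma weighted_poly_uminus: "f \<in> weighted_poly \<omega> \<Longrightarrow> (\<lambda>z. - f z) \<in> weighted_poly \<omega>"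
  using weighted_poly_mult[OF weighted_poly_param[OF pf.const[of "-1"], of 0], of f \<omega>] by simp

lemma weighted_poly_sum:
  "(\<And>i. i \<in> T \<Longrightarrow> f i \<in> weighted_poly \<omega>) \<Longrightarrow> (\<lambda>z. \<Sum>i\<in>T. f i z) \<in> weighted_poly \<omega>"
proof (induction T rule: infinite_finite_induct)
  case (insert i T)
  have "(\<lambda>z. f i z + (\<Sum>i\<in>T. f i z)) \<in> weighted_poly \<omega>"
    by (rule weighted_poly.add) (use insert in auto)
  then show ?case using insert.hyps by simp
qed (simp_all add: weighted_poly_param[OF pf.const])

lemma weighted_poly_var:
  assumes "k < n" shows "(\<lambda>z. snd z k) \<in> weighted_poly (W k)"
proof -
  let ?m = "(\<lambda>_. 0)(k := 1 :: nat)"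
  have "mono ?m x = x k" for x
    using assms unfolding mono_def by (subst prod.remove[of _ k]) (auto intro!: prod.neutral)
  moreover have "wt ?m = W k"
    using assms unfolding wt_def by (subst sum.remove[of _ k]) (auto intro!: sum.neutral)
  ultimately show ?thesis
    using weighted_poly_mono_fun[of ?m] assms by (simp add: exponents_def)
qed

sublocale polys: fun_alg "polys :: ('v point \<Rightarrow> complex) set"
proof
  show "(\<lambda>_. c) \<in> polys" for c
    unfolding polys_def using weighted_poly_param[OF pf.const[of c], of 0] by auto
  fix f g :: "'v point \<Rightarrow> complex"
  assume "f \<in> polys" "g \<in> polys"
  then obtain \<omega> \<omega>' where fg: "f \<in> weighted_poly \<omega>" "g \<in> weighted_poly \<omega>'" by (auto simp: polys_def)
  have "(\<lambda>z. f z + g z) \<in> weighted_poly (max \<omega> \<omega>')"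
    using fg by (intro weighted_poly.add) (auto elim: weighted_poly_mono)
  then show "(\<lambda>z. f z + g z) \<in> polys" by (auto simp: polys_def)
  show "(\<lambda>z. f z * g z) \<in> polys" using weighted_poly_mult[OF fg] by (auto simp: polys_def)
qed

lemma polysI: "f \<in> weighted_poly \<omega> \<Longrightarrow> f \<in> polys"
  by (auto simp: polys_def)

lemma reduce_exponent:
  assumes "m \<in> exponents" "k < n" "d k \<le> m k"
  defines "m' \<equiv> m(k := m k - d k)"
  shows "m' \<in> exponents" "wt m = wt m' + d k * W k" "mono m x = mono m' x * x k ^ d k"
proof -
  show "m' \<in> exponents" using assms by (auto simp: exponents_def)
  have "wt m = W k * m k + (\<Sum>j\<in>{..<n} - {k}. W j * m j)"
    unfolding wt_def using assms by (subst sum.remove[of _ k]) auto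
  moreover have "wt m' = W k * (m k - d k) + (\<Sum>j\<in>{..<n} - {k}. W j * m j)"
    unfolding wt_def m'_def using assms by (subst sum.remove[of _ k]) auto
  moreover have "W k * m k = W k * ((m k - d k) + d k)"
    using assms(3) by simp
  then have "W k * m k = W k * (m k - d k) + d k * W k"
    by (simp only: distrib_left mult.commute)
  ultimately show "wt m = wt m' + d k * W k" by simp
  have "mono m x = x k ^ m k * (\<Prod>j\<in>{..<n} - {k}. x j ^ m j)"
    unfolding mono_def using assms by (subst prod.remove[of _ k]) auto
  moreover have "mono m' x = x k ^ (m k - d k) * (\<Prod>j\<in>{..<n} - {k}. x j ^ m j)"
    unfolding mono_def m'_def using assms by (subst prod.remove[of _ k]) auto
  ultimately show "mono m x = mono m' x * x k ^ d k"
    using assms(3) by (simp add: mult_ac flip: power_add)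
qed

end

text \<open>The leading form of c_k is the pure power x_k^(d_k), of weight d_k W_k; that weight is
  positive, so subtracting 1 is a strict drop. Pure powers of distinct variables form a regular
  sequence, the structural reason for freeness; the argument itself uses explicit bases.\<close>

locale leading_powers_system = leading_powers +
  fixes c :: "nat \<Rightarrow> 'v point \<Rightarrow> complex"
  assumes leading: "k < n \<Longrightarrow> (\<lambda>z. c k z - snd z k ^ d k) \<in> weighted_poly (d k * W k - 1)"
begin

abbreviation cJ :: "('v point \<Rightarrow> complex) set" where
  "cJ \<equiv> idl polys (c ` {..<n})"

lemma c_weighted: "k < n \<Longrightarrow> c k \<in> weighted_poly (d k * W k)"
proof -
  assume k: "k < n"
  let ?m = "(\<lambda>_. 0)(k := d k)"
  have m: "mono ?m x = x k ^ d k" "wt ?m = d k * W k" for x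
    using k unfolding mono_def wt_def
    by (subst prod.remove[of _ k] sum.remove[of _ k]; auto intro!: prod.neutral sum.neutral)+
  have "(\<lambda>z. (c k z - snd z k ^ d k) + mono ?m (snd z)) \<in> weighted_poly (d k * W k)"
  proof (rule weighted_poly.add)
    show "(\<lambda>z. c k z - snd z k ^ d k) \<in> weighted_poly (d k * W k)"
      by (rule weighted_poly_mono[OF leading[OF k]]) simp
    show "(\<lambda>z. mono ?m (snd z)) \<in> weighted_poly (d k * W k)"
      using weighted_poly_mono_fun[of ?m] k m by (simp add: exponents_def)
  qed
  then show ?thesis by (simp add: m)
qed

sublocale cJ: fun_ideal "polys :: ('v point \<Rightarrow> complex) set" cJ
  by (rule polys.fun_ideal_idl) (auto intro: polysI c_weighted)

lemma c_in_cJ: "k < n \<Longrightarrow> c k \<in> cJ"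
  by (rule polys.idl_gen) auto

definition normal_form :: "('v point \<Rightarrow> complex) \<Rightarrow> ((nat \<Rightarrow> nat) \<Rightarrow> ('v \<Rightarrow> complex) \<Rightarrow> complex) \<Rightarrow> bool" where
  "normal_form f y \<longleftrightarrow> (\<forall>\<alpha>. y \<alpha> \<in> pf UNIV) \<and>
     (\<lambda>z. f z - (\<Sum>\<alpha>\<in>Box. y \<alpha> (fst z) * mono \<alpha> (snd z))) \<in> cJ"

lemma normal_form_add:
  assumes "normal_form f y" "normal_form g y'"
  shows "normal_form (\<lambda>z. f z + g z) (\<lambda>\<alpha> q. y \<alpha> q + y' \<alpha> q)"
proof -
  have "(\<lambda>z. (f z - (\<Sum>\<alpha>\<in>Box. y \<alpha> (fst z) * mono \<alpha> (snd z))) +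
      (g z - (\<Sum>\<alpha>\<in>Box. y' \<alpha> (fst z) * mono \<alpha> (snd z)))) \<in> cJ"
    using assms by (intro cJ.ideal_add) (auto simp: normal_form_def)
  then have "(\<lambda>z. f z + g z - (\<Sum>\<alpha>\<in>Box. (y \<alpha> (fst z) + y' \<alpha> (fst z)) * mono \<alpha> (snd z))) \<in> cJ"
    by (simp add: algebra_simps sum.distrib)
  then show ?thesis using assms by (auto simp: normal_form_def intro: pf.add)
qed

lemma normal_form_cong:
  assumes "normal_form f y" "(\<lambda>z. g z - f z) \<in> cJ" shows "normal_form g y"
  using assms cJ.ideal_add[of "\<lambda>z. g z - f z" "\<lambda>z. f z - (\<Sum>\<alpha>\<in>Box. y \<alpha> (fst z) * mono \<alpha> (snd z))"]
  by (auto simp: normal_form_def)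

text \<open>A monomial outside the box contains some x_k^(d_k). Replacing this power by x_k^(d_k) -
  c_k keeps the class modulo \<open>cJ\<close> and lowers the weight strictly.\<close>

lemma normal_form_exists: "f \<in> weighted_poly \<omega> \<Longrightarrow> \<exists>y. normal_form f y"
proof (induction \<omega> arbitrary: f rule: less_induct)
  case (less \<omega>)
  show ?case using less.prems
  proof (induction rule: weighted_poly.induct)
    case (monomial y m)
    show ?case
    proof (cases "m \<in> Box")
      case True
      have "(\<lambda>q. if \<alpha> = m then y q else 0) \<in> pf UNIV" for \<alpha>
        using monomial(1) by (cases "\<alpha> = m") (auto intro: pf.const)
      then have "normal_form (\<lambda>z. y (fst z) * mono m (snd z)) (\<lambda>\<alpha> q. if \<alpha> = m then y q else 0)"
        using True finite_Box monomial(1) cJ.ideal_zero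
        by (auto simp: normal_form_def if_distrib[of "\<lambda>t. t * _"] cong: if_cong)
      then show ?thesis by blast
    next
      case False
      then obtain k where k: "k < n" "d k \<le> m k" using monomial(2) by (auto simp: Box_def not_less)
      define m' where "m' = m(k := m k - d k)"
      note r = reduce_exponent[OF monomial(2) k, folded m'_def]
      have m'Fil: "(\<lambda>z. - (y (fst z) * mono m' (snd z))) \<in> weighted_poly (wt m')"
        by (rule weighted_poly_uminus, rule weighted_poly.monomial) (use monomial r in auto)
      have pos: "0 < d k * W k" using W_pos d_pos k by simp
      have "(\<lambda>z. - (y (fst z) * mono m' (snd z)) * (c k z - snd z k ^ d k)) \<in> weighted_poly (wt m' + (d k * W k - 1))"
        by (rule weighted_poly_mult[OF m'Fil leading[OF k(1)]])
      moreover have "wt m' + (d k * W k - 1) < \<omega>" using r(2) monomial(3) pos by linarith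
      ultimately obtain y' where y': "normal_form (\<lambda>z. - (y (fst z) * mono m' (snd z)) * (c k z - snd z k ^ d k)) y'"
        using less.IH by blast
      have "(\<lambda>z. (y (fst z) * mono m' (snd z)) * c k z) \<in> cJ"
        using polysI[OF weighted_poly_uminus[OF m'Fil]] c_in_cJ[OF k(1)] by (intro cJ.ideal_mult) simp_all
      then have "normal_form (\<lambda>z. y (fst z) * mono m (snd z)) y'"
        by (intro normal_form_cong[OF y']) (simp add: r(3) algebra_simps)
      then show ?thesis by blast
    qed
  next
    case (add f g)
    then show ?case using normal_form_add by blast
  qed
qed

text \<open>For fixed parameters \<open>q\<close> the products \<open>x\<^sup>a c\<^sup>b\<close> with \<open>a\<close> in the box are a basis of the polynomials in
  \<open>x\<close>, because their leading forms are the monomials \<open>x\<^sup>m\<close>, \<open>m k = a k + d k b k\<close>.\<close>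

definition basis :: "('v \<Rightarrow> complex) \<Rightarrow> (nat \<Rightarrow> nat) \<Rightarrow> (nat \<Rightarrow> complex) \<Rightarrow> complex" where
  "basis q m x = (\<Prod>k<n. x k ^ (m k mod d k) * c k (q, x) ^ (m k div d k))"

inductive_set basis_span :: "('v \<Rightarrow> complex) \<Rightarrow> (nat \<Rightarrow> nat) set \<Rightarrow> ((nat \<Rightarrow> complex) \<Rightarrow> complex) set"
  for q M where
    zero: "(\<lambda>_. 0) \<in> basis_span q M"
  | step: "m \<in> M \<Longrightarrow> r \<in> basis_span q M \<Longrightarrow> (\<lambda>x. \<kappa> * basis q m x + r x) \<in> basis_span q M"

lemma basis_span_add: "f \<in> basis_span q M \<Longrightarrow> g \<in> basis_span q M \<Longrightarrow> (\<lambda>x. f x + g x) \<in> basis_span q M"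
proof (induction rule: basis_span.induct)
  case (step m r \<kappa>)
  then have "(\<lambda>x. \<kappa> * basis q m x + (r x + g x)) \<in> basis_span q M" by (intro basis_span.step) auto
  then show ?case by (simp add: add.assoc)
qed simp

lemma basis_span_scale: "f \<in> basis_span q M \<Longrightarrow> (\<lambda>x. s * f x) \<in> basis_span q M"
proof (induction rule: basis_span.induct)
  case (step m r \<kappa>)
  then have "(\<lambda>x. (s * \<kappa>) * basis q m x + s * r x) \<in> basis_span q M" by (intro basis_span.step) auto
  then show ?case by (simp add: algebra_simps)
qed (simp add: basis_span.zero)

lemma basis_span_subset: "f \<in> basis_span q M \<Longrightarrow> M \<subseteq> M' \<Longrightarrow> f \<in> basis_span q M'"
  by (induction rule: basis_span.induct) (auto intro: basis_span.intros)

text \<open>Multiplication by c_k adds d_k to the exponent m_k: the remainder modulo d_k stays and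
  the quotient grows by one. The new exponent is never in the box, which is what separates the ideal
  from the normal forms.\<close>

lemma basis_span_mult_c:
  assumes k: "k < n" and f: "f \<in> basis_span q exponents"
  shows "(\<lambda>x. f x * c k (q, x)) \<in> basis_span q (exponents - Box)"
  using f
proof (induction rule: basis_span.induct)
  case zero
  then show ?case by (simp add: basis_span.zero)
next
  case (step m r \<kappa>)
  let ?m = "m(k := m k + d k)"
  have "basis q ?m x = basis q m x * c k (q, x)" for x
  proof -
    have "basis q ?m x = (x k ^ (?m k mod d k) * c k (q, x) ^ (?m k div d k)) *
        (\<Prod>j\<in>{..<n} - {k}. x j ^ (?m j mod d j) * c j (q, x) ^ (?m j div d j))"
      unfolding basis_def using k by (subst prod.remove[of _ k]) auto
    also have "(\<Prod>j\<in>{..<n} - {k}. x j ^ (?m j mod d j) * c j (q, x) ^ (?m j div d j)) =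
        (\<Prod>j\<in>{..<n} - {k}. x j ^ (m j mod d j) * c j (q, x) ^ (m j div d j))"
      by (intro prod.cong) auto
    finally show ?thesis
      unfolding basis_def using k d_pos[OF k] by (subst (2) prod.remove[of _ k]) (auto simp: mult_ac)
  qed
  moreover have "?m \<in> exponents - Box"
    using step.hyps k by (auto simp: exponents_def Box_def)
  ultimately show ?case
    using basis_span.step[OF _ step.IH, of ?m \<kappa>] by (simp add: algebra_simps)
qed

text \<open>The reduction to normal form again, except that the multiples of c_k are kept as basis
  elements instead of being discarded.\<close>

lemma weighted_poly_basis_span: "f \<in> weighted_poly \<omega> \<Longrightarrow> (\<lambda>x. f (q, x)) \<in> basis_span q exponents"
proof (induction \<omega> arbitrary: f rule: less_induct)
  case (less \<omega>)
  show ?case using less.prems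
  proof (induction rule: weighted_poly.induct)
    case (monomial y m)
    show ?case
    proof (cases "m \<in> Box")
      case True
      then have "basis q m x = mono m x" for x
        unfolding basis_def mono_def by (intro prod.cong) (auto simp: Box_def)
      then show ?thesis
        using basis_span.step[OF monomial(2) basis_span.zero, of "y q" q] by simp
    next
      case False
      then obtain k where k: "k < n" "d k \<le> m k" using monomial(2) by (auto simp: Box_def not_less)
      define m' where "m' = m(k := m k - d k)"
      note r = reduce_exponent[OF monomial(2) k, folded m'_def]
      have pos: "0 < d k * W k" using W_pos d_pos k by simp
      have m'Fil: "(\<lambda>z. y (fst z) * mono m' (snd z)) \<in> weighted_poly (wt m')"
        by (rule weighted_poly.monomial) (use monomial r in auto)
      have "(\<lambda>x. y (fst (q, x)) * mono m' (snd (q, x))) \<in> basis_span q exponents"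
        by (rule less.IH[OF _ m'Fil]) (use r(2) monomial(3) pos in linarith)
      then have 1: "(\<lambda>x. (y q * mono m' x) * c k (q, x)) \<in> basis_span q exponents"
        using basis_span_subset[OF basis_span_mult_c[OF k(1)]] by auto
      have "(\<lambda>x. (\<lambda>z. (y (fst z) * mono m' (snd z)) * (c k z - snd z k ^ d k)) (q, x)) \<in> basis_span q exponents"
        by (rule less.IH[OF _ weighted_poly_mult[OF m'Fil leading[OF k(1)]]])
          (use r(2) monomial(3) pos in linarith)
      from basis_span_add[OF 1 basis_span_scale[OF this, of "-1"]] show ?thesis
        by (simp add: r(3) algebra_simps)
    qed
  next
    case (add f g)
    then show ?case by (intro basis_span_add)
  qed
qed

lemma cJ_basis_span:
  assumes "r \<in> cJ" shows "(\<lambda>x. r (q, x)) \<in> basis_span q (exponents - Box)"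
  using assms
proof (induction rule: idl.induct)
  case (step g f r)
  obtain k \<omega> where "f = c k" "k < n" "g \<in> weighted_poly \<omega>" using step.hyps by (auto simp: polys_def)
  then show ?case
    using basis_span_add[OF basis_span_mult_c[OF _ weighted_poly_basis_span[of g \<omega>]] step.IH] by simp
qed (rule basis_span.zero)

lemma basis_span_sum:
  "f \<in> basis_span q M \<Longrightarrow> \<exists>T \<kappa>. finite T \<and> T \<subseteq> M \<and> (\<forall>x. f x = (\<Sum>m\<in>T. \<kappa> m * basis q m x))"
proof (induction rule: basis_span.induct)
  case zero
  show ?case by (rule exI[of _ "{}"]) auto
next
  case (step m r \<kappa>)
  then obtain T \<kappa>' where T: "finite T" "T \<subseteq> M" "\<And>x. r x = (\<Sum>m\<in>T. \<kappa>' m * basis q m x)" by blast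
  define \<kappa>'' where "\<kappa>'' = (\<lambda>m'. (if m' \<in> T then \<kappa>' m' else 0) + (if m' = m then \<kappa> else 0))"
  have "(\<Sum>m'\<in>insert m T. \<kappa>'' m' * basis q m' x) = \<kappa> * basis q m x + r x" for x
  proof -
    have "(\<Sum>m'\<in>insert m T. \<kappa>'' m' * basis q m' x) =
        (\<Sum>m'\<in>insert m T. if m' = m then \<kappa> * basis q m x else 0) +
        (\<Sum>m'\<in>insert m T. if m' \<in> T then \<kappa>' m' * basis q m' x else 0)"
      unfolding sum.distrib[symmetric] by (intro sum.cong) (auto simp: \<kappa>''_def algebra_simps)
    also have "(\<Sum>m'\<in>insert m T. if m' = m then \<kappa> * basis q m x else 0) = \<kappa> * basis q m x"
      using T(1) by simp
    also have "(\<Sum>m'\<in>insert m T. if m' \<in> T then \<kappa>' m' * basis q m' x else 0) = r x"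
      unfolding T(3) using T(1) by (intro sum.mono_neutral_cong_right) auto
    finally show ?thesis .
  qed
  then show ?case using T step.hyps by (intro exI[of _ "insert m T"] exI[of _ \<kappa>'']) auto
qed

text \<open>Functions come without homogeneous components. The part of top weight \<omega> is
  recovered as the limit, for s tending to infinity, of the value at the dilated point divided by
  s^\<omega>.\<close>

definition dilate :: "complex \<Rightarrow> (nat \<Rightarrow> complex) \<Rightarrow> nat \<Rightarrow> complex" where
  "dilate s x k = s ^ W k * x k"

lemma mono_dilate: "mono m (dilate s x) = s ^ wt m * mono m x"
  by (simp add: mono_def wt_def dilate_def power_mult_distrib prod.distrib power_sum power_mult)

lemma inverse_power_tendsto_0: "0 < j \<Longrightarrow> (\<lambda>i. 1 / of_nat (Suc i) ^ j :: complex) \<longlonglongrightarrow> 0"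
proof -
  assume "0 < j"
  have "(\<lambda>i. inverse (of_nat (Suc i)) ^ j :: complex) \<longlonglongrightarrow> 0 ^ j"
    by (intro tendsto_power LIMSEQ_Suc lim_inverse_n)
  moreover have "(0::complex) ^ j = 0" using \<open>0 < j\<close> by simp
  ultimately show ?thesis by (simp only: inverse_eq_divide power_one_over)
qed

lemma weighted_poly_dilate_limit:
  assumes "f \<in> weighted_poly \<omega>" "\<omega> < \<omega>'"
  shows "(\<lambda>i. f (q, dilate (of_nat (Suc i)) x) / of_nat (Suc i) ^ \<omega>') \<longlonglongrightarrow> 0"
  using assms(1)
proof (induction rule: weighted_poly.induct)
  case (monomial y m)
  have eq: "y q * mono m (dilate (of_nat (Suc i)) x) / of_nat (Suc i) ^ \<omega>' =
      y q * mono m x * (1 / of_nat (Suc i) ^ (\<omega>' - wt m))" for i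
    using monomial(3) assms(2) of_nat_neq_0[of i, where ?'a = complex]
    by (simp add: mono_dilate power_diff del: of_nat_Suc)
  have "(\<lambda>i. y q * mono m x * (1 / of_nat (Suc i) ^ (\<omega>' - wt m))) \<longlonglongrightarrow> y q * mono m x * 0"
    using monomial(3) assms(2) by (intro tendsto_mult tendsto_const inverse_power_tendsto_0) simp
  then show ?case unfolding fst_conv snd_conv eq by simp
next
  case (add f g)
  from tendsto_add[OF add.IH] show ?case by (simp add: add_divide_distrib)
qed

lemma basis_dilate_limit:
  "(\<lambda>i. basis q m (dilate (of_nat (Suc i)) x) / of_nat (Suc i) ^ wt m) \<longlonglongrightarrow> mono m x"
proof -
  have c_lim: "(\<lambda>i. c k (q, dilate (of_nat (Suc i)) x) / of_nat (Suc i) ^ (d k * W k)) \<longlonglongrightarrow> x k ^ d k"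
    if k: "k < n" for k
  proof -
    have "(\<lambda>i. (c k (q, dilate (of_nat (Suc i)) x) - dilate (of_nat (Suc i)) x k ^ d k) /
        of_nat (Suc i) ^ (d k * W k)) \<longlonglongrightarrow> 0"
      using weighted_poly_dilate_limit[OF leading[OF k], of "d k * W k" q x] W_pos[OF k] d_pos[OF k] by simp
    then have "(\<lambda>i. (c k (q, dilate (of_nat (Suc i)) x) - dilate (of_nat (Suc i)) x k ^ d k) /
        of_nat (Suc i) ^ (d k * W k) + x k ^ d k) \<longlonglongrightarrow> 0 + x k ^ d k"
      by (intro tendsto_add tendsto_const)
    moreover have "(c k (q, dilate (of_nat (Suc i)) x) - dilate (of_nat (Suc i)) x k ^ d k) /
        of_nat (Suc i) ^ (d k * W k) + x k ^ d k = c k (q, dilate (of_nat (Suc i)) x) / of_nat (Suc i) ^ (d k * W k)" for i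
    proof -
      have nz: "(of_nat (Suc i) :: complex) \<noteq> 0" by (rule of_nat_neq_0)
      have "dilate (of_nat (Suc i)) x k ^ d k = of_nat (Suc i) ^ (d k * W k) * x k ^ d k"
        by (simp only: dilate_def power_mult_distrib power_mult[symmetric] mult.commute[of "W k"])
      then show ?thesis using nz by (simp only: diff_divide_distrib) simp
    qed
    ultimately show ?thesis by simp
  qed
  have "(\<lambda>i. \<Prod>k<n. x k ^ (m k mod d k) *
      (c k (q, dilate (of_nat (Suc i)) x) / of_nat (Suc i) ^ (d k * W k)) ^ (m k div d k))
      \<longlonglongrightarrow> (\<Prod>k<n. x k ^ (m k mod d k) * (x k ^ d k) ^ (m k div d k))"
    by (intro tendsto_prod tendsto_mult tendsto_const tendsto_power c_lim) simp
  moreover have "(\<Prod>k<n. x k ^ (m k mod d k) * (x k ^ d k) ^ (m k div d k)) = mono m x"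
    unfolding mono_def by (intro prod.cong refl) (simp flip: power_mult power_add)
  moreover have "(\<Prod>k<n. x k ^ (m k mod d k) *
      (c k (q, dilate s x) / s ^ (d k * W k)) ^ (m k div d k)) =
      basis q m (dilate s x) / s ^ wt m" if s: "s \<noteq> 0" for s
  proof -
    have "s ^ wt m = (\<Prod>k<n. s ^ (W k * (m k mod d k)) * s ^ (d k * W k * (m k div d k)))"
      unfolding wt_def power_sum
    proof (intro prod.cong refl)
      fix k
      have "W k * m k = W k * (m k mod d k) + d k * W k * (m k div d k)"
        by (subst mod_mult_div_eq[of "m k" "d k", symmetric]) (simp only: distrib_left mult_ac)
      then show "s ^ (W k * m k) = s ^ (W k * (m k mod d k)) * s ^ (d k * W k * (m k div d k))"
        by (simp add: power_add)
    qed
    then have "basis q m (dilate s x) / s ^ wt m =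
        (\<Prod>k<n. ((s ^ W k * x k) ^ (m k mod d k) * c k (q, dilate s x) ^ (m k div d k)) /
          (s ^ (W k * (m k mod d k)) * s ^ (d k * W k * (m k div d k))))"
      by (simp only: basis_def dilate_def prod_dividef)
    moreover have "(s ^ W k * x k) ^ a * C ^ b / (s ^ (W k * a) * s ^ (d k * W k * b)) =
        x k ^ a * (C / s ^ (d k * W k)) ^ b" for k a b C
      using s by (simp add: power_mult_distrib power_divide power_mult)
    ultimately show ?thesis by simp
  qed
  then have "(\<Prod>k<n. x k ^ (m k mod d k) *
      (c k (q, dilate (of_nat (Suc i)) x) / of_nat (Suc i) ^ (d k * W k)) ^ (m k div d k)) =
      basis q m (dilate (of_nat (Suc i)) x) / of_nat (Suc i) ^ wt m" for i
    using of_nat_neq_0 by blast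
  ultimately show ?thesis by simp
qed

text \<open>Dividing a relation by s^\<omega>, with \<omega> the largest weight among its nonzero
  coefficients, and letting s grow leaves a relation between distinct monomials of weight
  \<omega>.\<close>

lemma basis_independent:
  assumes T: "finite T" "T \<subseteq> exponents" and eq: "\<And>x. (\<Sum>m\<in>T. \<kappa> m * basis q m x) = 0" and "m \<in> T"
  shows "\<kappa> m = 0"
proof (rule ccontr)
  assume nz: "\<kappa> m \<noteq> 0"
  define S where "S = {m \<in> T. \<kappa> m \<noteq> 0}"
  define \<omega> where "\<omega> = Max (wt ` S)"
  have S: "finite S" "S \<noteq> {}" using T(1) nz \<open>m \<in> T\<close> by (auto simp: S_def)
  obtain m0 where m0: "m0 \<in> S" "wt m0 = \<omega>"
    using Max_in[of "wt ` S"] S unfolding \<omega>_def by fastforce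
  have le: "wt m \<le> \<omega>" if "m \<in> S" for m
    unfolding \<omega>_def using that S by (intro Max_ge) auto
  have "(\<Sum>m\<in>{m \<in> S. wt m = \<omega>}. \<kappa> m * (\<Prod>k<n. x k ^ m k)) = 0" for x
  proof -
    let ?s = "\<lambda>i. of_nat (Suc i) :: complex"
    have lim: "(\<lambda>i. \<kappa> m * (basis q m (dilate (?s i) x) / ?s i ^ \<omega>)) \<longlonglongrightarrow>
        \<kappa> m * (if wt m = \<omega> then mono m x else 0)" if m: "m \<in> S" for m
    proof (intro tendsto_mult tendsto_const, cases "wt m = \<omega>")
      case True
      then show "(\<lambda>i. basis q m (dilate (?s i) x) / ?s i ^ \<omega>) \<longlonglongrightarrow> (if wt m = \<omega> then mono m x else 0)"
        using basis_dilate_limit[of q m x] by simp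
    next
      case False
      then have less: "wt m < \<omega>" using le[OF m] by simp
      have "(\<lambda>i. (basis q m (dilate (?s i) x) / ?s i ^ wt m) * (1 / ?s i ^ (\<omega> - wt m))) \<longlonglongrightarrow> mono m x * 0"
        using less by (intro tendsto_mult basis_dilate_limit inverse_power_tendsto_0) simp
      moreover have "(basis q m (dilate (?s i) x) / ?s i ^ wt m) * (1 / ?s i ^ (\<omega> - wt m)) =
          basis q m (dilate (?s i) x) / ?s i ^ \<omega>" for i
        using less of_nat_neq_0[of i, where ?'a = complex] by (simp add: power_diff del: of_nat_Suc)
      ultimately have "(\<lambda>i. basis q m (dilate (?s i) x) / ?s i ^ \<omega>) \<longlonglongrightarrow> 0"
        by (simp only: mult_zero_right)
      then show "(\<lambda>i. basis q m (dilate (?s i) x) / ?s i ^ \<omega>) \<longlonglongrightarrow> (if wt m = \<omega> then mono m x else 0)"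
        using False by simp
    qed
    have "(\<lambda>i. \<Sum>m\<in>S. \<kappa> m * (basis q m (dilate (?s i) x) / ?s i ^ \<omega>)) \<longlonglongrightarrow>
        (\<Sum>m\<in>S. \<kappa> m * (if wt m = \<omega> then mono m x else 0))"
      by (intro tendsto_sum lim)
    moreover have "(\<Sum>m\<in>S. \<kappa> m * (basis q m y / s)) = 0" for y s
    proof -
      have "(\<Sum>m\<in>S. \<kappa> m * (basis q m y / s)) = (\<Sum>m\<in>T. \<kappa> m * basis q m y) / s"
        unfolding sum_divide_distrib using T(1) by (intro sum.mono_neutral_cong_left) (auto simp: S_def)
      then show ?thesis using eq by simp
    qed
    ultimately have "(\<Sum>m\<in>S. \<kappa> m * (if wt m = \<omega> then mono m x else 0)) = 0"
      by (simp add: LIMSEQ_const_iff)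
    moreover have "(\<Sum>m\<in>S. \<kappa> m * (if wt m = \<omega> then mono m x else 0)) =
        (\<Sum>m\<in>{m \<in> S. wt m = \<omega>}. \<kappa> m * mono m x)"
      using S(1) by (intro sum.mono_neutral_cong_right) auto
    ultimately show ?thesis by (simp add: mono_def)
  qed
  then have "\<kappa> m0 = 0"
    by (rule monomials_independent[rotated 3])
      (use S T m0 in \<open>auto simp: S_def exponents_def\<close>)
  then show False using m0(1) by (simp add: S_def)
qed

text \<open>In the fibre over \<open>q\<close> a normal form uses only basis elements with exponents
  in the box, an element of the ideal only those outside it; independence makes both zero.\<close>

lemma normal_form_unique:
  assumes r: "r \<in> cJ" and eq: "\<And>x. (\<Sum>\<alpha>\<in>Box. y \<alpha> * mono \<alpha> x) = r (q, x)" and "\<alpha> \<in> Box"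
  shows "y \<alpha> = 0"
proof -
  obtain T \<kappa> where T: "finite T" "T \<subseteq> exponents - Box" "\<And>x. r (q, x) = (\<Sum>m\<in>T. \<kappa> m * basis q m x)"
    using basis_span_sum[OF cJ_basis_span[OF r]] by metis
  define \<kappa>' where "\<kappa>' = (\<lambda>m. if m \<in> Box then y m else - \<kappa> m)"
  have dis: "Box \<inter> T = {}" using T(2) by auto
  have "(\<Sum>m\<in>Box \<union> T. \<kappa>' m * basis q m x) = 0" for x
  proof -
    have "(\<Sum>m\<in>Box \<union> T. \<kappa>' m * basis q m x) =
        (\<Sum>m\<in>Box. \<kappa>' m * basis q m x) + (\<Sum>m\<in>T. \<kappa>' m * basis q m x)"
      by (rule sum.union_disjoint[OF finite_Box T(1) dis])
    also have "(\<Sum>m\<in>Box. \<kappa>' m * basis q m x) = (\<Sum>m\<in>Box. y m * mono m x)"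
    proof (intro sum.cong refl)
      fix m assume m: "m \<in> Box"
      then have "basis q m x = mono m x"
        unfolding basis_def mono_def by (intro prod.cong) (auto simp: Box_def)
      then show "\<kappa>' m * basis q m x = y m * mono m x" using m by (simp add: \<kappa>'_def)
    qed
    also have "(\<Sum>m\<in>T. \<kappa>' m * basis q m x) = - (\<Sum>m\<in>T. \<kappa> m * basis q m x)"
      unfolding sum_negf[symmetric] using T(2) by (intro sum.cong) (auto simp: \<kappa>'_def)
    finally show ?thesis using eq[of x] T(3)[of x] by simp
  qed
  then have "\<kappa>' \<alpha> = 0"
    by (rule basis_independent[rotated 2]) (use T finite_Box \<open>\<alpha> \<in> Box\<close> in \<open>auto simp: Box_def\<close>)
  then show ?thesis using \<open>\<alpha> \<in> Box\<close> by (simp add: \<kappa>'_def)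
qed

text \<open>The quotient by \<open>cJ\<close> is free over the parameters with basis the monomials of the box. Since \<open>\<Gamma>\<close> acts as
  the identity at \<open>q0\<close>, the coordinates of an element killed by \<open>\<Gamma>\<close> are, on each line through \<open>q0\<close>,
  divisible by all powers of the line parameter.\<close>

theorem nonzerodivisor:
  assumes \<Gamma>: "\<Gamma> \<in> polys" and f: "f \<in> polys" and \<Gamma>f: "(\<lambda>z. \<Gamma> z * f z) \<in> cJ"
    and r0: "r0 \<in> cJ" "\<And>x. \<Gamma> (q0, x) - 1 = r0 (q0, x)"
  shows "f \<in> cJ"
proof -
  obtain y where y: "normal_form f y" using normal_form_exists f by (auto simp: polys_def)
  have monoP: "(\<lambda>z. mono \<alpha> (snd z)) \<in> polys" if "\<alpha> \<in> Box" for \<alpha>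
    using that by (intro polysI[OF weighted_poly_mono_fun]) (auto simp: Box_def)
  have "\<forall>\<alpha>. \<exists>\<theta>. \<alpha> \<in> Box \<longrightarrow> normal_form (\<lambda>z. \<Gamma> z * mono \<alpha> (snd z)) \<theta>"
    using normal_form_exists polys.mult[OF \<Gamma> monoP] unfolding polys_def by blast
  then obtain \<theta> where \<theta>: "\<And>\<alpha>. \<alpha> \<in> Box \<Longrightarrow> normal_form (\<lambda>z. \<Gamma> z * mono \<alpha> (snd z)) (\<theta> \<alpha>)"
    by metis
  have yP: "(\<lambda>z. y \<alpha> (fst z)) \<in> polys" for \<alpha>
    using y by (intro polysI[of _ 0] weighted_poly_param) (simp add: normal_form_def)
  \<comment> \<open>\<open>\<theta>\<close> is the matrix of multiplication by
    \<open>\<Gamma>\<close> in the box basis. The product of \<open>\<Gamma>\<close> and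
    \<open>f\<close> lies in the ideal, so the coordinate vector \<open>y\<close> is annihilated by
    \<open>\<theta>\<close>.\<close>
  have rel: "(\<Sum>\<alpha>\<in>Box. y \<alpha> q * \<theta> \<alpha> \<beta> q) = 0" if "\<beta> \<in> Box" for q \<beta>
  proof -
    let ?N = "\<lambda>z. \<Sum>\<alpha>\<in>Box. y \<alpha> (fst z) * mono \<alpha> (snd z)"
    have 1: "(\<lambda>z. \<Gamma> z * f z - \<Gamma> z * (f z - ?N z)) \<in> cJ"
      using y by (intro cJ.ideal_diff[OF \<Gamma>f] cJ.ideal_mult[OF \<Gamma>]) (simp add: normal_form_def)
    have "(\<lambda>z. \<Sum>\<alpha>\<in>Box. y \<alpha> (fst z) * (\<Gamma> z * mono \<alpha> (snd z) -
        (\<Sum>\<beta>\<in>Box. \<theta> \<alpha> \<beta> (fst z) * mono \<beta> (snd z)))) \<in> cJ"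
      using \<theta> by (intro cJ.ideal_sum cJ.ideal_mult[OF yP]) (simp add: normal_form_def)
    note r = cJ.ideal_diff[OF 1 this]
    show ?thesis
    proof (rule normal_form_unique[OF r, where q = q and y = "\<lambda>\<beta>. \<Sum>\<alpha>\<in>Box. y \<alpha> q * \<theta> \<alpha> \<beta> q", OF _ that])
      fix x
      have "(\<Sum>\<beta>\<in>Box. (\<Sum>\<alpha>\<in>Box. y \<alpha> q * \<theta> \<alpha> \<beta> q) * mono \<beta> x) =
          (\<Sum>\<alpha>\<in>Box. y \<alpha> q * (\<Sum>\<beta>\<in>Box. \<theta> \<alpha> \<beta> q * mono \<beta> x))"
        unfolding sum_distrib_left sum_distrib_right by (subst sum.swap) (simp add: mult_ac)
      then show "(\<Sum>\<beta>\<in>Box. (\<Sum>\<alpha>\<in>Box. y \<alpha> q * \<theta> \<alpha> \<beta> q) * mono \<beta> x) =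
          \<Gamma> (q, x) * f (q, x) - \<Gamma> (q, x) * (f (q, x) - ?N (q, x)) -
          (\<Sum>\<alpha>\<in>Box. y \<alpha> (fst (q, x)) * (\<Gamma> (q, x) * mono \<alpha> (snd (q, x)) -
            (\<Sum>\<beta>\<in>Box. \<theta> \<alpha> \<beta> (fst (q, x)) * mono \<beta> (snd (q, x)))))"
        by (simp add: right_diff_distrib sum_subtractf sum_distrib_left mult_ac)
    qed
  qed
  have \<theta>0: "\<theta> \<alpha> \<beta> q0 = (if \<alpha> = \<beta> then 1 else 0)" if ab: "\<alpha> \<in> Box" "\<beta> \<in> Box" for \<alpha> \<beta>
  proof -
    have "(\<lambda>z. mono \<alpha> (snd z) * r0 z) \<in> cJ" by (rule cJ.ideal_mult[OF monoP[OF ab(1)] r0(1)])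
    moreover have "(\<lambda>z. \<Gamma> z * mono \<alpha> (snd z) - (\<Sum>\<beta>\<in>Box. \<theta> \<alpha> \<beta> (fst z) * mono \<beta> (snd z))) \<in> cJ"
      using \<theta>[OF ab(1)] by (simp add: normal_form_def)
    ultimately have r: "(\<lambda>z. mono \<alpha> (snd z) * r0 z - (\<Gamma> z * mono \<alpha> (snd z) -
        (\<Sum>\<beta>\<in>Box. \<theta> \<alpha> \<beta> (fst z) * mono \<beta> (snd z)))) \<in> cJ" by (rule cJ.ideal_diff)
    have "\<theta> \<alpha> \<beta> q0 - (if \<alpha> = \<beta> then 1 else 0) = 0"
    proof (rule normal_form_unique[OF r, where q = q0 and y = "\<lambda>\<beta>. \<theta> \<alpha> \<beta> q0 - (if \<alpha> = \<beta> then 1 else 0)", OF _ ab(2)])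
      fix x
      have "(\<Sum>\<beta>\<in>Box. (\<theta> \<alpha> \<beta> q0 - (if \<alpha> = \<beta> then 1 else 0)) * mono \<beta> x) =
          (\<Sum>\<beta>\<in>Box. \<theta> \<alpha> \<beta> q0 * mono \<beta> x) - (\<Sum>\<beta>\<in>Box. if \<alpha> = \<beta> then mono \<beta> x else 0)"
        unfolding sum_subtractf[symmetric] by (intro sum.cong) (auto simp: algebra_simps)
      also have "(\<Sum>\<beta>\<in>Box. if \<alpha> = \<beta> then mono \<beta> x else 0) = mono \<alpha> x"
        using ab(1) finite_Box by simp
      finally show "(\<Sum>\<beta>\<in>Box. (\<theta> \<alpha> \<beta> q0 - (if \<alpha> = \<beta> then 1 else 0)) * mono \<beta> x) =
          mono \<alpha> (snd (q0, x)) * r0 (q0, x) - (\<Gamma> (q0, x) * mono \<alpha> (snd (q0, x)) -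
          (\<Sum>\<beta>\<in>Box. \<theta> \<alpha> \<beta> (fst (q0, x)) * mono \<beta> (snd (q0, x))))"
        by (simp add: r0(2)[symmetric] algebra_simps)
    qed
    then show ?thesis by simp
  qed
  have "y \<beta> q1 = 0" if \<beta>: "\<beta> \<in> Box" for \<beta> q1
  proof -
    define line where "line = (\<lambda>t v. q0 v + t * (q1 v - q0 v))"
    have "\<forall>\<alpha>. \<exists>P. \<forall>t. y \<alpha> (line t) = poly P t"
      using y pf_line_poly unfolding normal_form_def line_def by blast
    then obtain Y where Y: "\<And>\<alpha> t. y \<alpha> (line t) = poly (Y \<alpha>) t" by metis
    have "\<forall>\<alpha> \<beta>. \<exists>P. \<forall>t. \<alpha> \<in> Box \<longrightarrow> \<theta> \<alpha> \<beta> (line t) = poly P t"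
      using \<theta> pf_line_poly unfolding normal_form_def line_def by blast
    then obtain Th where Th: "\<And>\<alpha> \<beta> t. \<alpha> \<in> Box \<Longrightarrow> \<theta> \<alpha> \<beta> (line t) = poly (Th \<alpha> \<beta>) t" by metis
    have line0: "line 0 = q0" and line1: "line 1 = q1" by (auto simp: line_def)
    have Yrel: "(\<Sum>\<alpha>\<in>Box. Y \<alpha> * Th \<alpha> \<beta>) = 0" if "\<beta> \<in> Box" for \<beta>
    proof -
      have "poly (\<Sum>\<alpha>\<in>Box. Y \<alpha> * Th \<alpha> \<beta>) t = 0" for t
        using rel[OF that, of "line t"] by (simp add: poly_sum Y Th)
      then show ?thesis by (intro poly_all_0_iff_0[THEN iffD1] allI)
    qed
    have X: "[:0, 1:] dvd Th \<alpha> \<beta> - (if \<alpha> = \<beta> then 1 else 0)" if "\<alpha> \<in> Box" "\<beta> \<in> Box" for \<alpha> \<beta>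
      using \<theta>0[OF that] Th[OF that(1), of \<beta> 0] line0
      by (auto simp: dvd_iff_poly_eq_0 poly_eq_0_iff_dvd[of _ 0, simplified, symmetric])
    \<comment> \<open>From Y Th = 0 and Th congruent to the identity modulo t follows Y = - Y (Th -
      1), so a power of t dividing all of Y can be raised by one.\<close>
    have div: "[:0, 1:] ^ k dvd Y \<beta>" if "\<beta> \<in> Box" for k \<beta>
      using that
    proof (induction k arbitrary: \<beta>)
      case (Suc k)
      have "Y \<beta> = (\<Sum>\<alpha>\<in>Box. Y \<alpha> * (if \<alpha> = \<beta> then 1 else 0))"
        using Suc.prems finite_Box by (simp add: if_distrib[of "(*) _"] cong: if_cong)
      also have "\<dots> = (\<Sum>\<alpha>\<in>Box. Y \<alpha> * Th \<alpha> \<beta>) - (\<Sum>\<alpha>\<in>Box. Y \<alpha> * (Th \<alpha> \<beta> - (if \<alpha> = \<beta> then 1 else 0)))"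
        by (simp only: sum_subtractf[symmetric] right_diff_distrib) simp
      also have "\<dots> = - (\<Sum>\<alpha>\<in>Box. Y \<alpha> * (Th \<alpha> \<beta> - (if \<alpha> = \<beta> then 1 else 0)))"
        using Yrel[OF Suc.prems] by simp
      also have "[:0, 1:] ^ Suc k dvd \<dots>"
        unfolding power_Suc2 dvd_minus_iff
        by (intro dvd_sum mult_dvd_mono Suc.IH X Suc.prems)
      finally show ?case .
    qed simp
    have "Y \<beta> = 0"
    proof (rule ccontr)
      assume "Y \<beta> \<noteq> 0"
      then have "degree ([:0, 1:] ^ Suc (degree (Y \<beta>)) :: complex poly) \<le> degree (Y \<beta>)"
        using div[OF \<beta>] by (intro dvd_imp_degree_le)
      then show False by (simp add: degree_power_eq)
    qed
    then show ?thesis using Y[of \<beta> 1] line1 by simp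
  qed
  then have "(\<Sum>\<alpha>\<in>Box. y \<alpha> (fst z) * mono \<alpha> (snd z)) = 0" for z :: "'v point"
    by (intro sum.neutral) auto
  then show ?thesis using y by (simp add: normal_form_def)
qed

end

section \<open>The chart at the identity\<close>

definition supdiag :: "nat \<Rightarrow> complex mat" where
  "supdiag n = Matrix.mat n n (\<lambda>(i, j). if j = Suc i then 1 else 0)"

definition reversal :: "nat \<Rightarrow> complex mat" where
  "reversal n = Matrix.mat n n (\<lambda>(i, j). if i + j = n - 1 then 1 else 0)"

lemma supdiag_carrier [simp]: "supdiag n \<in> carrier_mat n n"
  by (simp add: supdiag_def)

lemma reversal_carrier [simp]: "reversal n \<in> carrier_mat n n"
  by (simp add: reversal_def)

lemma reversal_mult:
  assumes "X \<in> carrier_mat n n" "i < n" "j < n"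
  shows "(reversal n * X) $$ (i, j) = X $$ (n - 1 - i, j)"
proof -
  have "(reversal n * X) $$ (i, j) = (\<Sum>k<n. reversal n $$ (i, k) * X $$ (k, j))"
    by (intro mat_mult_index[of _ n n _ n]) (use assms in auto)
  also have "\<dots> = (\<Sum>k<n. if k = n - 1 - i then X $$ (n - 1 - i, j) else 0)"
    using assms by (intro sum.cong) (auto simp: reversal_def)
  finally show ?thesis using assms by simp
qed

lemma mult_reversal:
  assumes "X \<in> carrier_mat n n" "i < n" "j < n"
  shows "(X * reversal n) $$ (i, j) = X $$ (i, n - 1 - j)"
proof -
  have "(X * reversal n) $$ (i, j) = (\<Sum>k<n. X $$ (i, k) * reversal n $$ (k, j))"
    by (intro mat_mult_index[of _ n n _ n]) (use assms in auto)
  also have "\<dots> = (\<Sum>k<n. if k = n - 1 - j then X $$ (i, n - 1 - j) else 0)"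
    using assms by (intro sum.cong) (auto simp: reversal_def)
  finally show ?thesis using assms by simp
qed

lemma reversal_reversal: "reversal n * reversal n = 1\<^sub>m n"
proof (rule eq_matI)
  fix i j assume "i < dim_row (1\<^sub>m n)" "j < dim_col (1\<^sub>m n)"
  then show "(reversal n * reversal n) $$ (i, j) = 1\<^sub>m n $$ (i, j)"
    by (subst reversal_mult) (auto simp: reversal_def)
qed (auto simp: reversal_def)

lemma reversal_supdiag: "reversal n * supdiag n * reversal n = subdiag n"
proof (rule eq_matI)
  fix i j assume "i < dim_row (subdiag n)" "j < dim_col (subdiag n)"
  then have ij: "i < n" "j < n" by (auto simp: subdiag_def)
  have "(reversal n * supdiag n * reversal n) $$ (i, j) = supdiag n $$ (n - 1 - i, n - 1 - j)"
    using ij by (subst mult_reversal[of _ n]) (auto simp: reversal_mult mult_carrier_mat[of _ n n])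
  then show "(reversal n * supdiag n * reversal n) $$ (i, j) = subdiag n $$ (i, j)"
    using ij by (auto simp: subdiag_def supdiag_def)
qed (auto simp: reversal_def subdiag_def)

text \<open>The rows \<open>e\<^sub>0\<^sup>T H\<^sup>m\<close> and the columns \<open>H\<^sup>m e\<^sub>0\<close>.\<close>

primrec krow :: "nat \<Rightarrow> (nat \<Rightarrow> nat \<Rightarrow> complex) \<Rightarrow> nat \<Rightarrow> nat \<Rightarrow> complex" where
  "krow n H 0 k = (if k = 0 then 1 else 0)"
| "krow n H (Suc m) k = (\<Sum>i<n. krow n H m i * H i k)"

primrec kcol :: "nat \<Rightarrow> (nat \<Rightarrow> nat \<Rightarrow> complex) \<Rightarrow> nat \<Rightarrow> nat \<Rightarrow> complex" where
  "kcol n H 0 k = (if k = 0 then 1 else 0)"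
| "kcol n H (Suc m) k = (\<Sum>i<n. H k i * kcol n H m i)"

text \<open>Both sides are e_0^T H^i H^j e_0. The value depends only on i + j, so products of these
  rows and columns form a Hankel matrix.\<close>

lemma krow_kcol:
  assumes "0 < n" shows "(\<Sum>l<n. krow n H i l * kcol n H j l) = krow n H (i + j) 0"
proof (induction j arbitrary: i)
  case 0
  show ?case using assms by (simp add: if_distrib[of "(*) _"] cong: if_cong)
next
  case (Suc j)
  have "(\<Sum>l<n. krow n H i l * kcol n H (Suc j) l) = (\<Sum>m<n. krow n H (Suc i) m * kcol n H j m)"
    unfolding krow.simps kcol.simps sum_distrib_left sum_distrib_right
    by (subst sum.swap) (simp add: mult_ac)
  then show ?case using Suc.IH[of "Suc i"] by simp
qed

lemma (in fun_alg) krow_alg: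
  assumes "\<And>i k. i < n \<Longrightarrow> k < n \<Longrightarrow> (\<lambda>z. H z i k) \<in> A" and "k < n"
  shows "(\<lambda>z. krow n (H z) m k) \<in> A"
  using assms(2)
proof (induction m arbitrary: k)
  case (Suc m)
  then show ?case unfolding krow.simps by (intro sum mult assms(1)) auto
qed (auto intro: const)

lemma (in fun_alg) kcol_alg:
  assumes "\<And>i k. i < n \<Longrightarrow> k < n \<Longrightarrow> (\<lambda>z. H z i k) \<in> A" and "k < n"
  shows "(\<lambda>z. kcol n (H z) m k) \<in> A"
  using assms(2)
proof (induction m arbitrary: k)
  case (Suc m)
  then show ?case unfolding kcol.simps by (intro sum mult assms(1)) auto
qed (auto intro: const)

lemma (in fun_ideal) krow_cong:
  assumes "\<And>i k. i < n \<Longrightarrow> k < n \<Longrightarrow> (\<lambda>z. H z i k) \<in> A" "\<And>i k. i < n \<Longrightarrow> k < n \<Longrightarrow> (\<lambda>z. H' z i k) \<in> A"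
    and "\<And>i k. i < n \<Longrightarrow> k < n \<Longrightarrow> (\<lambda>z. H z i k - H' z i k) \<in> I" and "k < n"
  shows "(\<lambda>z. krow n (H z) m k - krow n (H' z) m k) \<in> I"
  using assms(4)
proof (induction m arbitrary: k)
  case (Suc m)
  have "(\<lambda>z. krow n (H z) m i * H z i k - krow n (H' z) m i * H' z i k) \<in> I" if "i < n" for i
    by (rule cong_mult[OF Suc.IH[OF that] assms(3)[OF that Suc.prems] assms(1)[OF that Suc.prems]
        krow_alg[of n "H'", OF assms(2) that]])
  then show ?case unfolding krow.simps by (intro cong_sum) auto
qed (simp add: ideal_zero)

lemma uconj_supdiag_eq: "umat n a * uconj n (supdiag n) a = supdiag n * umat n a"
proof -
  have "umat n a * uconj n (supdiag n) a = (umat n a * adj_mat (umat n a)) * (supdiag n * umat n a)"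
    unfolding uconj_def using mult_carrier_mat[of "supdiag n" n n "umat n a" n]
    by (simp add: assoc_mult_mat[of _ n n _ n _ n] mult_carrier_mat[of _ n n _ n] del: adj_umat_mult)
  then show ?thesis
    using mult_carrier_mat[of "supdiag n" n n "umat n a" n] left_mult_one_mat[of "supdiag n * umat n a" n n]
    by simp
qed

lemma supdiag_mult_entry:
  assumes "i < n" "k < n"
  shows "(supdiag n * umat n a) $$ (i, k) = (if Suc i < n then umat n a $$ (Suc i, k) else 0)"
proof -
  have "(supdiag n * umat n a) $$ (i, k) = (\<Sum>l<n. supdiag n $$ (i, l) * umat n a $$ (l, k))"
    by (intro mat_mult_index[of _ n n _ n]) (use assms in auto)
  also have "\<dots> = (\<Sum>l<n. if l = Suc i then umat n a $$ (Suc i, k) else 0)"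
    using assms by (intro sum.cong) (auto simp: supdiag_def)
  finally show ?thesis by simp
qed

lemma umat_uconj_supdiag:
  assumes "i < n" "k < n"
  shows "(\<Sum>l<n. umat n a $$ (i, l) * uconj n (supdiag n) a $$ (l, k)) =
    (if Suc i < n then umat n a $$ (Suc i, k) else 0)"
proof -
  have "(umat n a * uconj n (supdiag n) a) $$ (i, k) =
      (\<Sum>l<n. umat n a $$ (i, l) * uconj n (supdiag n) a $$ (l, k))"
    by (intro mat_mult_index[of _ n n _ n]) (use assms in auto)
  then show ?thesis unfolding uconj_supdiag_eq supdiag_mult_entry[OF assms] by simp
qed

lemma uconj_supdiag_upper:
  assumes "i < k" "k < n"
  shows "uconj n (supdiag n) a $$ (i, k) = (if k = Suc i then 1 else 0)"
  using assms(1)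
proof (induction i rule: less_induct)
  case (less i)
  have "(\<Sum>l<n. umat n a $$ (i, l) * uconj n (supdiag n) a $$ (l, k)) =
      (\<Sum>l<n. if l = i then uconj n (supdiag n) a $$ (i, k) else 0)"
  proof (intro sum.cong refl)
    fix l assume "l \<in> {..<n}"
    then show "umat n a $$ (i, l) * uconj n (supdiag n) a $$ (l, k) =
        (if l = i then uconj n (supdiag n) a $$ (i, k) else 0)"
      using less assms(2) by (cases l i rule: linorder_cases) (auto simp: umat_def)
  qed
  then show ?case
    using umat_uconj_supdiag[of i n k a] less.prems assms(2) by (auto simp: umat_def)
qed

text \<open>Since M H = N M, multiplication by H takes row m of M to row m + 1, and the first row of
  M is e_0^T because M is unitriangular. The last row of N is zero, which gives e_0^T H^n =
  0.\<close>

lemma krow_uconj_supdiag: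
  assumes "k < n"
  shows "m < n \<Longrightarrow> krow n (\<lambda>i k. uconj n (supdiag n) a $$ (i, k)) m k = umat n a $$ (m, k)"
    and "krow n (\<lambda>i k. uconj n (supdiag n) a $$ (i, k)) n k = 0"
proof -
  have *: "krow n (\<lambda>i k. uconj n (supdiag n) a $$ (i, k)) m k = umat n a $$ (m, k)" if "m < n" "k < n" for m k
    using that
  proof (induction m arbitrary: k)
    case 0
    then show ?case by (auto simp: umat_def)
  next
    case (Suc m)
    then show ?case using umat_uconj_supdiag[of m n k a] by simp
  qed
  then show "m < n \<Longrightarrow> krow n (\<lambda>i k. uconj n (supdiag n) a $$ (i, k)) m k = umat n a $$ (m, k)"
    using assms by blast
  obtain m where m: "n = Suc m" using assms by (cases n) auto
  have "krow n (\<lambda>i k. uconj n (supdiag n) a $$ (i, k)) (Suc m) k =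
      (\<Sum>l<n. umat n a $$ (m, l) * uconj n (supdiag n) a $$ (l, k))"
    unfolding krow.simps(2) using * m by (intro sum.cong) auto
  then show "krow n (\<lambda>i k. uconj n (supdiag n) a $$ (i, k)) n k = 0"
    using umat_uconj_supdiag[of m n k a] m assms by simp
qed

section \<open>Hessenberg matrices as points of a weighted affine space\<close>

context hessenberg_fun
begin

text \<open>The Hessenberg equations are built in as zeros, so the only condition left is e_0^T H^n
  = 0. Diagonal entries serve as variables and the other free entries as parameters, because the
  leading forms of that condition are powers of diagonal entries.\<close>

definition ent :: "(nat \<times> nat) point \<Rightarrow> nat \<Rightarrow> nat \<Rightarrow> complex" where
  "ent z i j = (if j = Suc i then 1 else if i = j then snd z i
     else if j < i \<and> i \<le> h j then fst z (i, j) else 0)"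

lemma ent_simps [simp]:
  "ent z i (Suc i) = 1" "ent z i i = snd z i" "Suc i < j \<Longrightarrow> ent z i j = 0"
  by (auto simp: ent_def)

definition deg :: "nat \<Rightarrow> nat" where
  "deg k = n - k"

text \<open>Entry k of e_0^T H^m is a sum over walks of length m from level 0 to level k; a step
  rises by one level, stays at level i with factor x_i, or drops with a parameter as factor. A walk
  without drops stays m - k times, at levels up to k, and growth of the weight with the level
  favours staying always at k. A walk with a drop loses at least one stay; the constant n * n makes
  this loss outweigh all that higher levels can contribute.\<close>

definition wgt :: "nat \<Rightarrow> nat" where
  "wgt k = n * n + k + 1"

sublocale leading_powers n deg wgt
  by unfold_locales (auto simp: deg_def wgt_def)

lemma ent_weighted: "j < i \<Longrightarrow> (\<lambda>z. ent z i j) \<in> weighted_poly 0"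
  using weighted_poly_param[OF pf.var[of "(i, j)"], of 0] weighted_poly_param[OF pf.const[of 0], of 0]
  by (cases "i \<le> h j") (simp_all add: ent_def)

lemma ent_polys: "i < n \<Longrightarrow> k < n \<Longrightarrow> (\<lambda>z. ent z i k) \<in> polys"
proof -
  assume ik: "i < n" "k < n"
  consider "i < k" | "i = k" | "k < i" by linarith
  then show ?thesis
  proof cases
    case 1
    then show ?thesis using polys.const by (cases "k = Suc i") (simp_all add: ent_def)
  next
    case 2
    then show ?thesis using polysI[OF weighted_poly_var[OF ik(1)]] by simp
  next
    case 3
    then show ?thesis by (rule polysI[OF ent_weighted])
  qed
qed

lemma krow_ent_above: "m < k \<Longrightarrow> krow n (ent z) m k = 0"
proof (induction m arbitrary: k)
  case (Suc m)
  have "krow n (ent z) m i * ent z i k = 0" for i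
    using Suc.IH[of i] Suc.prems by (cases "m < i") auto
  then show ?case unfolding krow.simps by (simp only: sum.neutral_const)
qed simp

lemma krow_ent_diag: "m < n \<Longrightarrow> krow n (ent z) m m = 1"
proof (induction m)
  case (Suc m)
  have "krow n (ent z) m i * ent z i (Suc m) = (if i = m then 1 else 0)" for i
    using Suc krow_ent_above[of m i z] by (cases i m rule: linorder_cases) auto
  then show ?case unfolding krow.simps using Suc.prems by simp
qed simp

text \<open>The last step of the walk is a rise from k - 1, which has smaller weight because
  \<open>wgt\<close> increases, a stay at k, which continues the leading power, or a drop from some
  i > k, where the constant in \<open>wgt\<close> decides.\<close>

lemma krow_ent_leading:
  assumes "k < n" "k < m" "m \<le> n"
  shows "(\<lambda>z. krow n (ent z) m k - snd z k ^ (m - k)) \<in> weighted_poly ((m - k) * wgt k - 1)"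
  using assms
proof (induction m arbitrary: k)
  case (Suc m)
  let ?\<omega> = "(Suc m - k) * wgt k - 1"
  have km: "k \<le> m" "m < n" using Suc.prems by auto
  have wp: "(\<lambda>z. krow n (ent z) m i) \<in> weighted_poly ((m - i) * wgt i)" if i: "i < n" for i
  proof (cases i m rule: linorder_cases)
    case less
    let ?e = "(\<lambda>_. 0)(i := m - i)"
    have e: "mono ?e x = x i ^ (m - i)" "wt ?e = (m - i) * wgt i" for x
      using i unfolding mono_def wt_def
      by (subst prod.remove[of _ i] sum.remove[of _ i]; auto intro!: prod.neutral sum.neutral)+
    have "(\<lambda>z. (krow n (ent z) m i - snd z i ^ (m - i)) + mono ?e (snd z)) \<in> weighted_poly ((m - i) * wgt i)"
    proof (rule weighted_poly.add)
      show "(\<lambda>z. krow n (ent z) m i - snd z i ^ (m - i)) \<in> weighted_poly ((m - i) * wgt i)"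
        by (rule weighted_poly_mono[OF Suc.IH]) (use i less km in auto)
      show "(\<lambda>z. mono ?e (snd z)) \<in> weighted_poly ((m - i) * wgt i)"
        using weighted_poly_mono_fun[of ?e] i e by (simp add: exponents_def)
    qed
    then show ?thesis by (simp add: e)
  next
    case equal
    then show ?thesis using krow_ent_diag[OF i] weighted_poly_param[OF pf.const[of 1]] by simp
  next
    case greater
    then show ?thesis using krow_ent_above[OF greater] weighted_poly_param[OF pf.const[of 0]] by simp
  qed
  have split: "{..<n} = {..<k} \<union> ({k} \<union> {Suc k..<n})" using Suc.prems by auto
  have sum_split: "krow n (ent z) (Suc m) k =
      (if k = 0 then 0 else krow n (ent z) m (k - 1)) + (krow n (ent z) m k * snd z k +
      (\<Sum>i\<in>{Suc k..<n}. krow n (ent z) m i * ent z i k))" for z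
  proof -
    have "krow n (ent z) (Suc m) k = (\<Sum>i<k. krow n (ent z) m i * ent z i k) +
        (krow n (ent z) m k * ent z k k + (\<Sum>i\<in>{Suc k..<n}. krow n (ent z) m i * ent z i k))"
      unfolding krow.simps split by (subst sum.union_disjoint; (subst sum.union_disjoint)?) auto
    also have "(\<Sum>i<k. krow n (ent z) m i * ent z i k) =
        (\<Sum>i<k. if k \<noteq> 0 \<and> i = k - 1 then krow n (ent z) m (k - 1) else 0)"
    proof (intro sum.cong refl)
      fix i assume "i \<in> {..<k}"
      then show "krow n (ent z) m i * ent z i k = (if k \<noteq> 0 \<and> i = k - 1 then krow n (ent z) m (k - 1) else 0)"
        using ent_simps(3)[of i k z] by (cases "k = Suc i") auto
    qed
    finally show ?thesis by (cases "k = 0") auto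
  qed
  have 1: "(\<lambda>z. if k = 0 then 0 else krow n (ent z) m (k - 1)) \<in> weighted_poly ?\<omega>"
  proof (cases "k = 0")
    case False
    have "(m - (k - 1)) * wgt (k - 1) + 1 \<le> (Suc m - k) * wgt k"
    proof -
      have "(Suc m - k) * wgt k = (Suc m - k) * wgt (k - 1) + (Suc m - k)"
        using False by (simp add: wgt_def algebra_simps)
      moreover have "m - (k - 1) = Suc m - k" using False by simp
      moreover have "1 \<le> Suc m - k" using km by simp
      ultimately show ?thesis by (metis add_left_mono)
    qed
    then show ?thesis using False weighted_poly_mono[OF wp[of "k - 1"], of ?\<omega>] Suc.prems by simp
  qed (simp add: weighted_poly_param[OF pf.const])
  have 2: "(\<lambda>z. krow n (ent z) m k * snd z k - snd z k ^ (Suc m - k)) \<in> weighted_poly ?\<omega>"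
  proof (cases "k = m")
    case True
    then show ?thesis using krow_ent_diag[OF Suc.prems(1)] weighted_poly_param[OF pf.const[of 0]] by simp
  next
    case False
    then have lt: "k < m" using km by simp
    have "(\<lambda>z. (krow n (ent z) m k - snd z k ^ (m - k)) * snd z k) \<in>
        weighted_poly ((m - k) * wgt k - 1 + wgt k)"
      using Suc.IH[of k] Suc.prems lt by (intro weighted_poly_mult weighted_poly_var) auto
    moreover have "(m - k) * wgt k - 1 + wgt k = ?\<omega>"
    proof -
      have "(Suc m - k) * wgt k = (m - k) * wgt k + wgt k" using lt by (simp add: Suc_diff_le)
      moreover have "0 < (m - k) * wgt k" using lt by (simp add: wgt_def)
      ultimately show ?thesis by linarith
    qed
    moreover have "(krow n (ent z) m k - snd z k ^ (m - k)) * snd z k =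
        krow n (ent z) m k * snd z k - snd z k ^ (Suc m - k)" for z
      using lt by (simp add: Suc_diff_le algebra_simps)
    ultimately show ?thesis by simp
  qed
  \<comment> \<open>At most m - k - 1 stays, each of weight at most n^2 + n + 1. Their total excess
    over n^2 + 1 per stay is at most n^2, less than the weight of the missing stay.\<close>
  have 3: "(\<lambda>z. \<Sum>i\<in>{Suc k..<n}. krow n (ent z) m i * ent z i k) \<in> weighted_poly ?\<omega>"
  proof (rule weighted_poly_sum)
    fix i assume i: "i \<in> {Suc k..<n}"
    have "(m - i) * wgt i \<le> (m - k - 1) * (n * n + n + 1)"
      using i by (intro mult_mono) (auto simp: wgt_def)
    also have "\<dots> = (m - k - 1) * n + (m - k - 1) * (n * n + 1)" by (simp add: algebra_simps)
    also have "(m - k - 1) * n \<le> n * n" using km by (intro mult_right_mono) auto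
    finally have "(m - i) * wgt i + 1 \<le> (n * n + 1) + (m - k - 1) * (n * n + 1)" by simp
    also have "\<dots> = Suc (m - k - 1) * (n * n + 1)" by simp
    also have "\<dots> \<le> (Suc m - k) * wgt k" using km by (intro mult_mono) (auto simp: wgt_def)
    finally have le: "(m - i) * wgt i + 0 \<le> ?\<omega>" by simp
    show "(\<lambda>z. krow n (ent z) m i * ent z i k) \<in> weighted_poly ?\<omega>"
      by (rule weighted_poly_mono[OF weighted_poly_mult[OF wp ent_weighted] le]) (use i in auto)
  qed
  have "(\<lambda>z. (if k = 0 then 0 else krow n (ent z) m (k - 1)) + ((krow n (ent z) m k * snd z k - snd z k ^ (Suc m - k)) +
      (\<Sum>i\<in>{Suc k..<n}. krow n (ent z) m i * ent z i k))) \<in> weighted_poly ?\<omega>"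
    by (rule weighted_poly.add[OF 1 weighted_poly.add[OF 2 3]])
  then show ?case by (simp add: sum_split algebra_simps del: krow.simps)
qed simp

sublocale leading_powers_system n deg wgt "\<lambda>k z. krow n (ent z) n k"
  by unfold_locales (use krow_ent_leading in \<open>auto simp: deg_def\<close>)

definition krow_point :: "(nat \<times> nat) point \<Rightarrow> nat \<times> nat \<Rightarrow> complex" where
  "krow_point z = (\<lambda>(i, j). krow n (ent z) i j)"

lemma umat_krow_point: "i < n \<Longrightarrow> j < n \<Longrightarrow> umat n (krow_point z) $$ (i, j) = krow n (ent z) i j"
  by (auto simp: umat_def krow_point_def krow_ent_diag krow_ent_above)

lemma krow_point_polys: "v \<in> lcoords n \<Longrightarrow> (\<lambda>z. krow_point z v) \<in> polys"
  by (cases v) (auto simp: krow_point_def lcoords_def intro!: polys.krow_alg ent_polys)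

lemma krow_in_cJ: "k < n \<Longrightarrow> (\<lambda>z. krow n (ent z) n k) \<in> cJ"
  by (rule c_in_cJ)

text \<open>For M with rows e_0^T H^i the matrices M H and N M agree except in the last row, where
  they differ by e_0^T H^n. Hence M^(-1) N M = H - M^(-1) e_(n-1) e_0^T H^n, and H is zero in the
  constrained positions.\<close>

lemma uconj_krow_point:
  assumes "(i, j) \<in> below"
  shows "(\<lambda>z. uconj_fun n (supdiag n) (i, j) (krow_point z)) \<in> cJ"
proof -
  have ij: "i < n" "j < n" "h j < i" "j < i" using assms below_gt[OF assms] by (auto simp: below_def)
  obtain n' where n': "n = Suc n'" using ij by (cases n) auto
  have eq: "uconj_fun n (supdiag n) (i, j) (krow_point z) =
      - (adj_mat (umat n (krow_point z)) $$ (i, n') * krow n (ent z) n j)" for z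
  proof -
    let ?U = "umat n (krow_point z)" and ?Ui = "adj_mat (umat n (krow_point z))"
    let ?H = "Matrix.mat n n (\<lambda>(i, j). ent z i j)"
    have NU: "(supdiag n * ?U) $$ (l, j) = (\<Sum>t<n. ?U $$ (l, t) * ent z t j) -
        (if l = n' then krow n (ent z) n j else 0)" if l: "l < n" for l
    proof -
      have "(\<Sum>t<n. ?U $$ (l, t) * ent z t j) = krow n (ent z) (Suc l) j"
        using l by (simp add: umat_krow_point)
      note sum_eq = this
      show ?thesis
      proof (cases "Suc l < n")
        case True
        then have "l \<noteq> n'" using n' by simp
        then show ?thesis
          unfolding supdiag_mult_entry[OF l ij(2)] sum_eq
          using True umat_krow_point[OF True ij(2)] by (simp only: if_True if_False diff_0_right)
      next
        case False
        then have "Suc l = n" "l = n'" using l n' by simp_all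
        then show ?thesis
          unfolding supdiag_mult_entry[OF l ij(2)] sum_eq
          using False by (simp only: if_True if_False diff_self refl)
      qed
    qed
    have "uconj n (supdiag n) (krow_point z) $$ (i, j) = (?Ui * (supdiag n * ?U)) $$ (i, j)"
      unfolding uconj_def by (simp add: assoc_mult_mat[of _ n n _ n _ n])
    also have "\<dots> = (\<Sum>l<n. ?Ui $$ (i, l) * (supdiag n * ?U) $$ (l, j))"
      using ij mult_carrier_mat[of "supdiag n" n n ?U n] by (intro mat_mult_index[of _ n n _ n]) auto
    also have "\<dots> = (\<Sum>l<n. ?Ui $$ (i, l) * (\<Sum>t<n. ?U $$ (l, t) * ent z t j)) -
        (\<Sum>l<n. if l = n' then ?Ui $$ (i, n') * krow n (ent z) n j else 0)"
      unfolding sum_subtractf[symmetric] using NU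
      by (intro sum.cong refl) (simp add: right_diff_distrib)
    also have "(\<Sum>l<n. if l = n' then ?Ui $$ (i, n') * krow n (ent z) n j else 0) =
        ?Ui $$ (i, n') * krow n (ent z) n j" using n' by simp
    also have "(\<Sum>l<n. ?Ui $$ (i, l) * (\<Sum>t<n. ?U $$ (l, t) * ent z t j)) =
        (\<Sum>t<n. (\<Sum>l<n. ?Ui $$ (i, l) * ?U $$ (l, t)) * ent z t j)"
      unfolding sum_distrib_left sum_distrib_right by (subst sum.swap) (simp add: mult_ac)
    also have "\<dots> = (\<Sum>t<n. if t = i then ent z i j else 0)"
    proof (intro sum.cong refl)
      fix t assume "t \<in> {..<n}"
      then have "(\<Sum>l<n. ?Ui $$ (i, l) * ?U $$ (l, t)) = (?Ui * ?U) $$ (i, t)"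
        using ij by (intro mat_mult_index[of _ n n _ n, symmetric]) auto
      then show "(\<Sum>l<n. ?Ui $$ (i, l) * ?U $$ (l, t)) * ent z t j = (if t = i then ent z i j else 0)"
        using ij \<open>t \<in> {..<n}\<close> by simp
    qed
    also have "\<dots> = 0" using ij by (simp add: ent_def)
    finally show ?thesis by (simp add: uconj_fun_def)
  qed
  have "(\<lambda>z. adj_mat (umat n (krow_point z)) $$ (i, n')) \<in> polys"
  proof (rule polys.adj_mat[where n = n])
    show "(\<lambda>z. umat n (krow_point z) $$ (k, l)) \<in> polys" if "k < n" "l < n" for k l
      using that by (simp add: umat_krow_point polys.krow_alg ent_polys)
  qed (use ij n' in auto)
  then show ?thesis unfolding eq by (intro cJ.ideal_uminus cJ.ideal_mult krow_in_cJ ij)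
qed

text \<open>A legitimate parameter value because indecomposability leaves the subdiagonal free. Over
  it H is tridiagonal with ones beside the diagonal, and e_0 is a cyclic vector.\<close>

definition q_one :: "nat \<times> nat \<Rightarrow> complex" where
  "q_one = (\<lambda>(i, j). if i = Suc j then 1 else 0)"

lemma kcol_q_one:
  assumes "k < n"
  shows "s < k \<Longrightarrow> kcol n (ent (q_one, x)) s k = 0" and "kcol n (ent (q_one, x)) k k = 1"
proof -
  have low: "ent (q_one, x) k i = 0" if "Suc i < k" for k i
    using that by (simp add: ent_def q_one_def)
  have sub: "ent (q_one, x) (Suc i) i = 1" if "Suc i < n" for i
    using h_indec[OF that] by (simp add: ent_def q_one_def)
  show 1: "kcol n (ent (q_one, x)) s k = 0" if "s < k" for s k
    using that
  proof (induction s arbitrary: k)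
    case (Suc s)
    have "ent (q_one, x) k i * kcol n (ent (q_one, x)) s i = 0" for i
      using Suc.IH[of i] Suc.prems low[of i k] by (cases "s < i") auto
    then show ?case unfolding kcol.simps by (simp only: sum.neutral_const)
  qed simp
  show "kcol n (ent (q_one, x)) k k = 1"
    using assms
  proof (induction k)
    case (Suc k)
    have "ent (q_one, x) (Suc k) i * kcol n (ent (q_one, x)) k i = (if i = k then 1 else 0)" for i
      using Suc 1[of k i] low[of i "Suc k"] sub[OF Suc.prems] by (cases i k rule: linorder_cases) auto
    then show ?case unfolding kcol.simps using Suc.prems by simp
  qed simp
qed

text \<open>For r \<ge> n the number e_0^T H^r e_0 is the row e_0^T H^n, whose entries generate the
  ideal, times the column H^(r-n) e_0.\<close>

lemma krow_beyond: 
  assumes "0 < n" "n \<le> r" shows "(\<lambda>z. krow n (ent z) r 0) \<in> cJ"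
proof -
  have "krow n (ent z) r 0 = (\<Sum>l<n. kcol n (ent z) (r - n) l * krow n (ent z) n l)" for z
    using krow_kcol[OF assms(1), of "ent z" n "r - n"] assms(2) by (simp add: mult.commute)
  moreover have "(\<lambda>z. \<Sum>l<n. kcol n (ent z) (r - n) l * krow n (ent z) n l) \<in> cJ"
    by (intro cJ.ideal_sum cJ.ideal_mult polys.kcol_alg ent_polys krow_in_cJ) auto
  ultimately show ?thesis by simp
qed

text \<open>At \<open>q_one\<close> the first column \<open>v\<close> of \<open>M\<close> is cyclic, \<open>M T = [v, Nv, N\<^sup>2v, \<dots>]\<close> with \<open>T\<close> upper unitriangular,
  and this Hankel matrix is antitriangular modulo \<open>cJ\<close>. Hence the minors are powers of the last entry of
  \<open>v\<close>, which is a root of unity modulo \<open>cJ\<close>.\<close>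

lemma lead_prod_inverse:
  assumes n: "0 < n"
  shows "\<exists>E\<in>polys. \<exists>r\<in>cJ. \<forall>x. lead_prod n (reversal n * umat n (krow_point (q_one, x))) * E (q_one, x) - 1 = r (q_one, x)"
proof -
  let ?P = "polys :: ((nat \<times> nat) point \<Rightarrow> complex) set"
  \<comment> \<open>The functions whose restriction to the fibre over \<open>q_one\<close> is that
    of an element of \<open>cJ\<close>. Working modulo \<open>I\<close> is working in the fibre
    without leaving \<open>polys\<close>.\<close>
  define I where "I = {f \<in> ?P. \<exists>r\<in>cJ. \<forall>x. f (q_one, x) = r (q_one, x)}"
  interpret I: fun_ideal ?P I
  proof unfold_locales
    show "I \<subseteq> ?P" by (auto simp: I_def)
    show "(\<lambda>_. 0) \<in> I" using cJ.ideal_zero polys.const[of 0] by (auto simp: I_def)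
    show "(\<lambda>x. f x + g x) \<in> I" if fg: "f \<in> I" "g \<in> I" for f g
    proof -
      obtain r s where "r \<in> cJ" "s \<in> cJ" "\<And>x. f (q_one, x) = r (q_one, x)" "\<And>x. g (q_one, x) = s (q_one, x)"
        using fg by (auto simp: I_def)
      then show ?thesis
        using fg polys.add[of f g] cJ.ideal_add[of r s] by (auto simp: I_def intro!: bexI[of _ "\<lambda>z. r z + s z"])
    qed
    show "(\<lambda>x. f x * g x) \<in> I" if fg: "f \<in> ?P" "g \<in> I" for f g
    proof -
      obtain s where "s \<in> cJ" "\<And>x. g (q_one, x) = s (q_one, x)" using fg by (auto simp: I_def)
      then show ?thesis
        using fg polys.mult[of f g] cJ.ideal_mult[of f s] by (auto simp: I_def intro!: bexI[of _ "\<lambda>z. f z * s z"])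
    qed
  qed
  have cJ_I: "f \<in> cJ \<Longrightarrow> f \<in> I" for f using cJ.ideal_sub by (auto simp: I_def)
  have zero_I: "f \<in> ?P \<Longrightarrow> (\<And>x. f (q_one, x) = 0) \<Longrightarrow> f \<in> I" for f
    using cJ.ideal_zero by (auto simp: I_def intro!: bexI[of _ "\<lambda>_. 0"])
  define v where "v = (\<lambda>z. krow n (ent z) (n - 1) 0)"
  have rP: "(\<lambda>z. krow n (ent z) r 0) \<in> ?P" for r
    by (rule polys.krow_alg) (use n ent_polys in auto)
  then have vP: "v \<in> ?P" by (simp add: v_def)
  define Y where "Y = (\<lambda>z. Matrix.mat n n (\<lambda>(i, j). krow n (ent z) (n - 1 - i + j) 0))"
  have Yc: "Y z \<in> carrier_mat n n" for z by (simp add: Y_def)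
  have Yent: "(\<lambda>z. Y z $$ (i, j)) \<in> ?P" if "i < n" "j < n" for i j
    using that rP by (simp add: Y_def)
  have minor_v: "(\<lambda>z. lead_minor k (Y z) - v z ^ k) \<in> I" if k: "k \<le> n" for k
  proof -
    \<comment> \<open>Above the diagonal the exponent n - 1 - i + j is at least n, so those entries
      of \<open>Y\<close> lie in the ideal; what is left is lower triangular with \<open>v\<close>
      along the diagonal.\<close>
    define L where "L = (\<lambda>z. Matrix.mat k k (\<lambda>(i, j). if j \<le> i then krow n (ent z) (n - 1 - i + j) 0 else 0))"
    have "det (L z) = v z ^ k" for z
    proof -
      have "det (L z) = prod_list (diag_mat (L z))"
        by (rule det_lower_triangular[of k]) (auto simp: L_def)
      also have "\<dots> = (\<Prod>i = 0..<k. L z $$ (i, i))" by (simp add: prod_list_diag_prod L_def)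
      also have "\<dots> = (\<Prod>i = 0..<k. v z)" using k by (intro prod.cong) (auto simp: L_def v_def)
      finally show ?thesis by simp
    qed
    moreover have "(\<lambda>z. det (lead_block k (Y z)) - det (L z)) \<in> I"
    proof (rule I.cong_det[where n = k])
      fix i j assume ij: "i < k" "j < k"
      show "(\<lambda>z. lead_block k (Y z) $$ (i, j)) \<in> ?P"
        using ij k Yent[of i j] by (simp add: lead_block_def)
      show "(\<lambda>z. L z $$ (i, j)) \<in> ?P"
        using ij rP polys.const[of 0] by (cases "j \<le> i") (simp_all add: L_def)
      show "(\<lambda>z. lead_block k (Y z) $$ (i, j) - L z $$ (i, j)) \<in> I"
      proof (cases "j \<le> i")
        case True
        then show ?thesis using ij k by (simp add: lead_block_def Y_def L_def I.ideal_zero)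
      next
        case False
        then have "(\<lambda>z. krow n (ent z) (n - 1 - i + j) 0) \<in> I"
          using ij k by (intro cJ_I krow_beyond n) auto
        then show ?thesis using False ij k by (simp add: lead_block_def Y_def L_def)
      qed
    qed (auto simp: L_def)
    ultimately show ?thesis by (simp add: lead_minor_def)
  qed
  have Y_q_one: "lead_minor k (Y (q_one, x)) = lead_minor k (reversal n * umat n (krow_point (q_one, x)))"
    if k: "k \<le> n" for k x
  proof -
    let ?U = "umat n (krow_point (q_one, x))"
    define T where "T = Matrix.mat n n (\<lambda>(l, j). kcol n (ent (q_one, x)) j l)"
    have T: "T \<in> carrier_mat n n" "upper_triangular T" by (auto simp: T_def kcol_q_one)
    have RU: "reversal n * ?U \<in> carrier_mat n n" by (rule mult_carrier_mat[OF reversal_carrier umat_carrier])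
    have "Y (q_one, x) = reversal n * ?U * T"
    proof (rule eq_matI)
      fix i j assume "i < dim_row (reversal n * ?U * T)" "j < dim_col (reversal n * ?U * T)"
      then have ij: "i < n" "j < n" by (auto simp: T_def reversal_def)
      have "(reversal n * ?U * T) $$ (i, j) = (\<Sum>l<n. (reversal n * ?U) $$ (i, l) * T $$ (l, j))"
        by (rule mat_mult_index[OF RU T(1) ij])
      also have "\<dots> = (\<Sum>l<n. krow n (ent (q_one, x)) (n - 1 - i) l * kcol n (ent (q_one, x)) j l)"
        using ij by (intro sum.cong refl) (simp add: reversal_mult[OF umat_carrier] umat_krow_point T_def)
      also have "\<dots> = Y (q_one, x) $$ (i, j)"
        using ij by (simp add: krow_kcol[OF n] Y_def)
      finally show "Y (q_one, x) $$ (i, j) = (reversal n * ?U * T) $$ (i, j)" by simp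
    qed (auto simp: Y_def T_def reversal_def)
    moreover have "lead_minor k T = 1"
    proof -
      have "det (lead_block k T) = prod_list (diag_mat (lead_block k T))"
        using k T(2) by (intro det_upper_triangular[of _ k]) (auto simp: lead_block_def T_def kcol_q_one)
      also have "\<dots> = 1"
        using k by (simp add: prod_list_diag_prod lead_block_def T_def kcol_q_one)
      finally show ?thesis by (simp add: lead_minor_def)
    qed
    ultimately show ?thesis using lead_minor_upper_mult[OF T(2,1) RU k] by simp
  qed
  define \<epsilon> where "\<epsilon> = det (reversal n)"
  have eps: "\<epsilon> * \<epsilon> = 1"
    unfolding \<epsilon>_def using det_mult[OF reversal_carrier reversal_carrier] by (simp add: reversal_reversal)
  have det_q_one: "lead_minor n (Y (q_one, x)) = \<epsilon>" for x
    unfolding Y_q_one[OF order_refl] \<epsilon>_def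
    by (subst lead_minor_full, rule mult_carrier_mat[OF reversal_carrier umat_carrier])
      (simp add: det_mult[of _ n] lower_unitri_det[OF lower_unitri_umat])
  have minorP: "(\<lambda>z. lead_minor k (Y z)) \<in> ?P" if "k \<le> n" for k
    by (rule polys.lead_minor[OF Yent that])
  have "(\<lambda>z. lead_minor n (Y z) - \<epsilon>) \<in> I"
    by (intro zero_I polys.diff minorP polys.const) (auto simp: det_q_one)
  from I.ideal_diff[OF this minor_v[OF order_refl]]
  have "(\<lambda>z. v z ^ n - \<epsilon>) \<in> I" by simp
  then have "(\<lambda>z. (v z ^ n) ^ 2 - \<epsilon> ^ 2) \<in> I"
    by (rule I.cong_power) (intro polys.power vP polys.const)+
  \<comment> \<open>The full minor equals both the constant \<epsilon> and v^n modulo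
    \<open>I\<close>, and \<epsilon> squares to 1.\<close>
  then have root: "(\<lambda>z. v z ^ (2 * n) - 1) \<in> I"
    using eps by (simp add: power2_eq_square[of \<epsilon>] flip: power_mult) (simp add: mult.commute)
  define s where "s = (\<Sum>k\<le>n. k)"
  have "(\<lambda>z. (\<Prod>k\<le>n. lead_minor k (Y z)) - (\<Prod>k\<le>n. v z ^ k)) \<in> I"
    by (intro I.cong_prod minor_v minorP polys.power vP) auto
  then have G: "(\<lambda>z. lead_prod n (Y z) - v z ^ s) \<in> I"
    by (simp add: lead_prod_def s_def power_sum)
  \<comment> \<open>The product of the minors is v^s modulo \<open>I\<close>; this exponent
    completes it to (v^(2n))^s, which is 1.\<close>
  define E where "E = (\<lambda>z. v z ^ ((2 * n - 1) * s))"
  have EP: "E \<in> ?P" unfolding E_def by (intro polys.power vP)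
  have "(\<lambda>z. (lead_prod n (Y z) - v z ^ s) * E z) \<in> I" by (rule I.ideal_mult2[OF G EP])
  moreover have "v z ^ s * E z = (v z ^ (2 * n)) ^ s" for z
  proof -
    have "s + (2 * n - 1) * s = 2 * n * s" using n by (cases n) auto
    then show ?thesis by (simp add: E_def flip: power_add power_mult)
  qed
  moreover have "(\<lambda>z. (v z ^ (2 * n)) ^ s - 1 ^ s) \<in> I"
    by (rule I.cong_power[OF root]) (intro polys.power vP polys.const)+
  ultimately have "(\<lambda>z. lead_prod n (Y z) * E z - 1) \<in> I"
    using I.ideal_add[of "\<lambda>z. (lead_prod n (Y z) - v z ^ s) * E z" "\<lambda>z. (v z ^ (2 * n)) ^ s - 1 ^ s"]
    by (simp add: left_diff_distrib)
  then obtain r where "r \<in> cJ" "\<And>x. lead_prod n (Y (q_one, x)) * E (q_one, x) - 1 = r (q_one, x)"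
    by (auto simp: I_def)
  moreover have "lead_prod n (Y (q_one, x)) = lead_prod n (reversal n * umat n (krow_point (q_one, x)))" for x
    unfolding lead_prod_def by (intro prod.cong) (auto simp: Y_q_one)
  ultimately show ?thesis using EP by auto
qed

text \<open>Two substitutions link the chart with the space of matrices H: \<open>krow_point\<close>
  sends H to the matrix with rows e_0^T H^i, and \<open>\<zeta>\<close> sends M to M^(-1) N M. The
  first carries the membership known up to a power of the minors into \<open>cJ\<close>, where that
  power can be cancelled; the second brings the result back, and on the chart their composite is the
  identity modulo the Hessenberg ideal.\<close>

theorem reduced_supdiag:
  assumes n: "0 < n" shows "reduced (supdiag n)"
  unfolding reduced_def
proof (intro ballI impI)
  let ?P = "polys :: ((nat \<times> nat) point \<Rightarrow> complex) set"
  fix p assume p: "p \<in> pf (lcoords n)" "\<forall>a\<in>hZ (supdiag n). p a = 0"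
  have "\<exists>m. (\<lambda>a. lead_prod n (reversal n * umat n a) ^ m * p a) \<in> hJ (supdiag n)"
    by (rule transfer[of _ "reversal n"])
      (use p reduced_subdiag in \<open>auto simp: reversal_reversal reversal_supdiag\<close>)
  then obtain m where m: "(\<lambda>a. lead_prod n (reversal n * umat n a) ^ m * p a) \<in> hJ (supdiag n)" by blast
  define G where "G = (\<lambda>z. lead_prod n (reversal n * umat n (krow_point z)))"
  define f where "f = (\<lambda>z. p (krow_point z))"
  have comp: "(\<lambda>z. g (krow_point z)) \<in> ?P" if "g \<in> pf (lcoords n)" for g
    by (rule polys.pf_compose[OF that krow_point_polys])
  have fP: "f \<in> ?P" unfolding f_def by (rule comp[OF p(1)])
  have GP: "G \<in> ?P"
    unfolding G_def
    by (rule comp, rule pfa.lead_prod, rule mult_umat_entry_pf) auto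
  have Gf: "(\<lambda>z. G z ^ m * f z) \<in> cJ"
    unfolding G_def f_def
  proof (rule cJ.idl_compose[OF m[unfolded hJ_def], where b = krow_point])
    show "(\<lambda>z. g (krow_point z)) \<in> ?P" if "g \<in> pf (lcoords n)" for g by (rule comp[OF that])
    show "(\<lambda>z. g (krow_point z)) \<in> cJ" if "g \<in> uconj_fun n (supdiag n) ` below" for g
      using that uconj_krow_point by auto
  qed
  obtain E r where E: "E \<in> ?P" and r: "r \<in> cJ" "\<And>x. G (q_one, x) * E (q_one, x) - 1 = r (q_one, x)"
    using lead_prod_inverse[OF n] unfolding G_def by blast
  have "f \<in> cJ"
  \<comment> \<open>\<open>G\<close> is only a unit on the fibre over \<open>q_one\<close>; the
    multiplier (G E)^m is 1 there modulo the ideal and still takes \<open>f\<close> into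
    \<open>cJ\<close>.\<close>
  proof (rule nonzerodivisor)
    show "(\<lambda>z. (G z * E z) ^ m) \<in> ?P" by (intro polys.power polys.mult GP E)
    show "f \<in> ?P" by fact
    have "(\<lambda>z. E z ^ m * (G z ^ m * f z)) \<in> cJ" by (rule cJ.ideal_mult[OF polys.power[OF E] Gf])
    then show "(\<lambda>z. (G z * E z) ^ m * f z) \<in> cJ" by (simp add: power_mult_distrib mult_ac)
    have "(\<lambda>z. (r z + 1) ^ m - 1 ^ m) \<in> cJ"
      using r(1) cJ.ideal_sub by (intro cJ.cong_power polys.add polys.const) auto
    then show "(\<lambda>z. (r z + 1) ^ m - 1) \<in> cJ" by simp
    show "(G (q_one, x) * E (q_one, x)) ^ m - 1 = (r (q_one, x) + 1) ^ m - 1" for x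
      by (simp flip: r(2))
  qed
  define H where "H = (\<lambda>a i j. uconj n (supdiag n) a $$ (i, j))"
  \<comment> \<open>All entries of H are recorded, including the constrained ones.
    \<open>ent\<close> reads the latter as zero, which changes H only by elements of the
    ideal.\<close>
  define \<zeta> where "\<zeta> = (\<lambda>a. (\<lambda>(i, j). if i < n \<and> j < n then H a i j else 0, \<lambda>i. if i < n then H a i i else 0))"
  interpret J: fun_ideal "pf (lcoords n)" "hJ (supdiag n)" by (rule fun_ideal_hJ) simp
  have Hpf: "(\<lambda>a. H a i j) \<in> pf (lcoords n)" if "i < n" "j < n" for i j
    using uconj_entry_pf[OF supdiag_carrier that] by (simp add: uconj_fun_def[abs_def] H_def)
  have z1: "(\<lambda>a. fst (\<zeta> a) v) \<in> pf (lcoords n)" for v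
    by (cases v, cases "fst v < n \<and> snd v < n") (auto simp: \<zeta>_def Hpf pf.const)
  have z2: "(\<lambda>a. snd (\<zeta> a) k) \<in> pf (lcoords n)" for k
    by (cases "k < n") (auto simp: \<zeta>_def Hpf pf.const)
  have polys_comp: "(\<lambda>a. g (\<zeta> a)) \<in> pf (lcoords n)" if g: "g \<in> ?P" for g
  proof -
    obtain \<omega> where "g \<in> weighted_poly \<omega>" using g by (auto simp: polys_def)
    then show ?thesis
    proof (induction rule: weighted_poly.induct)
      case (monomial y e)
      have "(\<lambda>a. y (fst (\<zeta> a))) \<in> pf (lcoords n)" by (rule pfa.pf_compose[OF monomial(1) z1])
      moreover have "(\<lambda>a. mono e (snd (\<zeta> a))) \<in> pf (lcoords n)"
        unfolding mono_def by (intro pfa.prod pfa.power z2)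
      ultimately show ?case by (rule pf.mult)
    qed (rule pf.add)
  qed
  have ent_cong: "(\<lambda>a. H a i k - ent (\<zeta> a) i k) \<in> hJ (supdiag n)" if ik: "i < n" "k < n" for i k
  proof -
    consider "i < k" | "i = k" | "k < i" "i \<le> h k" | "k < i" "h k < i" by linarith
    then show ?thesis
    proof cases
      case 1
      then show ?thesis using uconj_supdiag_upper[OF 1 ik(2)] by (simp add: H_def ent_def J.ideal_zero)
    next
      case 4
      then have "uconj_fun n (supdiag n) (i, k) \<in> hJ (supdiag n)"
        unfolding hJ_def using ik by (intro pfa.idl_gen) (auto simp: below_def)
      then show ?thesis using 4 by (simp add: H_def ent_def uconj_fun_def[abs_def])
    qed (use ik in \<open>auto simp: ent_def \<zeta>_def J.ideal_zero\<close>)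
  qed
  have krow_J: "(\<lambda>a. krow n (H a) m k - krow n (ent (\<zeta> a)) m k) \<in> hJ (supdiag n)" if "k < n" for m k
    by (rule J.krow_cong) (use that Hpf ent_cong polys_comp[OF ent_polys] in auto)
  have "(\<lambda>a. p a - p (krow_point (\<zeta> a))) \<in> hJ (supdiag n)"
  proof (rule J.pf_compose_cong[OF p(1), where b = "\<lambda>a. a"])
    fix v assume v: "v \<in> lcoords n"
    obtain i j where ij: "v = (i, j)" "j < i" "i < n" using v by (auto simp: lcoords_def)
    show "(\<lambda>a. a v) \<in> pf (lcoords n)" by (rule pf.var[OF v])
    show "(\<lambda>a. krow_point (\<zeta> a) v) \<in> pf (lcoords n)" by (rule polys_comp[OF krow_point_polys[OF v]])
    have "krow n (H a) i j = a v" for a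
      using krow_uconj_supdiag(1)[of j n i a] ij by (simp add: H_def[abs_def] umat_def)
    then show "(\<lambda>a. a v - krow_point (\<zeta> a) v) \<in> hJ (supdiag n)"
      using krow_J[of j i] ij by (simp add: krow_point_def)
  qed
  moreover have "(\<lambda>a. f (\<zeta> a)) \<in> hJ (supdiag n)"
  proof (rule J.idl_compose[OF \<open>f \<in> cJ\<close>])
    show "(\<lambda>a. g (\<zeta> a)) \<in> pf (lcoords n)" if "g \<in> ?P" for g by (rule polys_comp[OF that])
    fix g assume "g \<in> (\<lambda>k z. krow n (ent z) n k) ` {..<n}"
    then obtain k where g: "g = (\<lambda>z. krow n (ent z) n k)" and k: "k < n" by auto
    have "krow n (H a) n k = 0" for a
      using krow_uconj_supdiag(2)[OF k, of a] by (simp add: H_def[abs_def])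
    then show "(\<lambda>a. g (\<zeta> a)) \<in> hJ (supdiag n)"
      using J.ideal_uminus[OF krow_J[OF k, of n]] by (simp add: g)
  qed
  ultimately show "p \<in> hJ (supdiag n)"
    using J.ideal_add by (fastforce simp: f_def)
qed

end

section \<open>Prime ideals\<close>

text \<open>Zorn's lemma gives an ideal maximal among the proper ones above \<open>I\<close>. If it
  contains f g but not f, then 1 = q + r f with q in it, and multiplication by g shows that it
  contains g.\<close>

lemma (in fun_ideal) prime_above:
  assumes "(\<lambda>_. 1) \<notin> I"
  shows "\<exists>P. fun_ideal A P \<and> I \<subseteq> P \<and> (\<lambda>_. 1) \<notin> P \<and>
    (\<forall>f\<in>A. \<forall>g\<in>A. (\<lambda>x. f x * g x) \<in> P \<longrightarrow> f \<in> P \<or> g \<in> P)"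
proof -
  define S where "S = {P. fun_ideal A P \<and> I \<subseteq> P \<and> (\<lambda>_. 1) \<notin> P}"
  have "I \<in> S" using assms fun_ideal_axioms by (auto simp: S_def)
  have "\<exists>P\<in>S. \<forall>X\<in>S. P \<subseteq> X \<longrightarrow> X = P"
  proof (rule subset_Zorn_nonempty)
    show "S \<noteq> {}" using \<open>I \<in> S\<close> by auto
    fix \<C> assume ne: "\<C> \<noteq> {}" and chain: "subset.chain S \<C>"
    have id: "fun_ideal A X" if "X \<in> \<C>" for X using that chain by (auto simp: subset.chain_def S_def)
    have "fun_ideal A (\<Union>\<C>)"
    proof unfold_locales
      show "\<Union>\<C> \<subseteq> A" using id fun_ideal.ideal_sub by blast
      show "(\<lambda>_. 0) \<in> \<Union>\<C>" using ne id fun_ideal.ideal_zero by blast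
      show "(\<lambda>x. f x * g x) \<in> \<Union>\<C>" if f: "f \<in> A" and g: "g \<in> \<Union>\<C>" for f g
      proof -
        obtain X where "X \<in> \<C>" "g \<in> X" using g by blast
        then show ?thesis using fun_ideal.ideal_mult[OF id f] by blast
      qed
      fix f g assume f: "f \<in> \<Union>\<C>" and g: "g \<in> \<Union>\<C>"
      obtain X Y where XY: "X \<in> \<C>" "f \<in> X" "Y \<in> \<C>" "g \<in> Y" using f g by blast
      then have "X \<subseteq> Y \<or> Y \<subseteq> X" using chain unfolding subset.chain_def by blast
      then show "(\<lambda>x. f x + g x) \<in> \<Union>\<C>"
      proof
        assume "X \<subseteq> Y"
        then have "f \<in> Y" using XY by auto
        from fun_ideal.ideal_add[OF id[OF XY(3)] this XY(4)] show ?thesis using XY(3) by (rule UnionI[rotated])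
      next
        assume "Y \<subseteq> X"
        then have "g \<in> X" using XY by auto
        from fun_ideal.ideal_add[OF id[OF XY(1)] XY(2) this] show ?thesis using XY(1) by (rule UnionI[rotated])
      qed
    qed
    moreover have "I \<subseteq> \<Union>\<C>" "(\<lambda>_. 1) \<notin> \<Union>\<C>"
      using ne chain unfolding subset.chain_def S_def by blast+
    ultimately show "\<Union>\<C> \<in> S" by (simp add: S_def)
  qed
  then obtain P where P: "P \<in> S" and max: "\<And>X. X \<in> S \<Longrightarrow> P \<subseteq> X \<Longrightarrow> X = P" by blast
  interpret P: fun_ideal A P using P by (simp add: S_def)
  have "g \<in> P" if f: "f \<in> A" and g: "g \<in> A" and fg: "(\<lambda>x. f x * g x) \<in> P" and fP: "f \<notin> P" for f g
  proof -
    define X where "X = {u. \<exists>q\<in>P. \<exists>r\<in>A. u = (\<lambda>x. q x + r x * f x)}"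
    have XI: "(\<lambda>x. q x + r x * f x) \<in> X" if "q \<in> P" "r \<in> A" for q r
      using that by (auto simp: X_def)
    have "fun_ideal A X"
    proof unfold_locales
      show "X \<subseteq> A"
      proof
        fix u assume "u \<in> X"
        then obtain q r where qr: "q \<in> P" "r \<in> A" "u = (\<lambda>x. q x + r x * f x)" by (auto simp: X_def)
        show "u \<in> A" unfolding qr(3) using qr(1,2) f P.ideal_sub by (intro add mult) auto
      qed
      show "(\<lambda>_. 0) \<in> X"
        using XI[OF P.ideal_zero const[of 0]] by simp
      fix u v assume "u \<in> X" "v \<in> X"
      then obtain q r q' r' where qr: "q \<in> P" "r \<in> A" "u = (\<lambda>x. q x + r x * f x)"
        "q' \<in> P" "r' \<in> A" "v = (\<lambda>x. q' x + r' x * f x)" by (auto simp: X_def)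
      have "(\<lambda>x. u x + v x) = (\<lambda>x. (q x + q' x) + (r x + r' x) * f x)"
        by (simp add: qr algebra_simps)
      then show "(\<lambda>x. u x + v x) \<in> X"
        using XI[OF P.ideal_add[OF qr(1,4)] add[OF qr(2,5)]] by simp
    next
      fix u v assume u: "u \<in> A" and "v \<in> X"
      then obtain q r where qr: "q \<in> P" "r \<in> A" "v = (\<lambda>x. q x + r x * f x)" by (auto simp: X_def)
      have "(\<lambda>x. u x * v x) = (\<lambda>x. u x * q x + (u x * r x) * f x)" by (simp add: qr algebra_simps)
      then show "(\<lambda>x. u x * v x) \<in> X"
        using XI[OF P.ideal_mult[OF u qr(1)] mult[OF u qr(2)]] by simp
    qed
    moreover have PX: "P \<subseteq> X"
    proof
      fix q assume "q \<in> P"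
      then show "q \<in> X" using XI[OF _ const[of 0], of q] by simp
    qed
    moreover have "f \<in> X"
    proof -
      show ?thesis using XI[OF P.ideal_zero const[of 1]] by simp
    qed
    ultimately have "X \<notin> S" using max[of X] fP by auto
    then have "(\<lambda>_. 1) \<in> X"
      using \<open>fun_ideal A X\<close> PX P by (auto simp: S_def)
    then obtain q r where qr: "q \<in> P" "r \<in> A" "(\<lambda>_. 1) = (\<lambda>x. q x + r x * f x)" by (auto simp: X_def)
    have "(\<lambda>x. q x * g x + r x * (f x * g x)) \<in> P"
      by (intro P.ideal_add P.ideal_mult2[OF qr(1) g] P.ideal_mult[OF qr(2) fg])
    moreover have "q x * g x + r x * (f x * g x) = g x" for x
      using fun_cong[OF qr(3), of x] by (metis distrib_right mult.assoc mult_1)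
    ultimately show ?thesis by simp
  qed
  then show ?thesis using P by (intro exI[of _ P]) (auto simp: S_def)
qed

text \<open>A Vandermonde argument by divided differences: subtracting the value at one parameter s0
  and dividing by the nonzero constant s - s0 lowers the degree in s, and infinitely many parameters
  remain.\<close>

lemma (in fun_ideal) polynomial_coefficients:
  assumes "\<And>e. e \<le> N \<Longrightarrow> c e \<in> A" and "infinite K"
    and "\<And>s. s \<in> K \<Longrightarrow> (\<lambda>x. \<Sum>e\<le>N. s ^ e * c e x) \<in> I" and "e \<le> N"
  shows "c e \<in> I"
  using assms
proof (induction N arbitrary: c K e)
  case 0
  then obtain s where "s \<in> K" using infinite_imp_nonempty by blast
  then show ?case using 0 by auto
next
  case (Suc N)
  obtain s0 where s0: "s0 \<in> K" using Suc.prems(2) using infinite_imp_nonempty by blast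
  \<comment> \<open>The coefficients of (F(s) - F(s0)) / (s - s0), where F(s) is the sum of s^e c_e.
    They satisfy c'_j = c_(j+1) + s0 c'_(j+1), which recovers the c_e of positive index.\<close>
  define c' where "c' = (\<lambda>j x. \<Sum>e\<in>{Suc j..Suc N}. s0 ^ (e - Suc j) * c e x)"
  have c'I: "c' j \<in> I" if "j \<le> N" for j
  proof (rule Suc.IH[where K = "K - {s0}"])
    show "infinite (K - {s0})" using Suc.prems(2) by simp
    show "c' e \<in> A" if "e \<le> N" for e
      unfolding c'_def using Suc.prems(1) by (intro sum mult const) auto
    fix s assume s: "s \<in> K - {s0}"
    have "(\<lambda>x. (1 / (s - s0)) * ((\<Sum>e\<le>Suc N. s ^ e * c e x) - (\<Sum>e\<le>Suc N. s0 ^ e * c e x))) \<in> I"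
      using s s0 by (intro ideal_mult[OF const] ideal_diff Suc.prems(3)) auto
    moreover have "(1 / (s - s0)) * ((\<Sum>e\<le>Suc N. s ^ e * c e x) - (\<Sum>e\<le>Suc N. s0 ^ e * c e x)) =
        (\<Sum>j\<le>N. s ^ j * c' j x)" for x
    proof -
      have "(\<Sum>e\<le>Suc N. s ^ e * c e x) - (\<Sum>e\<le>Suc N. s0 ^ e * c e x) =
          (\<Sum>e\<le>Suc N. (s ^ e - s0 ^ e) * c e x)"
        by (simp only: sum_subtractf[symmetric] left_diff_distrib)
      also have "\<dots> = (\<Sum>e\<le>Suc N. (s - s0) * ((\<Sum>j<e. s ^ j * s0 ^ (e - Suc j)) * c e x))"
        by (intro sum.cong refl) (simp only: power_diff_sumr2 mult.assoc mult.commute[of "s0 ^ _" "s ^ _"])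
      also have "\<dots> = (s - s0) * (\<Sum>e\<le>Suc N. \<Sum>j<e. s ^ j * (s0 ^ (e - Suc j) * c e x))"
        by (simp only: sum_distrib_left sum_distrib_right mult.assoc)
      also have "(\<Sum>e\<le>Suc N. \<Sum>j<e. s ^ j * (s0 ^ (e - Suc j) * c e x)) =
          (\<Sum>j\<le>N. \<Sum>e\<in>{Suc j..Suc N}. s ^ j * (s0 ^ (e - Suc j) * c e x))"
        unfolding sum.Sigma[OF finite_atMost ballI[OF finite_lessThan]] sum.Sigma[OF finite_atMost ballI[OF finite_atLeastAtMost]]
        by (rule sum.reindex_bij_witness[of _ "\<lambda>(j, e). (e, j)" "\<lambda>(e, j). (j, e)"]) auto
      finally have eq: "(\<Sum>e\<le>Suc N. s ^ e * c e x) - (\<Sum>e\<le>Suc N. s0 ^ e * c e x) =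
          (s - s0) * (\<Sum>j\<le>N. \<Sum>e\<in>{Suc j..Suc N}. s ^ j * (s0 ^ (e - Suc j) * c e x))" .
      have cancel: "(1 / (s - s0)) * ((s - s0) * t) = t" for t using s by simp
      show ?thesis unfolding eq cancel by (simp only: c'_def sum_distrib_left)
    qed
    ultimately show "(\<lambda>x. \<Sum>j\<le>N. s ^ j * c' j x) \<in> I" by simp
  qed (use that in simp)
  have pos: "c e \<in> I" if e: "0 < e" "e \<le> Suc N" for e
  proof -
    obtain j where j: "e = Suc j" "j \<le> N" using e by (cases e) auto
    have "c' j x = c e x + s0 * (if j < N then c' (Suc j) x else 0)" for x
    proof -
      have "c' j x = c e x + (\<Sum>e\<in>{Suc (Suc j)..Suc N}. s0 ^ (e - Suc j) * c e x)"
        unfolding c'_def j(1) using j(2) by (subst sum.atLeast_Suc_atMost) auto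
      also have "(\<Sum>e\<in>{Suc (Suc j)..Suc N}. s0 ^ (e - Suc j) * c e x) = s0 * (if j < N then c' (Suc j) x else 0)"
      proof (cases "j < N")
        case True
        have "s0 ^ (e - Suc j) * c e x = s0 * (s0 ^ (e - Suc (Suc j)) * c e x)" if "e \<in> {Suc (Suc j)..Suc N}" for e
        proof -
          have "e - Suc j = Suc (e - Suc (Suc j))" using that by auto
          then show ?thesis by (simp only: power_Suc mult.assoc)
        qed
        then show ?thesis
          unfolding c'_def if_P[OF True] sum_distrib_left by (intro sum.cong refl)
      next
        case False
        then show ?thesis using j(2) by simp
      qed
      finally show ?thesis .
    qed
    then have "c e = (\<lambda>x. c' j x - s0 * (if j < N then c' (Suc j) x else 0))" by auto
    moreover have "(\<lambda>x. if j < N then c' (Suc j) x else 0) \<in> I"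
      using c'I[of "Suc j"] ideal_zero by (cases "j < N") auto
    ultimately show ?thesis using ideal_diff[OF c'I[OF j(2)] ideal_mult[OF const]] by simp
  qed
  show ?case
  proof (cases "e = 0")
    case True
    have "(\<lambda>x. (\<Sum>e\<le>Suc N. s0 ^ e * c e x) - (\<Sum>e\<in>{1..Suc N}. s0 ^ e * c e x)) \<in> I"
      using pos by (intro ideal_diff[OF Suc.prems(3)[OF s0]] ideal_sum ideal_mult[OF const]) auto
    moreover have "(\<Sum>e\<le>Suc N. s0 ^ e * c e x) - (\<Sum>e\<in>{1..Suc N}. s0 ^ e * c e x) = c 0 x" for x
      by (simp add: atMost_atLeast0 sum.atLeast_Suc_atMost[of 0] del: sum.cl_ivl_Suc)
    ultimately show ?thesis using True by simp
  next
    case False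
    then show ?thesis using pos Suc.prems(4) by simp
  qed
qed

section \<open>Moving into the chart at the identity by the centralizer\<close>

lemma power_sum_bound:
  fixes B :: nat
  assumes "\<And>i. i < k \<Longrightarrow> g i \<le> m" "k < B"
  shows "(\<Sum>i<k. B ^ g i) < B ^ Suc m"
proof -
  have "(\<Sum>i<k. B ^ g i) \<le> (\<Sum>i<k. B ^ m)"
    using assms by (intro sum_mono power_increasing) auto
  also have "\<dots> = k * B ^ m" by simp
  also have "\<dots> < B * B ^ m" using assms(2) by (intro mult_strict_right_mono) auto
  finally show ?thesis by simp
qed

text \<open>Uniqueness of base B digits: fewer than B summands produce no carry, so the sum tells
  how often each power occurs, and monotonicity fixes their order. The largest exponent dominates
  and is compared first.\<close>

lemma power_sum_inj:
  fixes B :: nat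
  assumes "k < B" and "\<And>i j. i \<le> j \<Longrightarrow> j < k \<Longrightarrow> f i \<le> f j" "\<And>i j. i \<le> j \<Longrightarrow> j < k \<Longrightarrow> g i \<le> g j"
    and "(\<Sum>i<k. B ^ f i) = (\<Sum>i<k. B ^ g i)" and "i < k"
  shows "f i = g i"
  using assms
proof (induction k arbitrary: i)
  case (Suc k)
  have ge: "B ^ u k \<le> (\<Sum>i<Suc k. B ^ u i)" for u :: "nat \<Rightarrow> nat" by simp
  have less: "(\<Sum>i<Suc k. B ^ u i) < (\<Sum>i<Suc k. B ^ v i)"
    if "u k < v k" "\<And>i. i < Suc k \<Longrightarrow> u i \<le> u k" for u v
  proof -
    have "(\<Sum>i<Suc k. B ^ u i) < B ^ Suc (u k)" by (rule power_sum_bound[OF that(2) Suc.prems(1)])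
    also have "\<dots> \<le> B ^ v k" using that(1) Suc.prems(1) by (intro power_increasing) auto
    also have "\<dots> \<le> (\<Sum>i<Suc k. B ^ v i)" by (rule ge)
    finally show ?thesis .
  qed
  have top: "f k = g k"
    using less[of f g] less[of g f] Suc.prems(2)[of _ k] Suc.prems(3)[of _ k] Suc.prems(4)
    by (cases "f k" "g k" rule: linorder_cases) auto
  show ?case
  proof (cases "i = k")
    case False
    then show ?thesis using Suc.prems top by (intro Suc.IH) auto
  qed (use top in simp)
qed simp

section \<open>Row minors and the leading minors of a product\<close>

definition row_minor :: "nat \<Rightarrow> (nat \<Rightarrow> nat) \<Rightarrow> complex mat \<Rightarrow> complex" where
  "row_minor k \<phi> X = det (Matrix.mat k k (\<lambda>(i, j). X $$ (\<phi> i, j)))"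

lemma row_minor_swap:
  assumes "Suc i < k"
  shows "row_minor k (\<phi>(i := \<phi> (Suc i), Suc i := \<phi> i)) X = - row_minor k \<phi> X"
proof -
  let ?A = "Matrix.mat k k (\<lambda>(i, j). X $$ (\<phi> i, j))"
  have "Matrix.mat k k (\<lambda>(l, j). X $$ ((\<phi>(i := \<phi> (Suc i), Suc i := \<phi> i)) l, j)) = swaprows i (Suc i) ?A"
    using assms by (intro eq_matI) (auto simp: mat_swaprows_def)
  then show ?thesis
    unfolding row_minor_def using assms by (simp add: det_swaprows[of i k "Suc i"])
qed

lemma row_minor_equal_rows:
  assumes "Suc i < k" "\<phi> i = \<phi> (Suc i)" shows "row_minor k \<phi> X = 0"
proof -
  have "\<phi>(i := \<phi> (Suc i), Suc i := \<phi> i) = \<phi>" using assms(2) by auto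
  then show ?thesis using row_minor_swap[OF assms(1), of \<phi> X] by simp
qed

text \<open>Cauchy-Binet before collecting terms: the sum runs over all maps choosing a row of
  \<open>X\<close> for each of the first k rows of \<open>T\<close>, repeated and unordered choices
  included. Later a single map is singled out by its exponent, so terms are not grouped by sets of
  rows.\<close>

lemma lead_minor_mult:
  assumes T: "T \<in> carrier_mat n n" and X: "X \<in> carrier_mat n n" and k: "k \<le> n"
  shows "lead_minor k (T * X) = (\<Sum>\<phi>\<in>PiE {0..<k} (\<lambda>_. {0..<n}). (\<Prod>i = 0..<k. T $$ (i, \<phi> i)) * row_minor k \<phi> X)"
proof -
  have "lead_minor k (T * X) = (\<Sum>p\<in>{p. p permutes {0..<k}}. signof p * (\<Prod>i = 0..<k. (T * X) $$ (i, p i)))"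
    unfolding lead_minor_def det_def'[OF lead_block_carrier]
    by (intro sum.cong refl arg_cong2[of _ _ _ _ "(*)"] prod.cong) (auto simp: lead_block_def)
  also have "\<dots> = (\<Sum>p\<in>{p. p permutes {0..<k}}. signof p *
      (\<Sum>\<phi>\<in>PiE {0..<k} (\<lambda>_. {0..<n}). \<Prod>i = 0..<k. T $$ (i, \<phi> i) * X $$ (\<phi> i, p i)))"
  proof (intro sum.cong refl arg_cong2[of _ _ _ _ "(*)"])
    fix p assume p: "p \<in> {p. p permutes {0..<k}}"
    have "(\<Prod>i = 0..<k. (T * X) $$ (i, p i)) = (\<Prod>i = 0..<k. \<Sum>l = 0..<n. T $$ (i, l) * X $$ (l, p i))"
    proof (intro prod.cong refl)
      fix i assume i: "i \<in> {0..<k}"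
      then have "p i \<in> {0..<k}" using p permutes_in_image[of p "{0..<k}" i] by blast
      then have "p i < n" using k by simp
      then show "(T * X) $$ (i, p i) = (\<Sum>l = 0..<n. T $$ (i, l) * X $$ (l, p i))"
        using i k by (subst mat_mult_index[OF T X]) (auto simp: lessThan_atLeast0)
    qed
    also have "\<dots> = (\<Sum>\<phi>\<in>PiE {0..<k} (\<lambda>_. {0..<n}). \<Prod>i = 0..<k. T $$ (i, \<phi> i) * X $$ (\<phi> i, p i))"
      by (rule prod_sum_PiE) auto
    finally show "(\<Prod>i = 0..<k. (T * X) $$ (i, p i)) =
        (\<Sum>\<phi>\<in>PiE {0..<k} (\<lambda>_. {0..<n}). \<Prod>i = 0..<k. T $$ (i, \<phi> i) * X $$ (\<phi> i, p i))" .
  qed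
  also have "\<dots> = (\<Sum>\<phi>\<in>PiE {0..<k} (\<lambda>_. {0..<n}). (\<Prod>i = 0..<k. T $$ (i, \<phi> i)) *
      (\<Sum>p\<in>{p. p permutes {0..<k}}. signof p * (\<Prod>i = 0..<k. X $$ (\<phi> i, p i))))"
    unfolding sum_distrib_left prod.distrib by (subst sum.swap) (simp add: mult_ac)
  also have "\<dots> = (\<Sum>\<phi>\<in>PiE {0..<k} (\<lambda>_. {0..<n}). (\<Prod>i = 0..<k. T $$ (i, \<phi> i)) * row_minor k \<phi> X)"
  proof (intro sum.cong refl arg_cong2[of _ _ _ _ "(*)"])
    fix \<phi> :: "nat \<Rightarrow> nat"
    have "row_minor k \<phi> X = (\<Sum>p\<in>{p. p permutes {0..<k}}. signof p *
        (\<Prod>i = 0..<k. Matrix.mat k k (\<lambda>(i, j). X $$ (\<phi> i, j)) $$ (i, p i)))"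
      unfolding row_minor_def by (rule det_def') simp
    also have "\<dots> = (\<Sum>p\<in>{p. p permutes {0..<k}}. signof p * (\<Prod>i = 0..<k. X $$ (\<phi> i, p i)))"
      by (intro sum.cong refl arg_cong2[of _ _ _ _ "(*)"] prod.cong) auto
    finally show "(\<Sum>p\<in>{p. p permutes {0..<k}}. signof p * (\<Prod>i = 0..<k. X $$ (\<phi> i, p i))) = row_minor k \<phi> X"
      by simp
  qed
  finally show ?thesis .
qed

text \<open>The Toeplitz matrix \<open>\<Sum>\<^sub>j s^(B^j) N\<^sup>j\<close>: the rapidly growing exponents give the summands of its minors
  distinct degrees in \<open>s\<close>.\<close>

definition toeplitz :: "nat \<Rightarrow> complex \<Rightarrow> complex mat" where
  "toeplitz n s = Matrix.mat n n (\<lambda>(i, j). if i \<le> j then s ^ (Suc n ^ (j - i)) else 0)"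

lemma toeplitz_carrier [simp]: "toeplitz n s \<in> carrier_mat n n"
  by (simp add: toeplitz_def)

lemma toeplitz_commute: "supdiag n * toeplitz n s = toeplitz n s * supdiag n"
proof (rule eq_matI)
  fix i j assume "i < dim_row (toeplitz n s * supdiag n)" "j < dim_col (toeplitz n s * supdiag n)"
  then have ij: "i < n" "j < n" by (auto simp: toeplitz_def supdiag_def)
  have "(supdiag n * toeplitz n s) $$ (i, j) = (\<Sum>k<n. supdiag n $$ (i, k) * toeplitz n s $$ (k, j))"
    using ij by (intro mat_mult_index[of _ n n _ n]) auto
  also have "\<dots> = (\<Sum>k<n. if k = Suc i then (if Suc i \<le> j then s ^ (Suc n ^ (j - Suc i)) else 0) else 0)"
    using ij by (intro sum.cong) (auto simp: supdiag_def toeplitz_def)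
  also have "\<dots> = (\<Sum>k<n. if 0 < j \<and> k = j - 1 then (if i \<le> j - 1 then s ^ (Suc n ^ (j - 1 - i)) else 0) else 0)"
    using ij by (cases j) (auto simp: less_Suc_eq_le)
  also have "\<dots> = (\<Sum>k<n. toeplitz n s $$ (i, k) * supdiag n $$ (k, j))"
    using ij by (intro sum.cong) (auto simp: supdiag_def toeplitz_def)
  also have "\<dots> = (toeplitz n s * supdiag n) $$ (i, j)"
    using ij by (intro mat_mult_index[of _ n n _ n, symmetric]) auto
  finally show "(supdiag n * toeplitz n s) $$ (i, j) = (toeplitz n s * supdiag n) $$ (i, j)" .
qed (auto simp: toeplitz_def supdiag_def)

lemma toeplitz_det: "det (toeplitz n s) = s ^ n"
proof -
  have "det (toeplitz n s) = prod_list (diag_mat (toeplitz n s))"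
    by (rule det_upper_triangular[of _ n]) (auto simp: toeplitz_def)
  also have "\<dots> = (\<Prod>i = 0..<n. s)"
    unfolding prod_list_diag_prod by (intro prod.cong) (auto simp: toeplitz_def)
  finally show ?thesis by simp
qed

text \<open>The leading minor is the sum of s^(wt \<phi>) times the row minor of \<phi>. Among the
  contributing maps with row minor outside \<open>P\<close>, one of least weight is alone in its
  degree. If infinitely many s gave values in \<open>P\<close>, every coefficient would lie in
  \<open>P\<close>, and with it that row minor.\<close>

lemma toeplitz_lead_minor_finite:
  assumes PA: "fun_ideal A P" and X: "\<And>x. X x \<in> carrier_mat n n"
    and XA: "\<And>i j. i < n \<Longrightarrow> j < n \<Longrightarrow> (\<lambda>x. X x $$ (i, j)) \<in> A" and k: "k \<le> n"
    and \<phi>0: "\<And>i. i < k \<Longrightarrow> \<phi>0 i < n" "(\<lambda>x. row_minor k \<phi>0 (X x)) \<notin> P"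
  shows "finite {s. (\<lambda>x. lead_minor k (toeplitz n s * X x)) \<in> P}"
proof (rule ccontr)
  interpret P: fun_ideal A P by (rule PA)
  assume inf: "infinite {s. (\<lambda>x. lead_minor k (toeplitz n s * X x)) \<in> P}"
  define \<Delta> where "\<Delta> = (\<lambda>\<phi> x. row_minor k \<phi> (X x))"
  define F where "F = PiE {0..<k} (\<lambda>_. {0..<n})"
  \<comment> \<open>The Toeplitz matrix is upper triangular, so only these maps contribute.\<close>
  define \<Phi> where "\<Phi> = {\<phi> \<in> F. \<forall>i<k. i \<le> \<phi> i}"
  define wt where "wt = (\<lambda>\<phi>. \<Sum>i<k. Suc n ^ (\<phi> i - i))"
  have finF: "finite F" unfolding F_def by (intro finite_PiE) auto
  then have fin\<Phi>: "finite \<Phi>" by (simp add: \<Phi>_def)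
  have \<Delta>A: "\<Delta> \<phi> \<in> A" if "\<phi> \<in> F" for \<phi>
    unfolding \<Delta>_def row_minor_def
    by (rule P.det[where n = k]) (use that k XA in \<open>auto simp: F_def PiE_def Pi_def\<close>)
  have swap: "\<phi>(i := \<phi> (Suc i), Suc i := \<phi> i) \<in> F \<and> \<Delta> (\<phi>(i := \<phi> (Suc i), Suc i := \<phi> i)) \<notin> P"
    if "\<phi> \<in> F" "\<Delta> \<phi> \<notin> P" "Suc i < k" for \<phi> i
  proof
    show "\<phi>(i := \<phi> (Suc i), Suc i := \<phi> i) \<in> F"
      using that by (auto simp: F_def PiE_def Pi_def extensional_def)
    have "\<Delta> \<phi> = (\<lambda>x. - \<Delta> (\<phi>(i := \<phi> (Suc i), Suc i := \<phi> i)) x)"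
      by (simp add: \<Delta>_def row_minor_swap[OF that(3)])
    then show "\<Delta> (\<phi>(i := \<phi> (Suc i), Suc i := \<phi> i)) \<notin> P"
      using that(2) P.ideal_uminus by metis
  qed
  have neq: "\<phi> i \<noteq> \<phi> (Suc i)" if "\<Delta> \<phi> \<notin> P" "Suc i < k" for \<phi> i
  proof
    assume "\<phi> i = \<phi> (Suc i)"
    then have "\<Delta> \<phi> = (\<lambda>_. 0)" using that(2) by (simp add: \<Delta>_def row_minor_equal_rows)
    then show False using that(1) P.ideal_zero by simp
  qed
  have strict_ge: "i \<le> \<phi> i" if "\<And>i. Suc i < k \<Longrightarrow> \<phi> i < \<phi> (Suc i)" "i < k" for \<phi> :: "nat \<Rightarrow> nat" and i
    using that(2)
  proof (induction i)
    case (Suc i)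
    then show ?case using that(1)[OF Suc.prems] by simp
  qed simp
  \<comment> \<open>Exchanging two rows changes the minor only by a sign, so a map that maximizes
    the sum of i \<phi>(i) has no adjacent inversion. Adjacent values differ since equal rows give a
    zero minor; a strictly increasing map satisfies i \<le> \<phi>(i).\<close>
  have "\<exists>\<phi>\<in>\<Phi>. \<Delta> \<phi> \<notin> P"
  proof -
    define S where "S = {\<phi> \<in> F. \<Delta> \<phi> \<notin> P}"
    define \<psi> where "\<psi> = restrict \<phi>0 {0..<k}"
    have "\<Delta> \<psi> = (\<lambda>x. row_minor k \<phi>0 (X x))"
      unfolding \<Delta>_def row_minor_def \<psi>_def by (intro ext arg_cong[of _ _ det] eq_matI) auto
    then have "\<psi> \<in> S" using \<phi>0 by (auto simp: S_def F_def \<psi>_def)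
    define rank where "rank = (\<lambda>\<phi> :: nat \<Rightarrow> nat. \<Sum>i<k. i * \<phi> i)"
    have fin: "finite (rank ` S)" using finF by (simp add: S_def)
    moreover have "rank ` S \<noteq> {}" using \<open>\<psi> \<in> S\<close> by auto
    ultimately have "Max (rank ` S) \<in> rank ` S" by (rule Max_in)
    then obtain \<phi> where \<phi>: "\<phi> \<in> S" and max: "\<And>\<phi>'. \<phi>' \<in> S \<Longrightarrow> rank \<phi>' \<le> rank \<phi>"
      using Max_ge[OF fin] by fastforce
    have "\<phi> i < \<phi> (Suc i)" if i: "Suc i < k" for i
    proof (rule ccontr)
      assume "\<not> \<phi> i < \<phi> (Suc i)"
      then have gt: "\<phi> (Suc i) < \<phi> i" using neq[of \<phi> i] i \<phi> by (fastforce simp: S_def)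
      let ?\<phi>' = "\<phi>(i := \<phi> (Suc i), Suc i := \<phi> i)"
      have "rank ?\<phi>' \<le> rank \<phi>" using swap[of \<phi> i] \<phi> i by (intro max) (auto simp: S_def)
      moreover have split: "(\<Sum>l<k. u l) = u i + (u (Suc i) + (\<Sum>l\<in>{..<k} - {i} - {Suc i}. u l))" for u :: "nat \<Rightarrow> nat"
        using i by (subst sum.remove[of _ i], simp, simp, subst sum.remove[of _ "Suc i"]) auto
      have "(\<Sum>l\<in>{..<k} - {i} - {Suc i}. l * ?\<phi>' l) = (\<Sum>l\<in>{..<k} - {i} - {Suc i}. l * \<phi> l)"
        by (intro sum.cong) auto
      ultimately have "i * \<phi> (Suc i) + Suc i * \<phi> i \<le> i * \<phi> i + Suc i * \<phi> (Suc i)"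
        unfolding rank_def split by simp
      then show False using gt by simp
    qed
    then have "\<phi> \<in> \<Phi>" using strict_ge[of \<phi>] \<phi> by (auto simp: \<Phi>_def S_def)
    then show ?thesis using \<phi> by (auto simp: S_def)
  qed
  then obtain \<phi> where \<phi>: "\<phi> \<in> \<Phi>" "\<Delta> \<phi> \<notin> P" and min: "\<And>\<phi>'. \<phi>' \<in> \<Phi> \<Longrightarrow> \<Delta> \<phi>' \<notin> P \<Longrightarrow> wt \<phi> \<le> wt \<phi>'"
    using Min_in[of "wt ` {\<phi> \<in> \<Phi>. \<Delta> \<phi> \<notin> P}"] Min_le[of "wt ` {\<phi> \<in> \<Phi>. \<Delta> \<phi> \<notin> P}"] fin\<Phi> by fastforce
  \<comment> \<open>Exchanging an adjacent inversion stays in \<open>\<Phi>\<close> and, with B = n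
    + 1, replaces B^(y+t+2) + B^y by the smaller B^(y+1) + B^(y+t+1), against minimality of the
    weight.\<close>
  have incr: "\<phi>' i < \<phi>' (Suc i)" if \<phi>': "\<phi>' \<in> \<Phi>" "\<Delta> \<phi>' \<notin> P" "wt \<phi>' = wt \<phi>" and i: "Suc i < k" for \<phi>' i
  proof (rule ccontr)
    assume "\<not> \<phi>' i < \<phi>' (Suc i)"
    then have gt: "\<phi>' (Suc i) < \<phi>' i" using neq[OF \<phi>'(2) i] by simp
    have ge: "Suc i \<le> \<phi>' (Suc i)" using \<phi>'(1) i by (simp add: \<Phi>_def)
    let ?\<phi>' = "\<phi>'(i := \<phi>' (Suc i), Suc i := \<phi>' i)"
    have "?\<phi>' \<in> \<Phi>" using swap[of \<phi>' i] \<phi>' i gt ge by (auto simp: \<Phi>_def)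
    then have "wt \<phi>' \<le> wt ?\<phi>'" using min[of ?\<phi>'] swap[of \<phi>' i] \<phi>' i by (auto simp: \<Phi>_def)
    moreover have split: "(\<Sum>l<k. u l) = u i + (u (Suc i) + (\<Sum>l\<in>{..<k} - {i} - {Suc i}. u l))" for u :: "nat \<Rightarrow> nat"
      using i by (subst sum.remove[of _ i], simp, simp, subst sum.remove[of _ "Suc i"]) auto
    have "(\<Sum>l\<in>{..<k} - {i} - {Suc i}. Suc n ^ (?\<phi>' l - l)) = (\<Sum>l\<in>{..<k} - {i} - {Suc i}. Suc n ^ (\<phi>' l - l))"
      by (intro sum.cong) auto
    ultimately have le: "Suc n ^ (\<phi>' i - i) + Suc n ^ (\<phi>' (Suc i) - Suc i) \<le>
        Suc n ^ (\<phi>' (Suc i) - i) + Suc n ^ (\<phi>' i - Suc i)"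
      unfolding wt_def split by (simp del: power_Suc)
    obtain y where y: "\<phi>' (Suc i) = Suc i + y" using ge le_Suc_ex by blast
    obtain t where t: "\<phi>' i = Suc (Suc i + y + t)" using gt y less_iff_Suc_add by auto
    have e: "\<phi>' i - i = Suc (Suc (y + t))" "\<phi>' (Suc i) - Suc i = y" "\<phi>' (Suc i) - i = Suc y" "\<phi>' i - Suc i = Suc (y + t)"
      using y t by auto
    have n1: "1 < n" using i k by simp
    have "2 * Suc n ^ Suc (y + t) \<le> Suc n * Suc n ^ Suc (y + t)" using n1 by (intro mult_right_mono) auto
    then have "2 * Suc n ^ Suc (y + t) \<le> Suc n ^ Suc (Suc (y + t))" by (simp only: power_Suc)
    moreover have "Suc n ^ Suc y \<le> Suc n ^ Suc (y + t)" by (intro power_increasing) auto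
    moreover have "0 < Suc n ^ y" by simp
    ultimately show False using le unfolding e by linarith
  qed
  \<comment> \<open>For a strictly increasing map the differences \<phi>(i) - i increase weakly, so
    \<open>power_sum_inj\<close> recovers them from the weight.\<close>
  have uniq: "\<phi>' = \<phi>" if \<phi>': "\<phi>' \<in> \<Phi>" "\<Delta> \<phi>' \<notin> P" "wt \<phi>' = wt \<phi>" for \<phi>'
  proof (rule PiE_ext)
    show "\<phi>' \<in> PiE {0..<k} (\<lambda>_. {0..<n})" "\<phi> \<in> PiE {0..<k} (\<lambda>_. {0..<n})"
      using \<phi>' \<phi> by (auto simp: \<Phi>_def F_def)
    fix i assume i: "i \<in> {0..<k}"
    have mono: "u i - i \<le> u j - j" if u: "\<And>i. Suc i < k \<Longrightarrow> u i < u (Suc i)" and ij: "i \<le> j" "j < k" for u :: "nat \<Rightarrow> nat" and i j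
      using ij
    proof (induction j rule: dec_induct)
      case (step j)
      then show ?case using u[of j] by simp
    qed simp
    have "\<phi>' i - i = \<phi> i - i"
      by (rule power_sum_inj[of k "Suc n" "\<lambda>i. \<phi>' i - i" "\<lambda>i. \<phi> i - i"])
        (use k i \<phi>'(3) mono[of \<phi>'] mono[of \<phi>] incr[OF \<phi>'] incr[OF \<phi> refl] in \<open>auto simp: wt_def\<close>)
    moreover have "i \<le> \<phi>' i" "i \<le> \<phi> i" using \<phi>' \<phi> i by (auto simp: \<Phi>_def)
    ultimately show "\<phi>' i = \<phi> i" by simp
  qed
  define N where "N = Max (insert 0 (wt ` \<Phi>))"
  define co where "co = (\<lambda>e x. \<Sum>\<phi>\<in>{\<phi> \<in> \<Phi>. wt \<phi> = e}. \<Delta> \<phi> x)"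
  have wtN: "wt \<phi> \<le> N" if "\<phi> \<in> \<Phi>" for \<phi> unfolding N_def using fin\<Phi> that by (intro Max_ge) auto
  have expand: "lead_minor k (toeplitz n s * X x) = (\<Sum>e\<le>N. s ^ e * co e x)" for s x
  proof -
    have "lead_minor k (toeplitz n s * X x) = (\<Sum>\<phi>\<in>F. (\<Prod>i = 0..<k. toeplitz n s $$ (i, \<phi> i)) * \<Delta> \<phi> x)"
      unfolding F_def \<Delta>_def by (rule lead_minor_mult[OF toeplitz_carrier X k])
    also have "\<dots> = (\<Sum>\<phi>\<in>\<Phi>. (\<Prod>i = 0..<k. toeplitz n s $$ (i, \<phi> i)) * \<Delta> \<phi> x)"
    proof (intro sum.mono_neutral_right finF ballI)
      fix \<phi> assume "\<phi> \<in> F - \<Phi>"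
      then obtain i where "i < k" "\<phi> i < i" "\<phi> i < n" by (auto simp: \<Phi>_def F_def PiE_def Pi_def not_le)
      then have "(\<Prod>i = 0..<k. toeplitz n s $$ (i, \<phi> i)) = 0"
        using k by (intro prod_zero) (auto simp: toeplitz_def intro!: bexI[of _ i])
      then show "(\<Prod>i = 0..<k. toeplitz n s $$ (i, \<phi> i)) * \<Delta> \<phi> x = 0" by simp
    qed (auto simp: \<Phi>_def)
    also have "\<dots> = (\<Sum>\<phi>\<in>\<Phi>. s ^ wt \<phi> * \<Delta> \<phi> x)"
    proof (intro sum.cong refl arg_cong2[of _ _ _ _ "(*)"])
      fix \<phi> assume \<phi>: "\<phi> \<in> \<Phi>"
      have "(\<Prod>i = 0..<k. toeplitz n s $$ (i, \<phi> i)) = (\<Prod>i = 0..<k. s ^ (Suc n ^ (\<phi> i - i)))"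
        using \<phi> k by (intro prod.cong refl) (auto simp: toeplitz_def \<Phi>_def F_def PiE_def Pi_def)
      then show "(\<Prod>i = 0..<k. toeplitz n s $$ (i, \<phi> i)) = s ^ wt \<phi>"
        by (simp add: wt_def power_sum lessThan_atLeast0)
    qed
    also have "\<dots> = (\<Sum>e\<le>N. \<Sum>\<phi>\<in>{\<phi> \<in> \<Phi>. wt \<phi> = e}. s ^ wt \<phi> * \<Delta> \<phi> x)"
      using wtN fin\<Phi> by (subst sum.group) auto
    finally show ?thesis by (simp add: co_def sum_distrib_left)
  qed
  have "co (wt \<phi>) \<in> P"
  proof (rule P.polynomial_coefficients[OF _ inf])
    show "co e \<in> A" for e unfolding co_def using \<Delta>A by (intro P.sum) (auto simp: \<Phi>_def)
    show "(\<lambda>x. \<Sum>e\<le>N. s ^ e * co e x) \<in> P" if "s \<in> {s. (\<lambda>x. lead_minor k (toeplitz n s * X x)) \<in> P}" for s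
      using that by (simp add: expand)
    show "wt \<phi> \<le> N" by (rule wtN[OF \<phi>(1)])
  qed
  moreover have "(\<lambda>x. \<Sum>\<phi>'\<in>{\<phi>' \<in> \<Phi>. wt \<phi>' = wt \<phi>} - {\<phi>}. \<Delta> \<phi>' x) \<in> P"
    using uniq by (intro P.ideal_sum) auto
  moreover have "co (wt \<phi>) x - (\<Sum>\<phi>'\<in>{\<phi>' \<in> \<Phi>. wt \<phi>' = wt \<phi>} - {\<phi>}. \<Delta> \<phi>' x) = \<Delta> \<phi> x" for x
    unfolding co_def using \<phi>(1) fin\<Phi> by (subst sum.remove[of _ \<phi>]) auto
  ultimately have "\<Delta> \<phi> \<in> P" using P.ideal_diff by (metis (no_types, lifting) ext)
  then show False using \<phi>(2) by simp
qed

text \<open>The multipliers of \<open>p\<close> into the ideal form an ideal that contains, for each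
  s \<noteq> 0, a power of the product of the leading minors after translation by the Toeplitz
  matrix. A prime above it would contain one of these minors for every such s, yet each of the
  finitely many minors lies in it for only finitely many s. So 1 is a multiplier.\<close>

theorem (in hessenberg_fun) reduced_chart:
  assumes n: "0 < n" and c: "Q \<in> carrier_mat n n" "Q' \<in> carrier_mat n n"
    and inv: "Q * Q' = 1\<^sub>m n" "Q' * Q = 1\<^sub>m n"
    and \<sigma>: "\<And>i. i < n \<Longrightarrow> \<sigma> i < n"
      "\<And>a i j. i < n \<Longrightarrow> j < n \<Longrightarrow> (Q * umat n a) $$ (\<sigma> i, j) = umat n a $$ (i, j)"
  shows "reduced (Q' * supdiag n * Q)"
  unfolding reduced_def
proof (intro ballI impI)
  let ?E = "Q' * supdiag n * Q" and ?A = "pf (lcoords n)"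
  fix p assume p: "p \<in> ?A" "\<forall>a\<in>hZ ?E. p a = 0"
  note [simp] = c mult_carrier_mat[of _ n n _ n]
  interpret J: fun_ideal ?A "hJ ?E" by (rule fun_ideal_hJ) simp
  \<comment> \<open>The Toeplitz matrix commutes with N, so translating by it compares this chart
    with the chart at the identity for N itself.\<close>
  have moved: "\<exists>m. (\<lambda>a. lead_prod n (toeplitz n s * (Q * umat n a)) ^ m * p a) \<in> hJ ?E" if s: "s \<noteq> 0" for s
  proof -
    let ?T = "toeplitz n s"
    have "?T \<in> Units (ring_mat TYPE(complex) n ())"
      using s by (intro det_non_zero_imp_unit) (auto simp: toeplitz_det)
    then obtain T' where T'c: "T' \<in> carrier_mat n n" and TT': "?T * T' = 1\<^sub>m n" "T' * ?T = 1\<^sub>m n"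
      by (auto simp: Units_def ring_mat_def)
    note [simp] = T'c
    have as: "(X * Y) * Z = X * (Y * Z)" if "X \<in> carrier_mat n n" "Y \<in> carrier_mat n n" "Z \<in> carrier_mat n n"
      for X Y Z :: "complex mat" using that by (rule assoc_mult_mat)
    have can: "X * (Y * Z) = Z" if "X * Y = 1\<^sub>m n" "X \<in> carrier_mat n n" "Y \<in> carrier_mat n n" "Z \<in> carrier_mat n n"
      for X Y Z :: "complex mat" using that as[of X Y Z] by simp
    note cans = can[OF TT'(1)] can[OF TT'(2)] can[OF inv(1)] can[OF inv(2)]
    have E: "(?T * Q) * ?E * (Q' * T') = supdiag n"
    proof -
      have "(?T * Q) * ?E * (Q' * T') = ?T * (supdiag n * T')" by (simp add: as cans)
      also have "\<dots> = (supdiag n * ?T) * T'" unfolding toeplitz_commute by (simp add: as)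
      also have "\<dots> = supdiag n" by (simp add: as TT' right_mult_one_mat[OF supdiag_carrier])
      finally show ?thesis .
    qed
    have "\<exists>m. (\<lambda>a. lead_prod n (?T * Q * umat n a) ^ m * p a) \<in> hJ ?E"
    proof (rule transfer[where C = "?T * Q" and C' = "Q' * T'"])
      show "?T * Q * (Q' * T') = 1\<^sub>m n" "Q' * T' * (?T * Q) = 1\<^sub>m n" by (simp_all add: as cans TT' inv)
      show "reduced (?T * Q * ?E * (Q' * T'))" unfolding E by (rule reduced_supdiag[OF n])
    qed (use p in simp_all)
    then show ?thesis by (simp add: as)
  qed
  define I where "I = {f \<in> ?A. (\<lambda>a. f a * p a) \<in> hJ ?E}"
  interpret I: fun_ideal ?A I
  proof unfold_locales
    show "(\<lambda>a. f a + g a) \<in> I" if "f \<in> I" "g \<in> I" for f g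
      using that pf.add[of f _ g] J.ideal_add[of "\<lambda>a. f a * p a" "\<lambda>a. g a * p a"]
      by (auto simp: I_def distrib_right)
    show "(\<lambda>a. f a * g a) \<in> I" if "f \<in> ?A" "g \<in> I" for f g
      using that pf.mult[of f _ g] J.ideal_mult[of f "\<lambda>a. g a * p a"] by (auto simp: I_def mult.assoc)
  qed (auto simp: I_def J.ideal_zero pf.const)
  have "(\<lambda>_. 1) \<in> I"
  proof (rule ccontr)
    assume "(\<lambda>_. 1) \<notin> I"
    then obtain P where P: "fun_ideal ?A P" "I \<subseteq> P" "(\<lambda>_. 1) \<notin> P"
      and prime: "\<And>f g. f \<in> ?A \<Longrightarrow> g \<in> ?A \<Longrightarrow> (\<lambda>a. f a * g a) \<in> P \<Longrightarrow> f \<in> P \<or> g \<in> P"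
      using I.prime_above by metis
    interpret P: fun_ideal ?A P by (rule P(1))
    have XA: "(\<lambda>a. (Q * umat n a) $$ (i, j)) \<in> ?A" if "i < n" "j < n" for i j
      by (rule mult_umat_entry_pf[OF c(1) that])
    have "finite {s. (\<lambda>a. lead_minor k (toeplitz n s * (Q * umat n a))) \<in> P}" if k: "k \<le> n" for k
    proof (rule toeplitz_lead_minor_finite[OF P(1) _ XA k])
      show "\<sigma> i < n" if "i < k" for i using \<sigma>(1) that k by simp
      \<comment> \<open>The rows \<sigma>(0), ..., \<sigma>(k-1) of Q M are the first k rows of M,
        so this is a leading minor of a unitriangular matrix.\<close>
      have "row_minor k \<sigma> (Q * umat n a) = lead_minor k (umat n a * 1\<^sub>m n)" for a
        unfolding row_minor_def lead_minor_def lead_block_def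
        using \<sigma>(2) k by (intro arg_cong[of _ _ det] eq_matI) (auto simp: right_mult_one_mat[OF umat_carrier])
      then have "row_minor k \<sigma> (Q * umat n a) = 1" for a
        using lead_minor_lower_mult[OF lower_unitri_umat, of "1\<^sub>m n" n k a] k by (simp add: lead_minor_one)
      then show "(\<lambda>a. row_minor k \<sigma> (Q * umat n a)) \<notin> P" using P(3) by simp
    qed simp_all
    then have "finite (insert 0 (\<Union>k\<le>n. {s. (\<lambda>a. lead_minor k (toeplitz n s * (Q * umat n a))) \<in> P}))" by simp
    then obtain s where s: "s \<notin> insert 0 (\<Union>k\<le>n. {s. (\<lambda>a. lead_minor k (toeplitz n s * (Q * umat n a))) \<in> P})"
      by (metis ex_new_if_finite infinite_UNIV_char_0)
    have TXA: "(\<lambda>a. (toeplitz n s * (Q * umat n a)) $$ (i, j)) \<in> ?A" if "i < n" "j < n" for i j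
      by (rule pfa.mat_mult[where n = n]) (use that XA in \<open>auto intro: pf.const\<close>)
    have prod_notin: "finite T \<Longrightarrow> (\<And>k. k \<in> T \<Longrightarrow> f k \<in> ?A - P) \<Longrightarrow> (\<lambda>a. \<Prod>k\<in>T. f k a) \<notin> P" for f and T :: "nat set"
    proof (induction T rule: finite_induct)
      case (insert k T)
      then show ?case using prime[of "f k" "\<lambda>a. \<Prod>k\<in>T. f k a"] by (auto intro: pfa.prod)
    qed (use P(3) in simp)
    let ?D = "\<lambda>a. lead_prod n (toeplitz n s * (Q * umat n a))"
    have DA: "?D \<in> ?A" by (rule pfa.lead_prod[OF TXA])
    have DP: "?D \<notin> P"
      unfolding lead_prod_def
      by (rule prod_notin) (use s in \<open>auto intro: pfa.lead_minor[OF TXA]\<close>)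
    obtain m where "(\<lambda>a. ?D a ^ m * p a) \<in> hJ ?E" using moved[of s] s by auto
    then have "(\<lambda>a. ?D a ^ m) \<in> P" using P(2) pfa.power[OF DA] by (auto simp: I_def)
    moreover have "(\<lambda>a. \<Prod>k<m. ?D a) \<notin> P" by (rule prod_notin) (use DA DP in auto)
    ultimately show False by simp
  qed
  then show "p \<in> hJ ?E" by (simp add: I_def)
qed

section \<open>Polynomials and their evaluations\<close>

definition monomial_eval :: "(nat \<Rightarrow> nat \<Rightarrow> complex) \<Rightarrow> ((nat \<times> nat) \<Rightarrow>\<^sub>0 nat) \<Rightarrow> complex" where
  "monomial_eval a m = (\<Prod>(i, j)\<in>Poly_Mapping.keys m. a i j ^ Poly_Mapping.lookup m (i, j))"

lemma monomial_eval_superset: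
  assumes "finite K" "Poly_Mapping.keys m \<subseteq> K"
  shows "monomial_eval a m = (\<Prod>(i, j)\<in>K. a i j ^ Poly_Mapping.lookup m (i, j))"
  unfolding monomial_eval_def using assms
  by (intro prod.mono_neutral_left) (auto simp: in_keys_iff)

lemma monomial_eval_add: "monomial_eval a (m + m') = monomial_eval a m * monomial_eval a m'"
proof -
  let ?K = "Poly_Mapping.keys m \<union> Poly_Mapping.keys m'"
  have "monomial_eval a (m + m') = (\<Prod>(i, j)\<in>?K. a i j ^ Poly_Mapping.lookup (m + m') (i, j))"
    by (rule monomial_eval_superset) (use Poly_Mapping.keys_add[of m m'] in auto)
  also have "\<dots> = (\<Prod>(i, j)\<in>?K. a i j ^ Poly_Mapping.lookup m (i, j)) * (\<Prod>(i, j)\<in>?K. a i j ^ Poly_Mapping.lookup m' (i, j))"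
    unfolding prod.distrib[symmetric] by (intro prod.cong) (auto simp: lookup_add power_add)
  finally show ?thesis by (simp add: monomial_eval_superset[of ?K])
qed

lemma poly_eval_superset:
  assumes "finite K" "Poly_Mapping.keys p \<subseteq> K"
  shows "poly_eval a p = (\<Sum>m\<in>K. Poly_Mapping.lookup p m * monomial_eval a m)"
  unfolding poly_eval_def monomial_eval_def[symmetric] using assms
  by (intro sum.mono_neutral_left) (auto simp: in_keys_iff)

lemma poly_eval_add: "poly_eval a (p + q) = poly_eval a p + poly_eval a q"
proof -
  let ?K = "Poly_Mapping.keys p \<union> Poly_Mapping.keys q"
  have "poly_eval a (p + q) = (\<Sum>m\<in>?K. Poly_Mapping.lookup (p + q) m * monomial_eval a m)"
    by (rule poly_eval_superset) (use Poly_Mapping.keys_add[of p q] in auto)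
  then show ?thesis
    by (simp add: poly_eval_superset[of ?K] lookup_add distrib_right sum.distrib)
qed

lemma poly_eval_single: "poly_eval a (Poly_Mapping.single m c) = c * monomial_eval a m"
  by (subst poly_eval_superset[of "{m}"]) auto

lemma poly_eval_zero: "poly_eval a 0 = 0"
  by (simp add: poly_eval_def)

lemma poly_eval_sum: "poly_eval a (sum f T) = (\<Sum>i\<in>T. poly_eval a (f i))"
  by (induction T rule: infinite_finite_induct) (auto simp: poly_eval_add poly_eval_zero)

lemma poly_mapping_decompose:
  fixes p :: cpoly
  shows "p = (\<Sum>m\<in>Poly_Mapping.keys p. Poly_Mapping.single m (Poly_Mapping.lookup p m))"
  by (rule poly_mapping_eqI) (auto simp: lookup_sum lookup_single in_keys_iff when_def)

lemma poly_eval_mult: "poly_eval a (p * q) = poly_eval a p * poly_eval a q"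
proof -
  let ?t = "\<lambda>p m. Poly_Mapping.single m (Poly_Mapping.lookup p m)"
  have "poly_eval a (p * q) =
      poly_eval a ((\<Sum>m\<in>Poly_Mapping.keys p. ?t p m) * (\<Sum>m\<in>Poly_Mapping.keys q. ?t q m))"
    by (simp only: poly_mapping_decompose[symmetric])
  also have "\<dots> = (\<Sum>m\<in>Poly_Mapping.keys p. \<Sum>m'\<in>Poly_Mapping.keys q.
      (Poly_Mapping.lookup p m * monomial_eval a m) * (Poly_Mapping.lookup q m' * monomial_eval a m'))"
    by (simp add: sum_product poly_eval_sum mult_single poly_eval_single monomial_eval_add mult_ac)
  also have "\<dots> = poly_eval a p * poly_eval a q"
    by (simp only: sum_product poly_eval_superset[OF finite_keys subset_refl])
  finally show ?thesis .
qed

lemma poly_eval_one: "poly_eval a 1 = 1"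
  by (simp add: poly_eval_single monomial_eval_def flip: single_one)

interpretation poly_eval: comm_ring_hom "poly_eval a" for a
  by unfold_locales (auto simp: poly_eval_add poly_eval_mult poly_eval_zero poly_eval_one)

lemma poly_eval_var: "poly_eval a (poly_var i j) = a i j"
  by (simp add: poly_var_def poly_eval_single monomial_eval_def)

text \<open>Since C is infinite, a polynomial in finitely many variables is determined by its
  values; this lets statements about formal polynomials be settled on functions.\<close>

lemma poly_eval_injective:
  assumes V: "finite V" "\<And>m. m \<in> Poly_Mapping.keys p \<Longrightarrow> Poly_Mapping.keys m \<subseteq> V"
    and zero: "\<And>a. poly_eval a p = 0"
  shows "p = 0"
proof (rule ccontr)
  assume "p \<noteq> 0"
  then obtain m0 where m0: "m0 \<in> Poly_Mapping.keys p" by (metis keys_eq_empty ex_in_conv)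
  define T where "T = Poly_Mapping.lookup ` Poly_Mapping.keys p"
  define \<kappa> where "\<kappa> = (\<lambda>e. Poly_Mapping.lookup p (Poly_Mapping.Abs_poly_mapping e))"
  have inj: "inj_on Poly_Mapping.lookup (Poly_Mapping.keys p)"
    by (intro inj_onI) (simp add: poly_mapping.lookup_inject)
  have "\<kappa> (Poly_Mapping.lookup m0) = 0"
  proof (rule monomials_independent[where V = V and T = T and \<kappa> = \<kappa>])
    show "m v = 0" if "m \<in> T" "v \<notin> V" for m v
    proof -
      obtain m' where m': "m' \<in> Poly_Mapping.keys p" "m = Poly_Mapping.lookup m'"
        using \<open>m \<in> T\<close> by (auto simp: T_def)
      then have "v \<notin> Poly_Mapping.keys m'" using V(2)[OF m'(1)] \<open>v \<notin> V\<close> by auto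
      then show ?thesis using m'(2) by (simp add: in_keys_iff)
    qed
    show "Poly_Mapping.lookup m0 \<in> T" using m0 by (simp add: T_def)
    fix x :: "nat \<times> nat \<Rightarrow> complex"
    have "(\<Sum>m\<in>T. \<kappa> m * (\<Prod>v\<in>V. x v ^ m v)) =
        (\<Sum>m\<in>Poly_Mapping.keys p. Poly_Mapping.lookup p m * (\<Prod>v\<in>V. x v ^ Poly_Mapping.lookup m v))"
      unfolding T_def by (subst sum.reindex[OF inj]) (simp add: \<kappa>_def lookup_inverse)
    also have "\<dots> = (\<Sum>m\<in>Poly_Mapping.keys p. Poly_Mapping.lookup p m * monomial_eval (\<lambda>i j. x (i, j)) m)"
      using V by (intro sum.cong refl) (simp add: monomial_eval_superset[OF V(1)] case_prod_beta)
    also have "\<dots> = poly_eval (\<lambda>i j. x (i, j)) p" by (rule poly_eval_superset[symmetric]) auto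
    finally show "(\<Sum>m\<in>T. \<kappa> m * (\<Prod>v\<in>V. x v ^ m v)) = 0" using zero by simp
  qed (use V T_def in auto)
  then show False using m0 by (simp add: \<kappa>_def lookup_inverse in_keys_iff)
qed

section \<open>The general linear group and the flag variety\<close>

lemma GL_I:
  fixes X Y :: "'a::comm_ring_1 mat"
  assumes c: "X \<in> carrier_mat n n" "Y \<in> carrier_mat n n" and inv: "X * Y = 1\<^sub>m n" "Y * X = 1\<^sub>m n"
  shows "X \<in> carrier (GL n)" "inv\<^bsub>GL n\<^esub> X = Y"
proof -
  interpret R: ring "ring_mat TYPE('a) n ()" by (rule ring_mat)
  interpret G: group "GL n :: 'a mat monoid" unfolding GL_def by (rule R.units_group)
  have *: "X \<in> carrier (GL n)" "Y \<in> carrier (GL n)"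
    unfolding GL_def units_of_carrier Units_def using c inv by (auto simp: ring_mat_simps)
  show "X \<in> carrier (GL n)" by (rule *(1))
  show "inv\<^bsub>GL n\<^esub> X = Y"
    by (rule G.inv_equality) (use * inv in \<open>auto simp: GL_def units_of_mult units_of_one ring_mat_simps\<close>)
qed

lemma GL_simps: "X \<otimes>\<^bsub>GL n\<^esub> Y = X * Y" "\<one>\<^bsub>GL n\<^esub> = 1\<^sub>m n"
  by (simp_all add: GL_def units_of_mult units_of_one ring_mat_simps)

lemma group_GL: "group (GL n :: 'a::comm_ring_1 mat monoid)"
proof -
  interpret R: ring "ring_mat TYPE('a) n ()" by (rule ring_mat)
  show ?thesis unfolding GL_def by (rule R.units_group)
qed

lemma GL_D:
  fixes X :: "'a::comm_ring_1 mat"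
  assumes "X \<in> carrier (GL n)"
  shows "X \<in> carrier_mat n n" "inv\<^bsub>GL n\<^esub> X \<in> carrier (GL n)" "inv\<^bsub>GL n\<^esub> X \<in> carrier_mat n n"
    "X * inv\<^bsub>GL n\<^esub> X = 1\<^sub>m n" "inv\<^bsub>GL n\<^esub> X * X = 1\<^sub>m n"
proof -
  interpret G: group "GL n :: 'a mat monoid" by (rule group_GL)
  have car: "Y \<in> carrier_mat n n" if "Y \<in> carrier (GL n)" for Y :: "'a mat"
    using that unfolding GL_def units_of_carrier Units_def by (auto simp: ring_mat_simps)
  show "X \<in> carrier_mat n n" "inv\<^bsub>GL n\<^esub> X \<in> carrier (GL n)" "inv\<^bsub>GL n\<^esub> X \<in> carrier_mat n n"
    using car assms by auto
  show "X * inv\<^bsub>GL n\<^esub> X = 1\<^sub>m n" "inv\<^bsub>GL n\<^esub> X * X = 1\<^sub>m n"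
    using G.r_inv[OF assms] G.l_inv[OF assms] by (simp_all add: GL_simps)
qed

lemma borel_one: "1\<^sub>m n \<in> borel n"
  using GL_I(1)[of "1\<^sub>m n :: complex mat" n "1\<^sub>m n"] by (simp add: borel_def)

lemma borel_inverse: "b \<in> borel n \<Longrightarrow> upper_triangular (inv\<^bsub>GL n\<^esub> b)"
proof -
  assume b: "b \<in> borel n"
  then have G: "b \<in> carrier (GL n)" and u: "upper_triangular b" by (auto simp: borel_def)
  have "det (inv\<^bsub>GL n\<^esub> b) * det b = 1"
    using det_mult[OF GL_D(3)[OF G] GL_D(1)[OF G]] GL_D(5)[OF G] by simp
  then have "det b \<noteq> 0" by auto
  then show ?thesis
    by (intro upper_triangular_right_factor[OF GL_D(5)[OF G] GL_D(3,1)[OF G] u]) auto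
qed

lemma coset_eq_borel:
  assumes "M <#\<^bsub>GL n\<^esub> borel n = X <#\<^bsub>GL n\<^esub> borel n" "X \<in> carrier_mat n n"
  shows "\<exists>b\<in>borel n. X = M * b"
proof -
  have "X = X * 1\<^sub>m n" using assms(2) by simp
  then have "X \<in> X <#\<^bsub>GL n\<^esub> borel n" unfolding l_coset_def GL_simps using borel_one[of n] by auto
  then have "X \<in> M <#\<^bsub>GL n\<^esub> borel n" by (simp only: assms(1))
  then show ?thesis unfolding l_coset_def GL_simps by auto
qed

lemma lower_unipotent_iff: "M \<in> lower_unipotent n \<longleftrightarrow> lower_unitri n M"
proof -
  have shift: "(\<forall>i\<in>{1..n}. P i) \<longleftrightarrow> (\<forall>i<n. P (Suc i))" for P
    by (auto simp: Suc_le_eq gr0_conv_Suc elim!: ballE)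
  show ?thesis
    unfolding lower_unipotent_def lower_unitri_def shift by (auto simp: entry_def)
qed

lemma reg_nilpotent_supdiag: "reg_nilpotent n = supdiag n"
  by (rule eq_matI) (auto simp: reg_nilpotent_def supdiag_def matrix_of_def)

section \<open>The chart at w and its Hessenberg patch in coordinates\<close>

locale hessenberg_chart =
  fixes n :: nat and h w :: "nat \<Rightarrow> nat"
  assumes n_pos: "1 \<le> n" and hess: "hessenberg_function n h" and indec: "indecomposable n h"
    and w: "w permutes {1..n}"
begin

text \<open>The passage from indices starting at 1 to indices starting at 0. On the relevant range
  the values of \<open>h\<close> are at least 1, so the truncated subtraction is exact.\<close>

definition h0 :: "nat \<Rightarrow> nat" where
  "h0 j = h (j + 1) - 1"

lemma h_range: "1 \<le> j \<Longrightarrow> j \<le> n \<Longrightarrow> 1 \<le> h j \<and> h j \<le> n"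
  using hess by (force simp: hessenberg_function_def)

sublocale hessenberg_fun n h0
proof
  show "h0 j < n" if "j < n" for j using h_range[of "j + 1"] that by (auto simp: h0_def)
  show "Suc j \<le> h0 j" if "Suc j < n" for j
    using indec that by (force simp: indecomposable_def h0_def)
  show "h0 i \<le> h0 j" if "i \<le> j" "j < n" for i j
    using that
  proof (induction j rule: dec_induct)
    case (step j)
    have "h (j + 1) \<le> h (j + 1 + 1)" using hess step by (simp add: hessenberg_function_def)
    then show ?case using step by (simp add: h0_def)
  qed simp
qed

definition \<sigma> :: "nat \<Rightarrow> nat" where
  "\<sigma> i = w (i + 1) - 1"

abbreviation Q :: "complex mat" where
  "Q \<equiv> perm_matrix n w"

abbreviation Q' :: "complex mat" where
  "Q' \<equiv> transpose_mat Q"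

abbreviation E :: "complex mat" where
  "E \<equiv> Q' * supdiag n * Q"

abbreviation R :: "cpoly ring" where
  "R \<equiv> coord_poly_ring n w"

definition X :: "(nat \<times> nat \<Rightarrow> complex) \<Rightarrow> complex mat" where
  "X a = Q * umat n a"

definition flag :: "(nat \<times> nat \<Rightarrow> complex) \<Rightarrow> complex mat set" where
  "flag a = X a <#\<^bsub>GL n\<^esub> borel n"

definition ev :: "cpoly \<Rightarrow> (nat \<times> nat \<Rightarrow> complex) \<Rightarrow> complex" where
  "ev p a = poly_eval (entry (X a)) p"

lemma w_range: "1 \<le> i \<Longrightarrow> i \<le> n \<Longrightarrow> 1 \<le> w i \<and> w i \<le> n"
  using permutes_in_image[OF w, of i] by auto

lemma w_inj: "w i = w j \<longleftrightarrow> i = j"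
  using permutes_inj[OF w] by (auto dest: injD)

lemma \<sigma>_less: "i < n \<Longrightarrow> \<sigma> i < n"
  using w_range[of "i + 1"] by (auto simp: \<sigma>_def)

lemma \<sigma>_w: "i < n \<Longrightarrow> \<sigma> i + 1 = w (i + 1)"
  using w_range[of "i + 1"] by (simp add: \<sigma>_def)

lemma \<sigma>_surj: "r < n \<Longrightarrow> \<exists>i<n. r = \<sigma> i"
proof -
  assume r: "r < n"
  then have "r + 1 \<in> w ` {1..n}" using permutes_image[OF w] by auto
  then obtain i where "r + 1 = w i" "1 \<le> i" "i \<le> n" by auto
  then show ?thesis by (intro exI[of _ "i - 1"]) (auto simp: \<sigma>_def)
qed

lemma Q_carrier [simp]: "Q \<in> carrier_mat n n" "Q' \<in> carrier_mat n n"
  by (auto simp: perm_matrix_def matrix_of_def)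

lemma Q_entry: "i < n \<Longrightarrow> j < n \<Longrightarrow> Q $$ (i, j) = (if i = \<sigma> j then 1 else 0)"
  using \<sigma>_w[of j] by (auto simp: perm_matrix_def matrix_of_def)

lemma Q_mult:
  assumes "Y \<in> carrier_mat n n" "i < n" "j < n"
  shows "(Q * Y) $$ (\<sigma> i, j) = Y $$ (i, j)"
proof -
  have "(Q * Y) $$ (\<sigma> i, j) = (\<Sum>k<n. Q $$ (\<sigma> i, k) * Y $$ (k, j))"
    by (intro mat_mult_index[of _ n n _ n]) (use assms \<sigma>_less in auto)
  also have "\<dots> = (\<Sum>k<n. if k = i then Y $$ (i, j) else 0)"
  proof (intro sum.cong refl)
    fix k assume "k \<in> {..<n}"
    then have "\<sigma> i = \<sigma> k \<longleftrightarrow> k = i" using \<sigma>_w[of i] \<sigma>_w[of k] w_inj assms(2) by (metis add_right_cancel lessThan_iff)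
    then show "Q $$ (\<sigma> i, k) * Y $$ (k, j) = (if k = i then Y $$ (i, j) else 0)"
      using \<open>k \<in> {..<n}\<close> assms \<sigma>_less[of i] by (simp add: Q_entry)
  qed
  finally show ?thesis using assms by simp
qed

lemma QQ': "Q' * Q = 1\<^sub>m n" "Q * Q' = 1\<^sub>m n"
proof -
  show 1: "Q' * Q = 1\<^sub>m n"
  proof (rule eq_matI)
    fix i j assume "i < dim_row (1\<^sub>m n)" "j < dim_col (1\<^sub>m n)"
    then have ij: "i < n" "j < n" by auto
    have "(Q' * Q) $$ (i, j) = (\<Sum>k<n. Q' $$ (i, k) * Q $$ (k, j))"
      by (intro mat_mult_index[of _ n n _ n]) (use ij in auto)
    also have "\<dots> = (\<Sum>k<n. if k = \<sigma> i then Q $$ (\<sigma> i, j) else 0)"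
      using ij carrier_matD[OF Q_carrier(1)] by (intro sum.cong) (auto simp: Q_entry)
    also have "\<dots> = (Q * 1\<^sub>m n) $$ (\<sigma> i, j)" using \<sigma>_less[OF ij(1)] by (simp add: right_mult_one_mat[OF Q_carrier(1)])
    also have "\<dots> = 1\<^sub>m n $$ (i, j)" by (rule Q_mult[OF one_carrier_mat ij])
    finally show "(Q' * Q) $$ (i, j) = 1\<^sub>m n $$ (i, j)" .
  qed (auto simp: perm_matrix_def matrix_of_def)
  show "Q * Q' = 1\<^sub>m n" by (rule mat_mult_left_right_inverse[OF Q_carrier(2,1) 1])
qed

lemma X_carrier [simp]: "X a \<in> carrier_mat n n"
  unfolding X_def by (rule mult_carrier_mat[OF Q_carrier(1) umat_carrier])

lemma X_entry: "i < n \<Longrightarrow> j < n \<Longrightarrow> X a $$ (\<sigma> i, j) = umat n a $$ (i, j)"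
  unfolding X_def by (rule Q_mult[OF umat_carrier])

lemma X_inverse:
  "X a \<in> carrier (GL n)" "inv\<^bsub>GL n\<^esub> (X a) = adj_mat (umat n a) * Q'"
proof -
  have c: "adj_mat (umat n a) * Q' \<in> carrier_mat n n" by (rule mult_carrier_mat[OF adj_umat Q_carrier(2)])
  have "X a * (adj_mat (umat n a) * Q') = Q * ((umat n a * adj_mat (umat n a)) * Q')"
    unfolding X_def by (simp add: assoc_mult_mat[of _ n n _ n _ n] mult_carrier_mat[of _ n n _ n] del: adj_umat_mult)
  then have 1: "X a * (adj_mat (umat n a) * Q') = 1\<^sub>m n" by (simp add: QQ' left_mult_one_mat[OF Q_carrier(2)])
  have 2: "(adj_mat (umat n a) * Q') * X a = 1\<^sub>m n"
    by (rule mat_mult_left_right_inverse[OF X_carrier c 1])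
  show "X a \<in> carrier (GL n)" "inv\<^bsub>GL n\<^esub> (X a) = adj_mat (umat n a) * Q'"
    by (rule GL_I[OF X_carrier c 1 2])+
qed

lemma X_conj: "adj_mat (umat n a) * Q' * supdiag n * X a = uconj n E a"
  unfolding X_def uconj_def by (simp add: assoc_mult_mat[of _ n n _ n _ n] mult_carrier_mat[of _ n n _ n])

lemma E_carrier [simp]: "E \<in> carrier_mat n n"
  using mult_carrier_mat[OF mult_carrier_mat[OF Q_carrier(2) supdiag_carrier] Q_carrier(1)] .

lemma reduced_E: "reduced E"
  by (rule reduced_chart[where \<sigma> = \<sigma>]) (use n_pos QQ' \<sigma>_less Q_mult in auto)

lemma chart_eq: "chart n w = range flag"
proof -
  have "chart n w \<subseteq> range flag"
  proof
    fix P assume "P \<in> chart n w"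
    then obtain M where "lower_unitri n M" "P = (Q * M) <#\<^bsub>GL n\<^esub> borel n"
      by (auto simp: chart_def lower_unipotent_iff)
    then have "P = flag (\<lambda>(i, j). M $$ (i, j))"
      unfolding flag_def X_def by (simp only: umat_of_lower_unitri)
    then show "P \<in> range flag" by blast
  qed
  moreover have "flag a \<in> chart n w" for a
    unfolding chart_def flag_def X_def by (auto simp: lower_unipotent_iff intro!: exI[of _ "umat n a"])
  ultimately show ?thesis by blast
qed

text \<open>Two representatives in w U^- of one flag differ by a matrix that is upper triangular and
  lower unitriangular, hence the identity; this justifies the definite description.\<close>

lemma chart_representative_flag: "chart_representative n w (flag a) = X a"
  unfolding chart_representative_def
proof (rule the_equality)
  show "(\<exists>M\<in>lower_unipotent n. X a = Q * M) \<and> flag a = X a <#\<^bsub>GL n\<^esub> borel n"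
    by (auto simp: flag_def X_def lower_unipotent_iff intro!: bexI[of _ "umat n a"])
  fix Y assume Y: "(\<exists>M\<in>lower_unipotent n. Y = Q * M) \<and> flag a = Y <#\<^bsub>GL n\<^esub> borel n"
  then obtain M where M: "lower_unitri n M" "Y = Q * M" by (auto simp: lower_unipotent_iff)
  then have Mc: "M \<in> carrier_mat n n" by (simp add: lower_unitri_def)
  obtain b where b: "b \<in> borel n" "X a = Y * b"
    using coset_eq_borel[of n Y "X a"] Y by (auto simp: flag_def)
  have bc: "b \<in> carrier_mat n n" using b GL_D(1) by (auto simp: borel_def)
  have cancel: "Q' * (Q * Z) = Z" if "Z \<in> carrier_mat n n" for Z
    using assoc_mult_mat[OF Q_carrier(2,1) that] left_mult_one_mat[OF that] by (simp add: QQ')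
  have "Q * umat n a = Q * (M * b)"
    using b(2) M(2) by (simp add: X_def assoc_mult_mat[OF Q_carrier(1) Mc bc])
  then have UMb: "umat n a = M * b"
    using cancel[OF umat_carrier] cancel[OF mult_carrier_mat[OF Mc bc]] by metis
  have "b = adj_mat M * (M * b)"
    using lower_unitri_adj[OF M(1)] Mc bc by (simp add: assoc_mult_mat[symmetric])
  then have "b = adj_mat M * umat n a" by (simp add: UMb)
  then have "lower_unitri n b"
    using lower_unitri_mult[OF lower_unitri_adj(4)[OF M(1)] lower_unitri_umat] by simp
  moreover have "upper_triangular b" using b by (simp add: borel_def)
  ultimately have "b = 1\<^sub>m n"
    by (intro eq_matI) (auto simp: lower_unitri_def upper_triangular_def, metis linorder_neqE_nat)
  then show "Y = X a"
    using b(2) M(2) right_mult_one_mat[OF mult_carrier_mat[OF Q_carrier(1) Mc]] by simp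
qed

lemma poly_fun_flag: "poly_fun n w p (flag a) = ev p a"
  by (simp add: poly_fun_def ev_def chart_representative_flag)

lemma hess_space_iff:
  assumes "A \<in> carrier_mat n n"
  shows "A \<in> hessenberg_space n h \<longleftrightarrow> (\<forall>v\<in>below. A $$ v = 0)"
proof
  assume A: "A \<in> hessenberg_space n h"
  show "\<forall>v\<in>below. A $$ v = 0"
  proof clarify
    fix i j assume "(i, j) \<in> below"
    then have "i + 1 \<in> {1..n}" "j + 1 \<in> {1..n}" "h (j + 1) < i + 1" by (auto simp: below_def h0_def)
    then have "entry A (i + 1) (j + 1) = 0" using A unfolding hessenberg_space_def by blast
    then show "A $$ (i, j) = 0" by (simp add: entry_def)
  qed
next
  assume *: "\<forall>v\<in>below. A $$ v = 0"
  have "entry A i j = 0" if "i \<in> {1..n}" "j \<in> {1..n}" "h j < i" for i j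
  proof -
    have "(i - 1, j - 1) \<in> below" using that h_range[of j] by (auto simp: below_def h0_def)
    then show ?thesis using * by (auto simp: entry_def)
  qed
  then show "A \<in> hessenberg_space n h" using assms by (simp add: hessenberg_space_def)
qed

text \<open>\<open>Hess\<close> asks for some representative of the flag that conjugates N into
  H(h), while the chart supplies a particular one. They differ by an element of the Borel group,
  under whose conjugation H(h) is stable.\<close>

lemma hess_patch_eq: "hess_patch n w h = flag ` hZ E"
proof -
  have hZ_iff: "a \<in> hZ E \<longleftrightarrow> uconj n E a \<in> hessenberg_space n h" for a
    by (auto simp: hess_space_iff hZ_def uconj_fun_def)
  have conj_eq: "inv\<^bsub>GL n\<^esub> (X a) * reg_nilpotent n * X a = uconj n E a" for a
    by (simp add: X_inverse reg_nilpotent_supdiag X_conj)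
  have "flag a \<in> Hess n h \<longleftrightarrow> a \<in> hZ E" for a
  proof
    assume "a \<in> hZ E"
    then have "inv\<^bsub>GL n\<^esub> (X a) * reg_nilpotent n * X a \<in> hessenberg_space n h"
      by (simp add: conj_eq hZ_iff)
    moreover have "flag a \<in> flags n" using X_inverse(1) by (auto simp: flags_def LCOSETS_def flag_def)
    ultimately show "flag a \<in> Hess n h" using X_inverse(1) by (auto simp: Hess_def flag_def)
  next
    assume "flag a \<in> Hess n h"
    then obtain M where M: "M \<in> carrier (GL n)" "flag a = M <#\<^bsub>GL n\<^esub> borel n"
      "inv\<^bsub>GL n\<^esub> M * reg_nilpotent n * M \<in> hessenberg_space n h" by (auto simp: Hess_def)
    obtain b where b: "b \<in> borel n" "X a = M * b"
      using coset_eq_borel[of n M "X a"] M(2) by (auto simp: flag_def)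
    have bG: "b \<in> carrier (GL n)" and bu: "upper_triangular b" using b by (auto simp: borel_def)
    let ?Mi = "inv\<^bsub>GL n\<^esub> M" and ?bi = "inv\<^bsub>GL n\<^esub> b"
    note cM = GL_D[OF M(1)] and cb = GL_D[OF bG]
    interpret G: group "GL n :: complex mat monoid" by (rule group_GL)
    have inv: "inv\<^bsub>GL n\<^esub> (M * b) = ?bi * ?Mi"
      using G.inv_mult_group[OF M(1) bG] by (simp add: GL_simps)
    have "uconj n E a = ?bi * (?Mi * reg_nilpotent n * M) * b"
      unfolding conj_eq[symmetric] b(2) inv reg_nilpotent_supdiag using cM cb
      by (simp add: assoc_mult_mat[of _ n n _ n _ n] mult_carrier_mat[of _ n n _ n])
    moreover have "?Mi * reg_nilpotent n * M \<in> carrier_mat n n" using M(3) by (simp add: hessenberg_space_def)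
    ultimately show "a \<in> hZ E"
      unfolding hZ_def uconj_fun_def
      using upper_conj_below[OF cb(3) _ cb(1) borel_inverse[OF b(1)] bu] M(3)
      by (auto simp: hess_space_iff intro!: sum.neutral)
  qed
  then show ?thesis by (auto simp: hess_patch_def chart_eq)
qed

section \<open>The coordinate ring of the chart as a ring of functions\<close>

lemma R_simps: "p \<otimes>\<^bsub>R\<^esub> q = p * q" "p \<oplus>\<^bsub>R\<^esub> q = p + q" "\<one>\<^bsub>R\<^esub> = 1" "\<zero>\<^bsub>R\<^esub> = 0"
  "p \<in> carrier R \<longleftrightarrow> (\<forall>m\<in>Poly_Mapping.keys p. Poly_Mapping.keys m \<subseteq> free_positions n w)"
  by (auto simp: coord_poly_ring_def)

lemma R_closed:
  "p \<in> carrier R \<Longrightarrow> q \<in> carrier R \<Longrightarrow> p + q \<in> carrier R"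
  "p \<in> carrier R \<Longrightarrow> q \<in> carrier R \<Longrightarrow> p * q \<in> carrier R"
  "p \<in> carrier R \<Longrightarrow> - p \<in> carrier R"
  "Poly_Mapping.single 0 c \<in> carrier R" "0 \<in> carrier R" "1 \<in> carrier R"
proof -
  show "p + q \<in> carrier R" if "p \<in> carrier R" "q \<in> carrier R"
    using that Poly_Mapping.keys_add[of p q] unfolding R_simps by blast
  show "p * q \<in> carrier R" if pq: "p \<in> carrier R" "q \<in> carrier R"
    unfolding R_simps
  proof
    fix m assume "m \<in> Poly_Mapping.keys (p * q)"
    then obtain m1 m2 where "m = m1 + m2" "m1 \<in> Poly_Mapping.keys p" "m2 \<in> Poly_Mapping.keys q"
      using Poly_Mapping.keys_mult[of p q] by blast
    then show "Poly_Mapping.keys m \<subseteq> free_positions n w"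
      using pq Poly_Mapping.keys_add[of m1 m2] unfolding R_simps by blast
  qed
  show "- p \<in> carrier R" if "p \<in> carrier R" using that by (simp add: R_simps keys_minus)
  show "Poly_Mapping.single 0 c \<in> carrier R" for c by (auto simp: R_simps)
  show "0 \<in> carrier R" "1 \<in> carrier R" by (auto simp: R_simps)
qed

lemma R_sum: "(\<And>i. i \<in> T \<Longrightarrow> f i \<in> carrier R) \<Longrightarrow> sum f T \<in> carrier R"
  by (induction T rule: infinite_finite_induct) (auto intro: R_closed)

sublocale R: cring R
proof (rule cringI)
  show "abelian_group R"
    by (rule abelian_groupI) (auto simp: R_simps(1-4) algebra_simps intro: R_closed bexI[of _ "- _"])
  show "comm_monoid R"
    by unfold_locales (auto simp: R_simps(1-4) algebra_simps intro: R_closed)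
qed (simp add: R_simps(1-4) distrib_right)

lemma ev_hom: "ev (p + q) a = ev p a + ev q a" "ev (p * q) a = ev p a * ev q a" "ev 1 a = 1" "ev 0 a = 0"
  "ev (- p) a = - ev p a" "ev (p - q) a = ev p a - ev q a" "ev (sum f T) a = (\<Sum>i\<in>T. ev (f i) a)"
  by (simp_all add: ev_def poly_eval_add poly_eval_mult poly_eval_one poly_eval_zero poly_eval_sum
      poly_eval.hom_uminus poly_eval.hom_minus)

lemma entry_X_free:
  assumes "i \<in> {1..n}" "j \<in> {1..n}" "j < i"
  shows "entry (X a) (w i) j = a (i - 1, j - 1)"
proof -
  have "X a $$ (\<sigma> (i - 1), j - 1) = umat n a $$ (i - 1, j - 1)" using assms by (intro X_entry) auto
  then show ?thesis using assms by (auto simp: entry_def \<sigma>_def umat_def)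
qed

lemma ev_pf:
  assumes "p \<in> carrier R"
  shows "ev p \<in> pf (lcoords n)"
proof -
  have "(\<lambda>a. \<Sum>m\<in>Poly_Mapping.keys p. Poly_Mapping.lookup p m *
      (\<Prod>v\<in>Poly_Mapping.keys m. entry (X a) (fst v) (snd v) ^ Poly_Mapping.lookup m v)) \<in> pf (lcoords n)"
  proof (intro pfa.sum pf.mult pf.const pfa.prod pfa.power)
    fix m v assume "m \<in> Poly_Mapping.keys p" "v \<in> Poly_Mapping.keys m"
    then have "v \<in> free_positions n w" using assms unfolding R_simps by blast
    then obtain i j where v: "v = (w i, j)" and ij: "i \<in> {1..n}" "j \<in> {1..n}" "j < i"
      by (auto simp: free_positions_def)
    have "(i - 1, j - 1) \<in> lcoords n" using ij by (auto simp: lcoords_def)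
    then show "(\<lambda>a. entry (X a) (fst v) (snd v)) \<in> pf (lcoords n)"
      unfolding v fst_conv snd_conv entry_X_free[OF ij] by (rule pf.var)
  qed
  then show ?thesis by (simp add: ev_def[abs_def] poly_eval_def case_prod_beta)
qed

lemma poly_var_carrier: "(i, j) \<in> free_positions n w \<Longrightarrow> poly_var i j \<in> carrier R"
  by (auto simp: R_simps poly_var_def)

text \<open>With \<open>ev_pf\<close> and \<open>ev_inj\<close> this makes \<open>ev\<close> an
  isomorphism of the coordinate ring onto \<open>pf (lcoords n)\<close>: the free entry (w(i), j) of
  X is the entry (i, j) of M, with indices shifted by one.\<close>

lemma ev_surjective: "f \<in> pf (lcoords n) \<Longrightarrow> \<exists>p\<in>carrier R. ev p = f"
proof (induction rule: pf.induct)
  case (const c)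
  have "ev (Poly_Mapping.single 0 c) = (\<lambda>_. c)"
    by (intro ext) (simp add: ev_def poly_eval_single monomial_eval_def)
  then show ?case using R_closed(4) by blast
next
  case (var v)
  then obtain i j where ij: "v = (i, j)" "j < i" "i < n" by (auto simp: lcoords_def)
  have fr: "(w (i + 1), j + 1) \<in> free_positions n w"
    unfolding free_positions_def using ij by (auto intro!: exI[of _ "i + 1"])
  have "ev (poly_var (w (i + 1)) (j + 1)) = (\<lambda>a. a v)"
    using ij entry_X_free[of "i + 1" "j + 1"] by (intro ext) (simp add: ev_def poly_eval_var)
  then show ?case using poly_var_carrier[OF fr] by blast
next
  case (add f g)
  then obtain p q where "p \<in> carrier R" "q \<in> carrier R" "ev p = f" "ev q = g" by blast
  then show ?case by (intro bexI[of _ "p + q"]) (auto simp: ev_hom intro: R_closed)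
next
  case (mult f g)
  then obtain p q where "p \<in> carrier R" "q \<in> carrier R" "ev p = f" "ev q = g" by blast
  then show ?case by (intro bexI[of _ "p * q"]) (auto simp: ev_hom intro: R_closed)
qed

lemma ev_zero:
  assumes p: "p \<in> carrier R" and "\<And>a. ev p a = 0"
  shows "p = 0"
proof (rule poly_eval_injective)
  show "finite (free_positions n w)"
    by (rule finite_subset[of _ "(\<lambda>(i, j). (w i, j)) ` ({1..n} \<times> {1..n})"]) (auto simp: free_positions_def)
  show "Poly_Mapping.keys m \<subseteq> free_positions n w" if "m \<in> Poly_Mapping.keys p" for m
    using p that by (simp add: R_simps)
  fix b :: "nat \<Rightarrow> nat \<Rightarrow> complex"
  define a where "a = (\<lambda>(i, j). b (w (i + 1)) (j + 1))"
  have "poly_eval b p = ev p a"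
    unfolding ev_def poly_eval_def
  proof (intro sum.cong refl arg_cong2[of _ _ _ _ "(*)"] prod.cong)
    fix m v assume "m \<in> Poly_Mapping.keys p" "v \<in> Poly_Mapping.keys m"
    then have "v \<in> free_positions n w" using p unfolding R_simps by blast
    then obtain i j where v: "v = (w i, j)" and ij: "i \<in> {1..n}" "j \<in> {1..n}" "j < i"
      by (auto simp: free_positions_def)
    then show "(case v of (i, j) \<Rightarrow> b i j ^ Poly_Mapping.lookup m (i, j)) =
        (case v of (i, j) \<Rightarrow> entry (X a) i j ^ Poly_Mapping.lookup m (i, j))"
      by (simp add: v entry_X_free a_def)
  qed
  then show "poly_eval b p = 0" using assms(2) by simp
qed

lemma ev_inj: "p \<in> carrier R \<Longrightarrow> q \<in> carrier R \<Longrightarrow> ev p = ev q \<Longrightarrow> p = q"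
proof -
  assume "p \<in> carrier R" "q \<in> carrier R" "ev p = ev q"
  then have "p + - q = 0" by (intro ev_zero R_closed) (simp_all add: ev_hom)
  then show "p = q" by simp
qed

lemma generic_matrix_entry:
  assumes "i < n" "j < n"
  shows "generic_matrix n w $$ (i, j) \<in> carrier R" "ev (generic_matrix n w $$ (i, j)) a = X a $$ (i, j)"
proof -
  obtain k where k: "k < n" "i = \<sigma> k" using \<sigma>_surj[OF assms(1)] by blast
  have ik: "Suc i = w (k + 1)" using \<sigma>_w[OF k(1)] k(2) by simp
  have free: "(Suc i, Suc j) \<in> free_positions n w \<longleftrightarrow> j < k"
    using k assms w_inj unfolding ik free_positions_def by auto
  have G: "generic_matrix n w $$ (i, j) =
      (if k = j then 1 else if j < k then poly_var (Suc i) (Suc j) else 0)"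
    using assms free ik w_inj[of "k + 1" "Suc j"] by (auto simp: generic_matrix_def matrix_of_def)
  show "generic_matrix n w $$ (i, j) \<in> carrier R"
    using free by (auto simp: G intro: R_closed poly_var_carrier)
  have "ev (poly_var (Suc i) (Suc j)) a = X a $$ (i, j)"
    by (simp add: ev_def poly_eval_var entry_def)
  then show "ev (generic_matrix n w $$ (i, j)) a = X a $$ (i, j)"
    using X_entry[OF k(1) assms(2), of a] assms k(1) unfolding G k(2)[symmetric]
    by (auto simp: ev_hom umat_def)
qed

lemma generic_matrix_carrier: "generic_matrix n w \<in> carrier_mat n n"
  by (simp add: generic_matrix_def matrix_of_def)

lemma mat_mult_carrier_ev:
  assumes "A \<in> carrier_mat n n" "B \<in> carrier_mat n n"
    and "\<And>i j. i < n \<Longrightarrow> j < n \<Longrightarrow> A $$ (i, j) \<in> carrier R \<and> (\<forall>a. ev (A $$ (i, j)) a = A' a $$ (i, j))"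
    and "\<And>i j. i < n \<Longrightarrow> j < n \<Longrightarrow> B $$ (i, j) \<in> carrier R \<and> (\<forall>a. ev (B $$ (i, j)) a = B' a $$ (i, j))"
    and "\<And>a. A' a \<in> carrier_mat n n" "\<And>a. B' a \<in> carrier_mat n n" and "i < n" "j < n"
  shows "(A * B) $$ (i, j) \<in> carrier R \<and> (\<forall>a. ev ((A * B) $$ (i, j)) a = (A' a * B' a) $$ (i, j))"
  unfolding mat_mult_index[OF assms(1,2,7,8)] mat_mult_index[OF assms(5,6,7,8)]
  using assms(3,4,7,8) by (auto intro!: R_sum R_closed simp: ev_hom)

text \<open>The inverse in \<open>hess_poly\<close> is formed over the ring of all polynomials. A
  candidate is found by lifting the entries of the inverse of X(a), which are polynomial functions,
  through \<open>ev_surjective\<close>; that both products are the identity is checked on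
  values.\<close>

lemma hess_poly_ev:
  assumes ij: "i < n" "j < n"
  shows "hess_poly n w (i + 1) (j + 1) \<in> carrier R" "ev (hess_poly n w (i + 1) (j + 1)) = uconj_fun n E (i, j)"
proof -
  let ?G = "generic_matrix n w"
  have Xi: "adj_mat (umat n a) * Q' \<in> carrier_mat n n" for a
    by (rule mult_carrier_mat[OF adj_umat Q_carrier(2)])
  have "\<exists>p\<in>carrier R. ev p = (\<lambda>a. (adj_mat (umat n a) * Q') $$ (i, j))" if "i < n" "j < n" for i j
  proof (rule ev_surjective, rule pfa.mat_mult[where n = n])
    show "(\<lambda>a. adj_mat (umat n a) $$ (k, l)) \<in> pf (lcoords n)" if "k < n" "l < n" for k l
      by (rule pfa.adj_mat[where n = n]) (use that in \<open>auto intro: umat_entry_pf\<close>)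
  qed (use that in \<open>auto intro: pf.const\<close>)
  then obtain g where g: "\<And>i j. i < n \<Longrightarrow> j < n \<Longrightarrow>
      g i j \<in> carrier R \<and> ev (g i j) = (\<lambda>a. (adj_mat (umat n a) * Q') $$ (i, j))" by metis
  define Gi where "Gi = Matrix.mat n n (\<lambda>(i, j). g i j)"
  have Gic: "Gi \<in> carrier_mat n n" by (simp add: Gi_def)
  have Gi_ev: "Gi $$ (i, j) \<in> carrier R \<and> (\<forall>a. ev (Gi $$ (i, j)) a = (adj_mat (umat n a) * Q') $$ (i, j))"
    if "i < n" "j < n" for i j using g[OF that] that by (simp add: Gi_def)
  have G_ev: "?G $$ (i, j) \<in> carrier R \<and> (\<forall>a. ev (?G $$ (i, j)) a = X a $$ (i, j))" if "i < n" "j < n" for i j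
    using generic_matrix_entry[OF that] by simp
  note XX = GL_D(4,5)[OF X_inverse(1), unfolded X_inverse(2)]
  have one: "A = 1\<^sub>m n"
    if "A \<in> carrier_mat n n" and A: "\<And>i j. i < n \<Longrightarrow> j < n \<Longrightarrow> A $$ (i, j) \<in> carrier R \<and> (\<forall>a. ev (A $$ (i, j)) a = 1\<^sub>m n $$ (i, j))" for A
  proof (rule eq_matI)
    fix i j assume "i < dim_row (1\<^sub>m n)" "j < dim_col (1\<^sub>m n)"
    then have ij: "i < n" "j < n" by auto
    show "A $$ (i, j) = 1\<^sub>m n $$ (i, j)"
      by (rule ev_inj) (use A[OF ij] ij in \<open>auto simp: fun_eq_iff ev_hom intro: R_closed\<close>)
  qed (use that in auto)
  have "?G * Gi = 1\<^sub>m n"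
    using mat_mult_carrier_ev[OF generic_matrix_carrier Gic G_ev Gi_ev X_carrier Xi]
    by (intro one mult_carrier_mat[OF generic_matrix_carrier Gic]) (simp add: XX)
  moreover have "Gi * ?G = 1\<^sub>m n"
    using mat_mult_carrier_ev[OF Gic generic_matrix_carrier Gi_ev G_ev Xi X_carrier]
    by (intro one mult_carrier_mat[OF Gic generic_matrix_carrier]) (simp add: XX)
  ultimately have inv: "inv\<^bsub>GL n\<^esub> ?G = Gi" by (rule GL_I(2)[OF generic_matrix_carrier Gic])
  have Nc: "reg_nilpotent n \<in> carrier_mat n n" by (simp add: reg_nilpotent_def matrix_of_def)
  have N_ev: "(reg_nilpotent n :: cpoly mat) $$ (i, j) \<in> carrier R \<and>
      (\<forall>a. ev (reg_nilpotent n $$ (i, j)) a = supdiag n $$ (i, j))" if "i < n" "j < n" for i j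
    using that by (auto simp: reg_nilpotent_def matrix_of_def supdiag_def ev_hom intro: R_closed)
  have 1: "(Gi * reg_nilpotent n) $$ (i, j) \<in> carrier R \<and>
      (\<forall>a. ev ((Gi * reg_nilpotent n) $$ (i, j)) a = (adj_mat (umat n a) * Q' * supdiag n) $$ (i, j))"
    if "i < n" "j < n" for i j
    by (rule mat_mult_carrier_ev[OF Gic Nc Gi_ev N_ev Xi supdiag_carrier that])
  have "(Gi * reg_nilpotent n * ?G) $$ (i, j) \<in> carrier R \<and>
      (\<forall>a. ev ((Gi * reg_nilpotent n * ?G) $$ (i, j)) a = (adj_mat (umat n a) * Q' * supdiag n * X a) $$ (i, j))"
    by (rule mat_mult_carrier_ev[OF mult_carrier_mat[OF Gic Nc] generic_matrix_carrier 1 G_ev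
        mult_carrier_mat[OF Xi supdiag_carrier] X_carrier ij])
  then show "hess_poly n w (i + 1) (j + 1) \<in> carrier R" "ev (hess_poly n w (i + 1) (j + 1)) = uconj_fun n E (i, j)"
    by (auto simp: hess_poly_def entry_def inv uconj_fun_def X_conj)
qed

section \<open>The Hessenberg ideal, its zero set and its quotient\<close>

definition gens :: "cpoly set" where
  "gens = {hess_poly n w i j | i j. i \<in> {1..n} \<and> j \<in> {1..n} \<and> i > h j}"

lemma gens_eq: "gens = (\<lambda>(i, j). hess_poly n w (i + 1) (j + 1)) ` below"
proof -
  have "hess_poly n w i j \<in> (\<lambda>(i, j). hess_poly n w (i + 1) (j + 1)) ` below"
    if "i \<in> {1..n}" "j \<in> {1..n}" "h j < i" for i j
    using that h_range[of j] by (intro image_eqI[of _ _ "(i - 1, j - 1)"]) (auto simp: below_def h0_def)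
  moreover have "hess_poly n w (i + 1) (j + 1) \<in> gens" if "(i, j) \<in> below" for i j
    unfolding gens_def using that
    by (intro CollectI exI[of _ "i + 1"] exI[of _ "j + 1"]) (auto simp: below_def h0_def)
  ultimately show ?thesis by (auto simp: gens_def)
qed

lemma gens_carrier: "gens \<subseteq> carrier R"
  unfolding gens_eq using hess_poly_ev(1) by (auto simp: below_def)

lemma hess_ideal_gens: "hess_ideal n w h = Idl\<^bsub>R\<^esub> gens"
  by (simp add: hess_ideal_def gens_def)

lemma ideal_hess: "ideal (hess_ideal n w h) R"
  unfolding hess_ideal_gens by (rule R.genideal_ideal[OF gens_carrier])

lemma hJ_vanish: "f \<in> hJ E \<Longrightarrow> a \<in> hZ E \<Longrightarrow> f a = 0"
  unfolding hJ_def by (induction rule: idl.induct) (auto simp: hZ_def)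

text \<open>The generators correspond under \<open>ev\<close>. One direction is minimality of the
  generated ideal; the other lifts a combination of generators summand by summand and concludes by
  injectivity.\<close>

lemma hess_ideal_iff: "p \<in> hess_ideal n w h \<longleftrightarrow> p \<in> carrier R \<and> ev p \<in> hJ E"
proof
  interpret J: fun_ideal "pf (lcoords n)" "hJ E" by (rule fun_ideal_hJ[OF E_carrier])
  interpret I: ideal "hess_ideal n w h" R by (rule ideal_hess)
  let ?K = "{p \<in> carrier R. ev p \<in> hJ E}"
  have "ideal ?K R"
  proof (rule idealI[OF R.ring_axioms])
    show "subgroup ?K (add_monoid R)"
    proof (rule R.add.subgroupI)
      show "?K \<noteq> {}" using R_closed(5) J.ideal_zero by (auto simp: ev_hom[abs_def])
      fix p q assume p: "p \<in> ?K" and q: "q \<in> ?K"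
      show "p \<oplus>\<^bsub>R\<^esub> q \<in> ?K"
        using p q J.ideal_add[of "ev p" "ev q"] by (auto simp: R_simps(1-4) ev_hom[abs_def] intro: R_closed)
      have "\<ominus>\<^bsub>R\<^esub> p = - p"
        by (rule R.minus_equality) (use p in \<open>auto simp: R_simps(1-4) intro: R_closed\<close>)
      then show "\<ominus>\<^bsub>R\<^esub> p \<in> ?K"
        using p J.ideal_uminus[of "ev p"] by (auto simp: ev_hom[abs_def] intro: R_closed)
    qed auto
    fix p q assume p: "p \<in> ?K" and q: "q \<in> carrier R"
    have "(\<lambda>a. ev q a * ev p a) \<in> hJ E" using p q ev_pf by (intro J.ideal_mult) auto
    then show "q \<otimes>\<^bsub>R\<^esub> p \<in> ?K" "p \<otimes>\<^bsub>R\<^esub> q \<in> ?K"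
      using p q by (auto simp: R_simps(1-4) ev_hom[abs_def] mult.commute intro: R_closed)
  qed
  moreover have "gens \<subseteq> ?K"
    using gens_carrier hess_poly_ev(2) unfolding gens_eq hJ_def
    by (auto simp: below_def intro!: pfa.idl_gen)
  ultimately have "hess_ideal n w h \<subseteq> ?K" unfolding hess_ideal_gens by (rule R.genideal_minimal)
  then show "p \<in> carrier R \<and> ev p \<in> hJ E" if "p \<in> hess_ideal n w h" using that by blast
  have gen_in: "gens \<subseteq> hess_ideal n w h" unfolding hess_ideal_gens by (rule R.genideal_self[OF gens_carrier])
  have "\<exists>p\<in>hess_ideal n w h. ev p = f" if "f \<in> hJ E" for f
    using that unfolding hJ_def
  proof (induction rule: idl.induct)
    case zero
    have "ev 0 = (\<lambda>_. 0)" by (simp add: ev_hom[abs_def])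
    then show ?case using I.zero_closed by (auto simp: R_simps(1-4))
  next
    case (step g f r)
    obtain g' where g': "g' \<in> carrier R" "ev g' = g" using ev_surjective[OF step.hyps(1)] by blast
    obtain i j where ij: "(i, j) \<in> below" "f = uconj_fun n E (i, j)" using step.hyps(2) by auto
    let ?f = "hess_poly n w (i + 1) (j + 1)"
    have f': "?f \<in> hess_ideal n w h" "ev ?f = f"
      using gen_in ij hess_poly_ev(2)[of i j] by (auto simp: gens_eq below_def)
    obtain r' where r': "r' \<in> hess_ideal n w h" "ev r' = r" using step.IH by blast
    have "g' * ?f + r' \<in> hess_ideal n w h"
      using I.a_closed[OF I.I_l_closed[OF f'(1) g'(1)] r'(1)] by (simp add: R_simps(1-4))
    moreover have "ev (g' * ?f + r') = (\<lambda>a. g a * f a + r a)"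
      using g' f' r' by (simp add: ev_hom[abs_def])
    ultimately show ?case by blast
  qed
  note lift = this
  show "p \<in> hess_ideal n w h" if p: "p \<in> carrier R \<and> ev p \<in> hJ E"
  proof -
    obtain p' where p': "p' \<in> hess_ideal n w h" "ev p' = ev p" using lift[of "ev p"] p by blast
    have "p' = p" by (rule ev_inj[OF I.a_Hcarr[OF p'(1)] _ p'(2)]) (use p in blast)
    then show ?thesis using p'(1) by simp
  qed
qed

lemma vanishing_iff: "p \<in> carrier R \<Longrightarrow> p \<in> hess_ideal n w h \<longleftrightarrow> (\<forall>a\<in>hZ E. ev p a = 0)"
  using reduced_E ev_pf[of p] hJ_vanish unfolding hess_ideal_iff reduced_def by blast

lemma defining_ideal: "is_defining_ideal n w (hess_ideal n w h) (hess_patch n w h)"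
  unfolding is_defining_ideal_def
proof
  have "a \<in> hZ E \<longleftrightarrow> (\<forall>p\<in>hess_ideal n w h. ev p a = 0)" for a
  proof
    assume *: "\<forall>p\<in>hess_ideal n w h. ev p a = 0"
    show "a \<in> hZ E"
      unfolding hZ_def
    proof (clarify)
      fix i j assume ij: "(i, j) \<in> below"
      then have "hess_poly n w (i + 1) (j + 1) \<in> hess_ideal n w h"
        using R.genideal_self[OF gens_carrier] unfolding hess_ideal_gens gens_eq by auto
      then show "uconj_fun n E (i, j) a = 0"
        using * hess_poly_ev(2)[of i j] ij by (auto simp: below_def)
    qed
  qed (auto simp: hess_ideal_iff hJ_vanish)
  then show "hess_patch n w h = zero_locus n w (hess_ideal n w h)"
    by (auto simp: hess_patch_eq zero_locus_def chart_eq poly_fun_flag)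
  show "hess_ideal n w h = vanishing_ideal n w (hess_patch n w h)"
    using vanishing_iff by (auto simp: vanishing_ideal_def hess_patch_eq poly_fun_flag hess_ideal_iff)
qed

lemma radical: "radical_ideal R (hess_ideal n w h)"
  unfolding radical_ideal_def
proof (intro conjI ideal_hess ballI allI impI)
  fix p and k :: nat
  assume p: "p \<in> carrier R" and pk: "p [^]\<^bsub>R\<^esub> k \<in> hess_ideal n w h"
  have "ev (p [^]\<^bsub>R\<^esub> k) a = ev p a ^ k" for a
    by (induction k) (auto simp: R_simps(1-4) ev_hom)
  moreover have "\<forall>a\<in>hZ E. ev (p [^]\<^bsub>R\<^esub> k) a = 0"
    using pk vanishing_iff[of "p [^]\<^bsub>R\<^esub> k"] p by auto
  \<comment> \<open>For k = 0 the power is 1, so the zero set is empty and \<open>p\<close> lies in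
    the ideal as well.\<close>
  ultimately show "p \<in> hess_ideal n w h" using vanishing_iff[OF p] by auto
qed

text \<open>Restriction of polynomial functions to the patch is onto the coordinate ring and has the
  Hessenberg ideal as kernel, by \<open>vanishing_iff\<close>; the first isomorphism theorem
  applies. The ring axioms of the target hold because it is a homomorphic image.\<close>

lemma quotient_iso:
  "\<exists>\<phi>\<in>ring_iso (R Quot hess_ideal n w h) (coordinate_ring n w (hess_patch n w h)).
     \<forall>p\<in>carrier R. \<phi> (hess_ideal n w h +>\<^bsub>R\<^esub> p) = restrict (poly_fun n w p) (hess_patch n w h)"
proof -
  let ?Z = "hess_patch n w h" and ?S = "coordinate_ring n w (hess_patch n w h)"
  define \<psi> where "\<psi> = (\<lambda>p. restrict (poly_fun n w p) ?Z)"
  have S: "carrier ?S = \<psi> ` carrier R" "f \<otimes>\<^bsub>?S\<^esub> g = (\<lambda>P\<in>?Z. f P * g P)" "f \<oplus>\<^bsub>?S\<^esub> g = (\<lambda>P\<in>?Z. f P + g P)"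
    "\<one>\<^bsub>?S\<^esub> = (\<lambda>P\<in>?Z. 1)" "\<zero>\<^bsub>?S\<^esub> = (\<lambda>P\<in>?Z. 0)" for f g
    by (auto simp: coordinate_ring_def \<psi>_def)
  have pf_hom: "poly_fun n w (p + q) P = poly_fun n w p P + poly_fun n w q P"
    "poly_fun n w (p * q) P = poly_fun n w p P * poly_fun n w q P"
    "poly_fun n w 1 P = 1" "poly_fun n w 0 P = 0" for p q P
    by (simp_all add: poly_fun_def poly_eval_add poly_eval_mult poly_eval_one poly_eval_zero)
  have hom: "\<psi> \<in> Ring.ring_hom R ?S"
    by (rule ring_hom_memI) (auto simp: S R_simps(1-4) \<psi>_def pf_hom)
  have zero: "\<psi> \<zero>\<^bsub>R\<^esub> = \<zero>\<^bsub>?S\<^esub>" unfolding S(5) R_simps(4) \<psi>_def by (rule restrict_ext) (simp add: pf_hom)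
  have "ring (?S \<lparr>carrier := \<psi> ` carrier R, zero := \<psi> \<zero>\<^bsub>R\<^esub>\<rparr>)"
    by (rule R.ring_hom_imp_img_ring[OF hom])
  then have "ring ?S" unfolding zero S(1)[symmetric] by simp
  interpret \<psi>: ring_hom_ring R ?S \<psi> by (rule ring_hom_ringI2[OF R.ring_axioms \<open>ring ?S\<close> hom])
  have "\<psi> p = \<zero>\<^bsub>?S\<^esub> \<longleftrightarrow> (\<forall>a\<in>hZ E. ev p a = 0)" for p
  proof
    assume *: "\<psi> p = \<zero>\<^bsub>?S\<^esub>"
    show "\<forall>a\<in>hZ E. ev p a = 0"
    proof
      fix a assume "a \<in> hZ E"
      then show "ev p a = 0"
        using fun_cong[OF *[unfolded S(5) \<psi>_def], of "flag a"] by (simp add: hess_patch_eq poly_fun_flag)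
    qed
  next
    assume *: "\<forall>a\<in>hZ E. ev p a = 0"
    show "\<psi> p = \<zero>\<^bsub>?S\<^esub>"
      unfolding S(5) \<psi>_def
      by (rule restrict_ext) (use * in \<open>auto simp: hess_patch_eq poly_fun_flag\<close>)
  qed
  then have "a_kernel R ?S \<psi> = {p \<in> carrier R. \<forall>a\<in>hZ E. ev p a = 0}"
    by (simp only: a_kernel_def')
  also have "\<dots> = hess_ideal n w h"
    using vanishing_iff hess_ideal_iff by blast
  finally have ker: "a_kernel R ?S \<psi> = hess_ideal n w h" .
  have "(\<lambda>Y. the_elem (\<psi> ` Y)) \<in> ring_iso (R Quot hess_ideal n w h) ?S"
    using \<psi>.FactRing_iso_set[OF S(1)[symmetric]] unfolding ker .
  moreover have "the_elem (\<psi> ` (hess_ideal n w h +>\<^bsub>R\<^esub> p)) = \<psi> p" if "p \<in> carrier R" for p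
    using \<psi>.the_elem_simp[OF that] unfolding ker .
  ultimately have "\<exists>\<phi>\<in>ring_iso (R Quot hess_ideal n w h) ?S.
      \<forall>p\<in>carrier R. \<phi> (hess_ideal n w h +>\<^bsub>R\<^esub> p) = \<psi> p"
    by (intro bexI[of _ "\<lambda>Y. the_elem (\<psi> ` Y)"] ballI) assumption+
  then show ?thesis unfolding \<psi>_def .
qed

end

theorem proposition3p7:
  fixes n :: nat and h w :: "nat \<Rightarrow> nat"
  assumes "n \<ge> 1"
    and "hessenberg_function n h" and "indecomposable n h"
    and "w permutes {1..n}"
  shows
    "(\<exists>\<phi> \<in> ring_iso (coord_poly_ring n w Quot hess_ideal n w h)
                    (coordinate_ring n w (hess_patch n w h)).
        \<forall>p \<in> carrier (coord_poly_ring n w).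
          \<phi> (hess_ideal n w h +>\<^bsub>coord_poly_ring n w\<^esub> p)
            = restrict (poly_fun n w p) (hess_patch n w h)) \<and>
     radical_ideal (coord_poly_ring n w) (hess_ideal n w h) \<and>
     is_defining_ideal n w (hess_ideal n w h) (hess_patch n w h)"
proof -
  interpret hessenberg_chart n h w by unfold_locales (fact assms)+
  show ?thesis using quotient_iso radical defining_ideal by blast
qed

end
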